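(* Let $n \in \mathbb{N}$, $n \ge 1$, and let $s \in \left(0, \frac{n}{2}\right)$, $t \in \left(0, \frac{n}{2}\right)$ satisfy $s > t$. Then for any number $\varepsilon \in \left(0, \frac{n}{s} - 2\right)$ there exists a distribution $$u_{\varepsilon} \in H^t_{\frac{n}{s} - \varepsilon,\, unif}(\mathbb{R}^n) \setminus M[H^s_2(\mathbb{R}^n) \to H^t_2(\mathbb{R}^n)].$$
   Context: Notation: $\mathcal{D}(\mathbb{R}^n)$ is the space of infinitely differentiable complex-valued functions with compact support, $\mathcal{D}'(\mathbb{R}^n)$ its dual space of distributions, $\mathcal{S}'(\mathbb{R}^n)$ the space of tempered distributions. For a locally integrable function $f$ (of at most polynomial growth outside some ball) $\mathbf{f}$ denotes the regular distribution $\mathbf{f}(\varphi) = \int_{\mathbb{R}^n} f \varphi \, d\mu_n$, where $\mu_n$ is Lebesgue measure. The Fourier transform is $(\mathcal{F} f)(x) = (2\pi)^{-n/2}\int_{\mathbb{R}^n} e^{-i\langle x, y\rangle} f(y)\, dy$, extended by duality to $\mathcal{S}'(\mathbb{R}^n)$. $B_r(\mathbf{0})$ is the open ball of radius $r$ centred at the origin. Bessel potential spaces: for $p \in [1,+\infty)$, $H^0_p(\mathbb{R}^n)$ is the set of regular distributions $\mathbf{f}$ generated by $f \in L_p(\mathbb{R}^n)$, with norm $\|\mathbf{f}\|_{H^0_p} = \|f\|_{L_p}$. For $s \in \mathbb{R}$, $J_s(u) = \mathcal{F}^{-1}(\varphi_s \cdot \mathcal{F}(u))$ for $u \in \mathcal{S}'(\mathbb{R}^n)$,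 where $\varphi_s(x) = (1+|x|^2)^{s/2}$; $H^s_p(\mathbb{R}^n) = \{u \in \mathcal{S}'(\mathbb{R}^n) : J_s(u) \in H^0_p(\mathbb{R}^n)\}$ with norm $\|u\|_{H^s_p} = \|J_s(u)\|_{H^0_p}$. Local spaces: $H^s_{p,\,loc}(\mathbb{R}^n) = \{u \in \mathcal{D}'(\mathbb{R}^n) : f\cdot u \in H^s_p(\mathbb{R}^n)\ \text{for all } f \in \mathcal{D}(\mathbb{R}^n)\}$. Uniformly localized Bessel potential spaces: fix $\eta \in \mathcal{D}(\mathbb{R}^n)$ with $0 \leqslant \eta \leqslant 1$ on $\mathbb{R}^n$, $\eta = 1$ on $B_1(\mathbf{0})$, $\eta = 0$ on $\mathbb{R}^n \setminus B_2(\mathbf{0})$, and let $\eta_{(z)}(x) = \eta(x - z)$. Then $H^s_{p,\,unif}(\mathbb{R}^n)$ is the set of $u \in H^s_{p,\,loc}(\mathbb{R}^n)$ with $\|u\|_{H^s_{p,\,unif}} = \sup_{z \in \mathbb{R}^n} \|\eta_{(z)} \cdot u\|_{H^s_p} < +\infty$. Different admissible choices of $\eta$ give the same space with equivalent norms. Multipliers: for $s,t \in \mathbb{R}$, $p,q \in (1,+\infty)$, a distribution $\mu \in H^t_{q,\,loc}(\mathbb{R}^n)$ is a multiplier from $H^s_p(\mathbb{R}^n)$ to $H^t_q(\mathbb{R}^n)$ if there is $C \in [0,+\infty)$ with $\|f\cdot\mu\|_{H^t_q} \leqslant C \|\mathbf{f}\|_{H^s_p}$ for all $f \in \mathcal{D}(\mathbb{R}^n)$.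 The set of all such multipliers is $M[H^s_p(\mathbb{R}^n) \to H^t_q(\mathbb{R}^n)]$. *)

theory Defs
  imports "HOL-Analysis.Analysis"
begin

definition partial_deriv :: "'a::euclidean_space \<Rightarrow> ('a \<Rightarrow> complex) \<Rightarrow> 'a \<Rightarrow> complex" where
  "partial_deriv b f = (\<lambda>x. frechet_derivative f (at x) b)"

text \<open>Multi-indices are encoded as lists of coordinate directions, i.e. lists over \<^const>\<open>Basis\<close>.\<close>

definition iter_deriv :: "'a::euclidean_space list \<Rightarrow> ('a \<Rightarrow> complex) \<Rightarrow> 'a \<Rightarrow> complex" where
  "iter_deriv bs f = foldr partial_deriv bs f"

definition smooth :: "('a::euclidean_space \<Rightarrow> complex) \<Rightarrow> bool" where
  "smooth f \<longleftrightarrow> (\<forall>bs\<in>lists Basis. \<forall>x. iter_deriv bs f differentiable (at x))"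

definition fun_support :: "('a::euclidean_space \<Rightarrow> complex) \<Rightarrow> 'a set" where
  "fun_support f = closure {x. f x \<noteq> 0}"

definition test_functions :: "('a::euclidean_space \<Rightarrow> complex) set" where
  "test_functions = {f. smooth f \<and> compact (fun_support f)}"

definition schwartz_functions :: "('a::euclidean_space \<Rightarrow> complex) set" where
  "schwartz_functions = {f. smooth f \<and>
     (\<forall>(k::nat). \<forall>bs\<in>lists Basis. bounded (range (\<lambda>x. (1 + norm x) ^ k *\<^sub>R iter_deriv bs f x)))}"

definition test_converges ::
    "(nat \<Rightarrow> 'a::euclidean_space \<Rightarrow> complex) \<Rightarrow> ('a \<Rightarrow> complex) \<Rightarrow> bool" where
  "test_converges F f \<longleftrightarrow>
     (\<exists>K. compact K \<and> (\<forall>j. fun_support (F j) \<subseteq> K)) \<and>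
     (\<forall>bs\<in>lists Basis. uniform_limit UNIV (\<lambda>j. iter_deriv bs (F j)) (iter_deriv bs f) sequentially)"

definition schwartz_converges ::
    "(nat \<Rightarrow> 'a::euclidean_space \<Rightarrow> complex) \<Rightarrow> ('a \<Rightarrow> complex) \<Rightarrow> bool" where
  "schwartz_converges F f \<longleftrightarrow>
     (\<forall>(k::nat). \<forall>bs\<in>lists Basis.
        uniform_limit UNIV (\<lambda>j x. (1 + norm x) ^ k *\<^sub>R iter_deriv bs (F j) x)
          (\<lambda>x. (1 + norm x) ^ k *\<^sub>R iter_deriv bs f x) sequentially)"


text \<open>
  A distribution is represented by a functional on all complex-valued functions, of which only the
  values on the respective space of test functions (compactly supported, or Schwartz) are
  meaningful; all notions below depend on these values only.
  Continuity of a linear functional on either space is equivalent to sequential continuity.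
\<close>

type_synonym 'a functional = "('a \<Rightarrow> complex) \<Rightarrow> complex"

definition linear_functional_on :: "('a \<Rightarrow> complex) set \<Rightarrow> 'a functional \<Rightarrow> bool" where
  "linear_functional_on X u \<longleftrightarrow>
     (\<forall>f\<in>X. \<forall>g\<in>X. \<forall>a b. u (\<lambda>x. a * f x + b * g x) = a * u f + b * u g)"

definition distributions :: "'a::euclidean_space functional set" where
  "distributions = {u. linear_functional_on test_functions u \<and>
     (\<forall>F f. range F \<subseteq> test_functions \<and> f \<in> test_functions \<and> test_converges F f \<longrightarrow>
        (\<lambda>j. u (F j)) \<longlonglongrightarrow> u f)}"

definition tempered_distributions :: "'a::euclidean_space functional set" where
  "tempered_distributions = {u. linear_functional_on schwartz_functions u \<and>
     (\<forall>F f. range F \<subseteq> schwartz_functions \<and> f \<in> schwartz_functions \<and> schwartz_converges F f \<longrightarrow>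
        (\<lambda>j. u (F j)) \<longlonglongrightarrow> u f)}"

definition regular_dist :: "('a::euclidean_space \<Rightarrow> complex) \<Rightarrow> 'a functional" where
  "regular_dist f = (\<lambda>\<phi>. \<integral>x. f x * \<phi> x \<partial>lborel)"

text \<open>
  If \<open>f\<close> is a compactly supported test function and \<open>u\<close> a distribution, then \<open>f \<phi>\<close> is a test
  function for every Schwartz function \<open>\<phi>\<close>. The formula therefore gives \<open>f \<cdot> u\<close> directly as a
  tempered distribution, namely the unique continuous extension of the usual product.
\<close>

definition mult_dist :: "('a \<Rightarrow> complex) \<Rightarrow> 'a functional \<Rightarrow> 'a functional" where
  "mult_dist g u = (\<lambda>\<phi>. u (\<lambda>x. g x * \<phi> x))"

definition fourier :: "('a::euclidean_space \<Rightarrow> complex) \<Rightarrow> 'a \<Rightarrow> complex" where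
  "fourier f = (\<lambda>x. complex_of_real ((2 * pi) powr (- real DIM('a) / 2)) *
     (\<integral>y. exp (- (\<i> * complex_of_real (x \<bullet> y))) * f y \<partial>lborel))"

definition inv_fourier :: "('a::euclidean_space \<Rightarrow> complex) \<Rightarrow> 'a \<Rightarrow> complex" where
  "inv_fourier f = (\<lambda>x. complex_of_real ((2 * pi) powr (- real DIM('a) / 2)) *
     (\<integral>y. exp (\<i> * complex_of_real (x \<bullet> y)) * f y \<partial>lborel))"

definition fourier_dist :: "'a::euclidean_space functional \<Rightarrow> 'a functional" where
  "fourier_dist u = (\<lambda>\<phi>. u (fourier \<phi>))"

definition inv_fourier_dist :: "'a::euclidean_space functional \<Rightarrow> 'a functional" where
  "inv_fourier_dist u = (\<lambda>\<phi>. u (inv_fourier \<phi>))"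


definition Lp_functions :: "real \<Rightarrow> ('a::euclidean_space \<Rightarrow> complex) set" where
  "Lp_functions p =
     {f \<in> borel_measurable lborel. integrable lborel (\<lambda>x. norm (f x) powr p)}"

definition Lp_norm :: "real \<Rightarrow> ('a::euclidean_space \<Rightarrow> complex) \<Rightarrow> real" where
  "Lp_norm p f = (\<integral>x. norm (f x) powr p \<partial>lborel) powr (1 / p)"

definition generates :: "('a::euclidean_space \<Rightarrow> complex) \<Rightarrow> 'a functional \<Rightarrow> bool" where
  "generates f v \<longleftrightarrow> (\<forall>\<phi>\<in>schwartz_functions. v \<phi> = regular_dist f \<phi>)"

definition H0_space :: "real \<Rightarrow> 'a::euclidean_space functional set" where
  "H0_space p = {v. \<exists>f\<in>Lp_functions p. generates f v}"

text \<open>The generating function is unique almost everywhere, so the choice is immaterial.\<close>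

definition H0_norm :: "real \<Rightarrow> 'a::euclidean_space functional \<Rightarrow> real" where
  "H0_norm p v = Lp_norm p (SOME f. f \<in> Lp_functions p \<and> generates f v)"

definition bessel_weight :: "real \<Rightarrow> 'a::euclidean_space \<Rightarrow> complex" where
  "bessel_weight s = (\<lambda>x. complex_of_real ((1 + (norm x)\<^sup>2) powr (s / 2)))"

definition bessel_J :: "real \<Rightarrow> 'a::euclidean_space functional \<Rightarrow> 'a functional" where
  "bessel_J s u = inv_fourier_dist (mult_dist (bessel_weight s) (fourier_dist u))"

definition H_space :: "real \<Rightarrow> real \<Rightarrow> 'a::euclidean_space functional set" where
  "H_space s p = {u \<in> tempered_distributions. bessel_J s u \<in> H0_space p}"

definition H_norm :: "real \<Rightarrow> real \<Rightarrow> 'a::euclidean_space functional \<Rightarrow> real" where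
  "H_norm s p u = H0_norm p (bessel_J s u)"

definition H_loc :: "real \<Rightarrow> real \<Rightarrow> 'a::euclidean_space functional set" where
  "H_loc s p = {u \<in> distributions. \<forall>f\<in>test_functions. mult_dist f u \<in> H_space s p}"


definition unif_cutoff :: "('a::euclidean_space \<Rightarrow> real) \<Rightarrow> bool" where
  "unif_cutoff \<eta> \<longleftrightarrow> (\<lambda>x. complex_of_real (\<eta> x)) \<in> test_functions \<and>
     (\<forall>x. 0 \<le> \<eta> x \<and> \<eta> x \<le> 1) \<and>
     (\<forall>x\<in>ball 0 1. \<eta> x = 1) \<and> (\<forall>x. x \<notin> ball 0 2 \<longrightarrow> \<eta> x = 0)"

definition H_unif_norm ::
    "('a::euclidean_space \<Rightarrow> real) \<Rightarrow> real \<Rightarrow> real \<Rightarrow> 'a functional \<Rightarrow> ennreal" where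
  "H_unif_norm \<eta> s p u =
     (SUP z. ennreal (H_norm s p (mult_dist (\<lambda>x. complex_of_real (\<eta> (x - z))) u)))"

definition H_unif ::
    "('a::euclidean_space \<Rightarrow> real) \<Rightarrow> real \<Rightarrow> real \<Rightarrow> 'a functional set" where
  "H_unif \<eta> s p = {u \<in> H_loc s p. H_unif_norm \<eta> s p u < \<infinity>}"

text \<open>\<open>multipliers s p t q\<close> is the space of multipliers from \<open>H_space s p\<close> to \<open>H_space t q\<close>.\<close>

definition multipliers ::
    "real \<Rightarrow> real \<Rightarrow> real \<Rightarrow> real \<Rightarrow> 'a::euclidean_space functional set" where
  "multipliers s p t q = {\<mu> \<in> H_loc t q. \<exists>C\<ge>0. \<forall>f\<in>test_functions.
     H_norm t q (mult_dist f \<mu>) \<le> C * H_norm s p (regular_dist f)}"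

end

theory Submission imports Defs begin

text \<open>
  Write \<open>n\<close> for the dimension and \<open>p = n / s - \<epsilon>\<close>, so that \<open>2 < p < n / s\<close>. The counterexample is a
  superposition \<open>u = (\<Sum>k. a k * bump k)\<close> of copies of the cutoff \<open>\<eta>\<close>, shrunk to width
  \<open>l = 1 / (k + 1)\<close> and placed at centres which are far apart, with heights
  \<open>a k = l powr (t - n / p)\<close>.

  Everything rests on the scaling of the norms for \<open>l \<le> 1\<close>: a bump of height \<open>1\<close> and width \<open>l\<close> has a
  norm of order \<open>l powr (n / p - r)\<close> in the Bessel potential space of order \<open>r\<close> and exponent \<open>p\<close>. Any
  ball of radius \<open>2\<close> meets at most one bump, so the choice of \<open>a k\<close> makes the uniformly localised norm of
  \<open>u\<close> finite. On the other hand, the product of \<open>u\<close> with the \<open>k\<close>-th bump is the squared bump times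
  \<open>a k\<close>, whose \<open>L2\<close>-based norm of order \<open>t\<close> is at least of order
  \<open>a k * l powr (n / 2 - t) = l powr (n / 2 - n / p)\<close>, while the bump itself has norm of order at most
  \<open>l powr (n / 2 - s)\<close> in the space of order \<open>s\<close>. The quotient \<open>l powr (s - n / p)\<close> is unbounded as
  \<open>l\<close> tends to \<open>0\<close>, because \<open>p < n / s\<close>.

  The upper bound (\<open>H_norm_bump_le\<close>) follows from the decay of the Fourier transform of a bump
  (\<open>osc_bump_decay\<close>): the Bessel potential is bounded by the \<open>L1\<close> norm of its transform, its \<open>L2\<close> norm
  is controlled by a Plancherel inequality (\<open>osc_L2_bound\<close>), and these two estimates interpolate to
  all \<open>p \<ge> 2\<close> (\<open>inv_fourier_Lp_bound\<close>). The lower bound (\<open>H_norm_bump_ge\<close>) pairs the Bessel potential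
  of the bump with the bump itself. Since the norm of a distribution is read off from an arbitrarily
  chosen generating function, both bounds also need that this function is unique almost
  everywhere (\<open>generates_unique\<close>).
\<close>


section \<open>Smooth functions and test functions\<close>

lemma iter_deriv_Nil [simp]: "iter_deriv [] f = f"
  by (simp add: iter_deriv_def)

lemma iter_deriv_Cons [simp]: "iter_deriv (b # bs) f = partial_deriv b (iter_deriv bs f)"
  by (simp add: iter_deriv_def)

lemma iter_deriv_append: "iter_deriv (bs @ cs) f = iter_deriv bs (iter_deriv cs f)"
  by (simp add: iter_deriv_def)

lemma smooth_differentiable: "smooth f \<Longrightarrow> f differentiable (at x)"
  unfolding smooth_def by (metis iter_deriv_Nil lists.Nil)

lemma smooth_iter_deriv: "smooth f \<Longrightarrow> bs \<in> lists Basis \<Longrightarrow> smooth (iter_deriv bs f)"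
  unfolding smooth_def by (auto simp flip: iter_deriv_append)

lemma smooth_partial_deriv: "smooth f \<Longrightarrow> b \<in> Basis \<Longrightarrow> smooth (partial_deriv b f)"
  using smooth_iter_deriv[of f "[b]"] by simp

lemma smooth_continuous: "smooth f \<Longrightarrow> continuous_on S f"
  by (simp add: smooth_differentiable differentiable_imp_continuous_within
      continuous_at_imp_continuous_on)

lemma smooth_measurable: "smooth f \<Longrightarrow> f \<in> borel_measurable borel"
  by (intro borel_measurable_continuous_onI smooth_continuous)

lemma has_derivative_partial_deriv:
  assumes "f differentiable (at x)"
  shows "(f has_derivative frechet_derivative f (at x)) (at x)"
  using assms by (simp add: frechet_derivative_works)

lemma partial_deriv_eq:
  "(f has_derivative f') (at x) \<Longrightarrow> partial_deriv b f x = f' b"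
  unfolding partial_deriv_def using frechet_derivative_at[of f f' x] by simp

text \<open>The encoding of smoothness by lists of directions becomes usable through this coinduction
  principle: a class of differentiable functions closed under partial derivatives consists of
  smooth functions.\<close>

lemma smooth_coinduct:
  assumes "P f" and "\<And>f x. P f \<Longrightarrow> f differentiable (at x)"
    and "\<And>f b. P f \<Longrightarrow> b \<in> Basis \<Longrightarrow> P (partial_deriv b f)"
  shows "smooth f"
proof -
  have "P (iter_deriv bs f)" if "bs \<in> lists Basis" for bs
    using that by induction (auto intro: assms)
  then show ?thesis by (auto simp: smooth_def intro: assms(2))
qed

text \<open>Sums and products of smooth functions; by the Leibniz rule this class is closed under partial
  derivatives, so that the coinduction principle applies to it.\<close>

inductive smooth_algebra :: "('a::euclidean_space \<Rightarrow> complex) \<Rightarrow> bool" where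
  base: "smooth f \<Longrightarrow> smooth_algebra f"
| sum: "smooth_algebra f \<Longrightarrow> smooth_algebra g \<Longrightarrow> smooth_algebra (\<lambda>x. f x + g x)"
| prod: "smooth_algebra f \<Longrightarrow> smooth_algebra g \<Longrightarrow> smooth_algebra (\<lambda>x. f x * g x)"

lemma partial_deriv_add:
  assumes "\<And>x. f differentiable (at x)" "\<And>x. g differentiable (at x)"
  shows "partial_deriv b (\<lambda>x. f x + g x) = (\<lambda>x. partial_deriv b f x + partial_deriv b g x)"
proof
  fix x
  show "partial_deriv b (\<lambda>x. f x + g x) x = partial_deriv b f x + partial_deriv b g x"
    using partial_deriv_eq[OF has_derivative_add[OF has_derivative_partial_deriv
          has_derivative_partial_deriv, OF assms], of b]
    by (simp add: partial_deriv_def)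
qed

lemma partial_deriv_mult:
  assumes "\<And>x. f differentiable (at x)" "\<And>x. g differentiable (at x)"
  shows "partial_deriv b (\<lambda>x. f x * g x) =
    (\<lambda>x. f x * partial_deriv b g x + partial_deriv b f x * g x)"
proof
  fix x
  show "partial_deriv b (\<lambda>x. f x * g x) x = f x * partial_deriv b g x + partial_deriv b f x * g x"
    using partial_deriv_eq[OF has_derivative_mult[OF has_derivative_partial_deriv
          has_derivative_partial_deriv, OF assms], of b]
    by (simp add: partial_deriv_def)
qed

lemma smooth_algebra_differentiable: "smooth_algebra f \<Longrightarrow> f differentiable (at x)"
  by (induction rule: smooth_algebra.induct) (auto intro: smooth_differentiable)

lemma smooth_algebra_smooth: "smooth_algebra f \<Longrightarrow> smooth f"
proof (erule smooth_coinduct)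
  fix f :: "'a \<Rightarrow> complex" and b :: 'a
  assume "smooth_algebra f" "b \<in> Basis"
  then show "smooth_algebra (partial_deriv b f)"
  proof (induction rule: smooth_algebra.induct)
    case (base f)
    then show ?case by (intro smooth_algebra.base smooth_partial_deriv)
  next
    case (sum f g)
    then show ?case
      by (simp add: partial_deriv_add smooth_algebra_differentiable smooth_algebra.sum)
  next
    case (prod f g)
    then show ?case
      by (simp add: partial_deriv_mult smooth_algebra_differentiable smooth_algebra.sum
          smooth_algebra.prod)
  qed
qed (rule smooth_algebra_differentiable)

lemma smooth_add: "smooth f \<Longrightarrow> smooth g \<Longrightarrow> smooth (\<lambda>x. f x + g x)"
  by (intro smooth_algebra_smooth[OF smooth_algebra.sum] smooth_algebra.base)

lemma smooth_mult: "smooth f \<Longrightarrow> smooth g \<Longrightarrow> smooth (\<lambda>x. f x * g x)"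
  by (intro smooth_algebra_smooth[OF smooth_algebra.prod] smooth_algebra.base)

lemma smooth_const: "smooth (\<lambda>x. c)"
proof (rule smooth_coinduct[where P="\<lambda>f. \<exists>c. f = (\<lambda>x. c)"])
  fix f :: "'a \<Rightarrow> complex" and b :: 'a
  assume "\<exists>c. f = (\<lambda>x. c)"
  then show "\<exists>c. partial_deriv b f = (\<lambda>x. c)"
    using partial_deriv_eq[OF has_derivative_const] by blast
qed auto

lemma smooth_sum: "(\<And>i. i \<in> I \<Longrightarrow> smooth (f i)) \<Longrightarrow> smooth (\<lambda>x. \<Sum>i\<in>I. f i x)"
  by (induction I rule: infinite_finite_induct) (auto intro: smooth_add smooth_const)

lemma smooth_prod: "(\<And>i. i \<in> I \<Longrightarrow> smooth (f i)) \<Longrightarrow> smooth (\<lambda>x. \<Prod>i\<in>I. f i x)"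
  by (induction I rule: infinite_finite_induct) (auto intro: smooth_mult smooth_const)

lemma differentiable_affine:
  fixes f :: "'a::euclidean_space \<Rightarrow> complex"
  assumes "\<And>x. f differentiable (at x)"
  shows "(\<lambda>x. f ((x - z) /\<^sub>R l)) differentiable (at x)"
    "partial_deriv b (\<lambda>x. f ((x - z) /\<^sub>R l)) = (\<lambda>x. partial_deriv b f ((x - z) /\<^sub>R l) /\<^sub>R l)"
proof -
  have D: "((\<lambda>x. f ((x - z) /\<^sub>R l)) has_derivative
      (\<lambda>v. frechet_derivative f (at ((x - z) /\<^sub>R l)) (v /\<^sub>R l))) (at x)" for x
    by (rule has_derivative_compose[of "\<lambda>x. (x - z) /\<^sub>R l"])
      (auto intro!: derivative_eq_intros has_derivative_partial_deriv assms)
  have "linear (frechet_derivative f (at y))" for y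
    using has_derivative_partial_deriv[OF assms] has_derivative_linear by blast
  then show "partial_deriv b (\<lambda>x. f ((x - z) /\<^sub>R l)) =
      (\<lambda>x. partial_deriv b f ((x - z) /\<^sub>R l) /\<^sub>R l)"
    using partial_deriv_eq[OF D] by (simp add: fun_eq_iff partial_deriv_def linear_scale)
  show "(\<lambda>x. f ((x - z) /\<^sub>R l)) differentiable (at x)"
    using D differentiable_def by blast
qed

lemma partial_deriv_scale:
  assumes "\<And>x. f differentiable (at x)"
  shows "partial_deriv b (\<lambda>x. c * f x) = (\<lambda>x. c * partial_deriv b f x)"
proof -
  have "partial_deriv b (\<lambda>x. c) = (\<lambda>x. 0)"
    using partial_deriv_eq[OF has_derivative_const] by (auto simp: fun_eq_iff)
  then show ?thesis using partial_deriv_mult[of "\<lambda>x. c" f b] assms by simp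
qed

lemma iter_deriv_scale:
  assumes "smooth f" "bs \<in> lists Basis"
  shows "iter_deriv bs (\<lambda>x. c * f x) = (\<lambda>x. c * iter_deriv bs f x)"
  using assms(2)
proof induction
  case (Cons b bs)
  then show ?case using partial_deriv_scale[of "iter_deriv bs f"] assms(1) by (simp add: smooth_def)
qed simp

lemma iter_deriv_add:
  assumes "smooth f" "smooth g" "bs \<in> lists Basis"
  shows "iter_deriv bs (\<lambda>x. f x + g x) = (\<lambda>x. iter_deriv bs f x + iter_deriv bs g x)"
  using assms(3)
proof induction
  case (Cons b bs)
  then show ?case using partial_deriv_add[of "iter_deriv bs f" "iter_deriv bs g"] assms
    by (simp add: smooth_def)
qed simp

lemma iter_deriv_affine:
  assumes "smooth f" "bs \<in> lists Basis"
  shows "iter_deriv bs (\<lambda>x. f ((x - z) /\<^sub>R l)) =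
    (\<lambda>x. iter_deriv bs f ((x - z) /\<^sub>R l) /\<^sub>R l ^ length bs)"
  using assms(2)
proof induction
  case (Cons b bs)
  let ?f = "iter_deriv bs f"
  have d: "?f differentiable (at x)" for x using assms(1) Cons by (simp add: smooth_def)
  have "partial_deriv b (\<lambda>x. complex_of_real (inverse (l ^ length bs)) * ?f ((x - z) /\<^sub>R l)) =
    (\<lambda>x. complex_of_real (inverse (l ^ length bs)) * (partial_deriv b ?f ((x - z) /\<^sub>R l) /\<^sub>R l))"
    by (subst partial_deriv_scale) (auto simp: differentiable_affine d)
  then show ?case using Cons by (simp add: scaleR_conv_of_real mult_ac)
qed simp

lemma smooth_affine: "smooth f \<Longrightarrow> smooth (\<lambda>x. f ((x - z) /\<^sub>R l))"
  unfolding smooth_def[of "\<lambda>x. f ((x - z) /\<^sub>R l)"]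
  by (simp add: iter_deriv_affine smooth_def[of f] differentiable_affine)

lemma test_functionsI:
  assumes "smooth f" "\<And>x. f x \<noteq> 0 \<Longrightarrow> norm x \<le> R"
  shows "f \<in> test_functions"
proof -
  have "fun_support f \<subseteq> cball 0 R"
    unfolding fun_support_def by (rule closure_minimal) (use assms in auto)
  then show ?thesis using assms(1)
    unfolding test_functions_def fun_support_def
    by (simp add: compact_eq_bounded_closed bounded_subset[OF bounded_cball])
qed

lemma test_functionsE:
  assumes "f \<in> test_functions"
  obtains R where "smooth f" "R > 0" "\<And>x. f x \<noteq> 0 \<Longrightarrow> norm x \<le> R"
proof -
  have "bounded (fun_support f)" using assms by (simp add: test_functions_def compact_imp_bounded)
  then obtain R where "R > 0" "\<And>x. x \<in> fun_support f \<Longrightarrow> norm x \<le> R"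
    unfolding bounded_pos by blast
  moreover have "x \<in> fun_support f" if "f x \<noteq> 0" for x
    using that closure_subset[of "{x. f x \<noteq> 0}"] unfolding fun_support_def by blast
  ultimately show thesis using assms by (intro that[of R]) (auto simp: test_functions_def)
qed

lemma test_functions_mult:
  "f \<in> test_functions \<Longrightarrow> smooth g \<Longrightarrow> (\<lambda>x. f x * g x) \<in> test_functions"
  by (erule test_functionsE, rule test_functionsI) (auto intro: smooth_mult)

lemma test_functions_scale: "f \<in> test_functions \<Longrightarrow> (\<lambda>x. c * f x) \<in> test_functions"
  using test_functions_mult[OF _ smooth_const, of f c] by (simp add: mult.commute[of c])

lemma test_functions_affine:
  assumes "f \<in> test_functions" "l \<noteq> 0"
  shows "(\<lambda>x. f ((x - z) /\<^sub>R l)) \<in> test_functions"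
proof -
  obtain R where R: "smooth f" "R > 0" "\<And>x. f x \<noteq> 0 \<Longrightarrow> norm x \<le> R"
    using assms(1) by (rule test_functionsE) blast
  show ?thesis
  proof (rule test_functionsI[where R="norm z + R * \<bar>l\<bar>"])
    fix x assume "f ((x - z) /\<^sub>R l) \<noteq> 0"
    then have "norm (x - z) / \<bar>l\<bar> \<le> R" using R(3)[of "(x - z) /\<^sub>R l"] by (simp add: divide_inverse mult.commute)
    then have "norm (x - z) \<le> R * \<bar>l\<bar>" using assms(2) by (simp add: pos_divide_le_eq)
    then show "norm x \<le> norm z + R * \<bar>l\<bar>" using norm_triangle_sub[of x z] by simp
  qed (use R in \<open>simp add: smooth_affine\<close>)
qed

lemma iter_deriv_eq_0_outside:
  assumes "smooth f" "open S" "\<And>x. x \<in> S \<Longrightarrow> f x = 0" "bs \<in> lists Basis" "x \<in> S"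
  shows "iter_deriv bs f x = 0"
  using assms(4,5)
proof (induction arbitrary: x)
  case (Cons b bs)
  have "(iter_deriv bs f has_derivative (\<lambda>_. 0)) (at x)"
    by (rule has_derivative_transform_within_open[of "\<lambda>_. 0" _ x UNIV S])
      (use Cons assms in auto)
  then show ?case by (simp add: partial_deriv_eq)
qed (use assms in auto)

lemma schwartz_smooth: "f \<in> schwartz_functions \<Longrightarrow> smooth f"
  by (simp add: schwartz_functions_def)

lemma schwartz_iter_deriv:
  "f \<in> schwartz_functions \<Longrightarrow> bs \<in> lists Basis \<Longrightarrow> iter_deriv bs f \<in> schwartz_functions"
  unfolding schwartz_functions_def by (auto simp: smooth_iter_deriv simp flip: iter_deriv_append)

lemma test_functions_schwartz:
  assumes "f \<in> test_functions"
  shows "f \<in> schwartz_functions"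
proof -
  obtain R where R: "smooth f" "R > 0" "\<And>x. f x \<noteq> 0 \<Longrightarrow> norm x \<le> R"
    using assms(1) by (rule test_functionsE) blast
  have "bounded (range (\<lambda>x. (1 + norm x) ^ k *\<^sub>R iter_deriv bs f x))" (is "bounded (range ?h)")
    if bs: "bs \<in> lists Basis" for k bs
  proof -
    have z: "iter_deriv bs f x = 0" if "x \<in> - cball 0 R" for x
      by (rule iter_deriv_eq_0_outside[OF R(1) _ _ bs that]) (use R(3) in \<open>force+\<close>)
    have "continuous_on (cball 0 R) ?h"
      by (intro continuous_intros smooth_continuous smooth_iter_deriv R bs)
    then have "bounded (?h ` cball 0 R)"
      by (intro compact_imp_bounded compact_continuous_image) auto
    moreover have "range ?h \<subseteq> insert 0 (?h ` cball 0 R)"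
    proof (rule image_subsetI)
      show "?h x \<in> insert 0 (?h ` cball 0 R)" for x using z[of x] by (cases "x \<in> cball 0 R") auto
    qed
    ultimately show ?thesis by (meson bounded_insert bounded_subset)
  qed
  then show ?thesis using R by (simp add: schwartz_functions_def)
qed

lemma schwartz_decay:
  fixes f :: "'a::euclidean_space \<Rightarrow> complex"
  assumes "f \<in> schwartz_functions"
  obtains C where "C > 0" "\<And>x. norm (f x) \<le> C / (1 + norm x) ^ k"
proof -
  have "bounded (range (\<lambda>x. (1 + norm x) ^ k *\<^sub>R f x))"
  proof -
    have "[] \<in> lists (Basis :: 'a set)" by simp
    then have "bounded (range (\<lambda>x. (1 + norm x) ^ k *\<^sub>R iter_deriv [] f x))"
      using assms unfolding schwartz_functions_def by blast
    then show ?thesis by simp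
  qed
  then obtain C where C: "C > 0" "\<And>x. norm ((1 + norm x) ^ k *\<^sub>R f x) \<le> C"
    unfolding bounded_pos by blast
  show thesis
  proof (rule that[OF C(1)])
    fix x :: 'a
    have "(1 + norm x) ^ k > 0" by (simp add: add_pos_nonneg)
    then show "norm (f x) \<le> C / (1 + norm x) ^ k"
      using C(2)[of x] by (simp add: pos_le_divide_eq mult.commute)
  qed
qed

text \<open>Control of derivatives up to order \<open>N\<close> at length scale \<open>l\<close>: the \<open>k\<close>-th derivatives have size
  at most \<open>A / l ^ k\<close>, as they do for the dilation of a fixed test function by \<open>l\<close>.\<close>

definition deriv_bounded :: "nat \<Rightarrow> real \<Rightarrow> real \<Rightarrow> ('a::euclidean_space \<Rightarrow> complex) \<Rightarrow> bool" where
  "deriv_bounded N l A f \<longleftrightarrow> smooth f \<and>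
     (\<forall>bs\<in>lists Basis. length bs \<le> N \<longrightarrow> (\<forall>x. norm (iter_deriv bs f x) \<le> A / l ^ length bs))"

lemma deriv_boundedD:
  "deriv_bounded N l A f \<Longrightarrow> bs \<in> lists Basis \<Longrightarrow> length bs \<le> N \<Longrightarrow>
    norm (iter_deriv bs f x) \<le> A / l ^ length bs"
  by (simp add: deriv_bounded_def)

lemma deriv_bounded_partial_deriv:
  assumes "deriv_bounded (Suc N) l A f" "b \<in> Basis"
  shows "deriv_bounded N l (A / l) (partial_deriv b f)"
  unfolding deriv_bounded_def
proof (intro conjI ballI impI allI)
  show "smooth (partial_deriv b f)" using assms by (simp add: deriv_bounded_def smooth_partial_deriv)
  fix bs x assume "bs \<in> lists (Basis :: 'a set)" "length bs \<le> N"
  then show "norm (iter_deriv bs (partial_deriv b f) x) \<le> A / l / l ^ length bs"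
    using deriv_boundedD[OF assms(1), of "bs @ [b]" x] assms(2) by (simp add: iter_deriv_append)
qed

lemma deriv_bounded_mult:
  assumes "deriv_bounded N l A f" "deriv_bounded N l B g" "l > 0"
  shows "deriv_bounded N l (2 ^ N * A * B) (\<lambda>x. f x * g x)"
proof -
  have *: "norm (iter_deriv bs (\<lambda>x. f x * g x) x) \<le> 2 ^ length bs * A * B / l ^ length bs"
    if "bs \<in> lists Basis" "deriv_bounded (length bs) l A f" "deriv_bounded (length bs) l B g" 
    for bs f g A B x
    using that
  proof (induction bs arbitrary: f g A B rule: rev_induct)
    case Nil
    then have "norm (f x) \<le> A" "norm (g x) \<le> B" using deriv_boundedD[of 0 l _ _ "[]" x] by auto
    then have "norm (f x) * norm (g x) \<le> A * B"
      by (intro mult_mono norm_ge_zero order_trans[OF norm_ge_zero[of "f x"]])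
    then show ?case by (simp add: norm_mult)
  next
    case (snoc b bs)
    have mono: "deriv_bounded (length bs) l A f" if "deriv_bounded (Suc (length bs)) l A f" for f A
      using that by (simp add: deriv_bounded_def)
    have b: "b \<in> Basis" and bs: "bs \<in> lists Basis" using snoc by auto
    have f: "smooth f" and g: "smooth g" using snoc by (auto simp: deriv_bounded_def)
    have 1: "norm (iter_deriv bs (\<lambda>x. f x * partial_deriv b g x) x) \<le>
        2 ^ length bs * A * (B / l) / l ^ length bs"
      by (rule snoc.IH) (use snoc.prems b bs in \<open>auto intro: mono deriv_bounded_partial_deriv\<close>)
    have 2: "norm (iter_deriv bs (\<lambda>x. partial_deriv b f x * g x) x) \<le>
        2 ^ length bs * (A / l) * B / l ^ length bs"
      by (rule snoc.IH) (use snoc.prems b bs in \<open>auto intro: mono deriv_bounded_partial_deriv\<close>)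
    have "iter_deriv (bs @ [b]) (\<lambda>x. f x * g x) =
      (\<lambda>x. iter_deriv bs (\<lambda>x. f x * partial_deriv b g x) x +
         iter_deriv bs (\<lambda>x. partial_deriv b f x * g x) x)"
      using b bs f g
      by (simp add: iter_deriv_append partial_deriv_mult smooth_differentiable iter_deriv_add
          smooth_mult smooth_partial_deriv)
    then have "norm (iter_deriv (bs @ [b]) (\<lambda>x. f x * g x) x) \<le>
      2 ^ length bs * A * (B / l) / l ^ length bs + 2 ^ length bs * (A / l) * B / l ^ length bs"
      using order_trans[OF norm_triangle_ineq add_mono[OF 1 2]] by (simp only:)
    also have "\<dots> = 2 ^ length (bs @ [b]) * A * B / l ^ length (bs @ [b])"
      by (simp add: field_simps)
    finally show ?case .
  qed
  have AB: "0 \<le> A * B"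
    using order_trans[OF norm_ge_zero deriv_boundedD[OF assms(1), of "[]"]]
      order_trans[OF norm_ge_zero deriv_boundedD[OF assms(2), of "[]"]] by simp
  show ?thesis
    unfolding deriv_bounded_def
  proof (intro conjI ballI impI allI)
    show "smooth (\<lambda>x. f x * g x)" using assms by (auto simp: deriv_bounded_def intro: smooth_mult)
    fix bs x assume bs: "bs \<in> lists (Basis :: 'a set)" "length bs \<le> N"
    have "norm (iter_deriv bs (\<lambda>x. f x * g x) x) \<le> 2 ^ length bs * A * B / l ^ length bs"
      by (rule *) (use bs assms in \<open>auto simp: deriv_bounded_def\<close>)
    also have "\<dots> \<le> 2 ^ N * A * B / l ^ length bs"
      using AB bs(2) assms(3)
      by (simp add: mult.assoc divide_right_mono mult_right_mono power_increasing)
    finally show "norm (iter_deriv bs (\<lambda>x. f x * g x) x) \<le> 2 ^ N * A * B / l ^ length bs" .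
  qed
qed

lemma deriv_bounded_affine:
  assumes "deriv_bounded N 1 A f" "l > 0"
  shows "deriv_bounded N l A (\<lambda>x. f ((x - z) /\<^sub>R l))"
  using assms unfolding deriv_bounded_def
  by (simp add: smooth_affine iter_deriv_affine divide_inverse mult.commute mult_left_mono)

lemma deriv_bounded_scale:
  assumes "deriv_bounded N l A f"
  shows "deriv_bounded N l (norm c * A) (\<lambda>x. c * f x)"
  using assms unfolding deriv_bounded_def
  by (auto simp: smooth_mult smooth_const iter_deriv_scale norm_mult intro!: mult_left_mono
      simp flip: times_divide_eq_right)

lemma deriv_bounded_finer_scale:
  assumes "deriv_bounded N 1 A f" "0 < l" "l \<le> 1"
  shows "deriv_bounded N l A f"
  unfolding deriv_bounded_def
proof (intro conjI ballI impI allI)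
  show "smooth f" using assms by (simp add: deriv_bounded_def)
  fix bs x assume bs: "bs \<in> lists (Basis :: 'a set)" "length bs \<le> N"
  have A: "norm (iter_deriv bs f x) \<le> A" using deriv_boundedD[OF assms(1) bs] by simp
  then have "A \<ge> 0" by (rule order_trans[OF norm_ge_zero])
  then have "A * l ^ length bs \<le> A" using assms by (simp add: mult_left_le power_le_one)
  then show "norm (iter_deriv bs f x) \<le> A / l ^ length bs"
    using A assms(2) by (simp add: pos_le_divide_eq) (meson mult_right_mono order_trans zero_le_power less_imp_le)
qed

lemma test_functions_deriv_bounded:
  assumes "f \<in> test_functions"
  obtains A where "A > 0" "deriv_bounded N 1 A f"
proof -
  let ?L = "{bs. set bs \<subseteq> (Basis :: 'a set) \<and> length bs \<le> N}"
  have "\<exists>C>0. \<forall>x. norm (iter_deriv bs f x) \<le> C" if "bs \<in> ?L" for bs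
  proof -
    have "iter_deriv bs f \<in> schwartz_functions"
      using that by (intro schwartz_iter_deriv test_functions_schwartz assms) auto
    from schwartz_decay[OF this, of 0] show ?thesis by auto
  qed
  then obtain C where C: "\<And>bs x. bs \<in> ?L \<Longrightarrow> C bs > 0 \<and> norm (iter_deriv bs f x) \<le> C bs"
    by metis
  have fin: "finite ?L" by (rule finite_lists_length_le) simp
  show thesis
  proof (rule that[of "\<Sum>bs\<in>?L. C bs"])
    have "[] \<in> ?L" by simp
    then show "0 < (\<Sum>bs\<in>?L. C bs)" using fin C by (intro sum_pos) blast+
    have "C bs \<le> (\<Sum>bs\<in>?L. C bs)" if "bs \<in> ?L" for bs
      using that fin C by (intro member_le_sum) (auto simp: less_imp_le)
    then show "deriv_bounded N 1 (\<Sum>bs\<in>?L. C bs) f"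
      unfolding deriv_bounded_def using assms C
      by (auto simp: test_functions_def lists_eq_set intro: order_trans)
  qed
qed



section \<open>Integrability and rescaling\<close>

lemma nn_integral_inverse_square_finite:
  "(\<integral>\<^sup>+t. ennreal (1 / (1 + \<bar>t\<bar>)\<^sup>2) \<partial>(lborel :: real measure)) < \<infinity>"
proof -
  let ?f = "\<lambda>t::real. 1 / (1 + \<bar>t\<bar>)\<^sup>2"
  have lim: "((\<lambda>t::real. - (1 / (1 + t))) \<longlongrightarrow> 0) at_top"
    using tendsto_minus[OF tendsto_inverse_0_at_top[OF filterlim_tendsto_add_at_top[OF tendsto_const filterlim_ident, of 1]]]
    by (simp add: inverse_eq_divide)
  have half: "(\<integral>\<^sup>+t. ennreal (?f t) * indicator {0..} t \<partial>lborel) = ennreal (0 - - (1 / (1 + 0)))"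
  proof (rule nn_integral_FTC_atLeast[OF _ _ _ lim])
    show "((\<lambda>t. - (1 / (1 + t))) has_real_derivative ?f t) (at t)" if "0 \<le> t" for t
      using that by (auto intro!: derivative_eq_intros simp: power2_eq_square divide_simps)
  qed auto
  have "(\<integral>\<^sup>+t. ennreal (?f t) \<partial>lborel) \<le>
    (\<integral>\<^sup>+t. ennreal (?f t) * indicator {0..} t + ennreal (?f t) * indicator {0..} (- t) \<partial>lborel)"
    by (intro nn_integral_mono) (auto split: split_indicator)
  also have "\<dots> = (\<integral>\<^sup>+t. ennreal (?f t) * indicator {0..} t \<partial>lborel) +
      (\<integral>\<^sup>+t. ennreal (?f t) * indicator {0..} (- t) \<partial>lborel)"
    by (rule nn_integral_add) auto
  also have "(\<integral>\<^sup>+t. ennreal (?f t) * indicator {0..} (- t) \<partial>lborel) =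
      (\<integral>\<^sup>+t. ennreal (?f t) * indicator {0..} t \<partial>lborel)"
    by (subst nn_integral_real_affine[where c="-1" and t=0]) auto
  finally show ?thesis unfolding half
    by (rule order_le_less_trans) (simp add: ennreal_plus[symmetric] del: ennreal_plus)
qed

text \<open>Comparison with the product of the one-dimensional functions \<open>1 / (1 + \<bar>t\<bar>)\<^sup>2\<close> over the
  coordinates.\<close>

lemma integrable_decay:
  "integrable lborel (\<lambda>x::'a::euclidean_space. 1 / (1 + norm x) ^ (2 * DIM('a)))"
proof (rule integrableI_nonneg)
  have "(\<integral>\<^sup>+(x::'a). ennreal (1 / (1 + norm x) ^ (2 * DIM('a))) \<partial>lborel) \<le>
     (\<integral>\<^sup>+(x::'a). (\<Prod>b\<in>Basis. ennreal (1 / (1 + \<bar>x \<bullet> b\<bar>)\<^sup>2)) \<partial>lborel)"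
  proof (intro nn_integral_mono)
    fix x :: 'a
    have "1 / (1 + norm x) ^ (2 * DIM('a)) = (\<Prod>b\<in>(Basis::'a set). 1 / (1 + norm x)\<^sup>2)"
      by (simp add: power_mult power_divide)
    also have "\<dots> \<le> (\<Prod>b\<in>(Basis::'a set). 1 / (1 + \<bar>x \<bullet> b\<bar>)\<^sup>2)"
      by (intro prod_mono conjI divide_left_mono power_mono add_left_mono Basis_le_norm)
        (auto intro!: mult_pos_pos add_pos_nonneg simp: add_nonneg_eq_0_iff)
    finally show "ennreal (1 / (1 + norm x) ^ (2 * DIM('a))) \<le>
        (\<Prod>b\<in>Basis. ennreal (1 / (1 + \<bar>x \<bullet> b\<bar>)\<^sup>2))"
      by (subst prod_ennreal) (auto intro: ennreal_leI)
  qed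
  also have "\<dots> = (\<Prod>b\<in>(Basis::'a set). (\<integral>\<^sup>+t. ennreal (1 / (1 + \<bar>t\<bar>)\<^sup>2) \<partial>lborel))"
    by (rule nn_integral_lborel_prod) auto
  also have "\<dots> < \<infinity>"
    using nn_integral_inverse_square_finite by (simp add: power_less_top_ennreal)
  finally show "(\<integral>\<^sup>+(x::'a). ennreal (1 / (1 + norm x) ^ (2 * DIM('a))) \<partial>lborel) < \<infinity>" .
qed auto

definition decay_integral :: "'a::euclidean_space itself \<Rightarrow> real" where
  "decay_integral _ = (\<integral>(x::'a). 1 / (1 + norm x) ^ (2 * DIM('a)) \<partial>lborel)"

lemma decay_integral_nonneg: "0 \<le> decay_integral TYPE('a::euclidean_space)"
  unfolding decay_integral_def by (intro integral_nonneg_AE) auto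

lemma nn_integral_lborel_affine:
  fixes f :: "'a::euclidean_space \<Rightarrow> ennreal"
  assumes [measurable]: "f \<in> borel_measurable borel" and "c \<noteq> 0"
  shows "(\<integral>\<^sup>+x. f x \<partial>lborel) = ennreal (\<bar>c\<bar> ^ DIM('a)) * (\<integral>\<^sup>+x. f (t + c *\<^sub>R x) \<partial>lborel)"
  by (subst lborel_affine[OF assms(2), of t])
    (simp add: nn_integral_density nn_integral_distr nn_integral_cmult)

lemma lborel_integrable_affine:
  fixes f :: "'a::euclidean_space \<Rightarrow> 'b::{banach, second_countable_topology}"
  assumes f: "integrable lborel f" and c: "c \<noteq> 0"
  shows "integrable lborel (\<lambda>x. f (t + c *\<^sub>R x))"
proof -
  have [measurable]: "f \<in> borel_measurable borel" using f by auto
  have "ennreal (\<bar>c\<bar> ^ DIM('a)) * (\<integral>\<^sup>+x. norm (f (t + c *\<^sub>R x)) \<partial>lborel) < \<infinity>"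
    using f c by (subst nn_integral_lborel_affine[symmetric]) (auto simp: integrable_iff_bounded)
  then have "(\<integral>\<^sup>+x. norm (f (t + c *\<^sub>R x)) \<partial>lborel) < \<infinity>"
    using c by (auto simp: ennreal_mult_less_top)
  then show ?thesis by (auto simp: integrable_iff_bounded)
qed

lemma lborel_integral_affine:
  fixes f :: "'a::euclidean_space \<Rightarrow> 'b::{banach, second_countable_topology}"
  assumes [measurable]: "f \<in> borel_measurable borel" and c: "c \<noteq> 0"
  shows "(\<integral>x. f x \<partial>lborel) = \<bar>c\<bar> ^ DIM('a) *\<^sub>R (\<integral>x. f (t + c *\<^sub>R x) \<partial>lborel)"
  by (subst lborel_affine[OF assms(2), of t])
    (simp add: integral_density integral_distr)

lemma integral_decay_scale:
  assumes "l > 0"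
  shows "integrable lborel (\<lambda>x::'a::euclidean_space. 1 / (1 + l * norm x) ^ (2 * DIM('a)))"
    "(\<integral>(x::'a). 1 / (1 + l * norm x) ^ (2 * DIM('a)) \<partial>lborel) =
      decay_integral TYPE('a) / l ^ DIM('a)"
proof -
  show "integrable lborel (\<lambda>x::'a::euclidean_space. 1 / (1 + l * norm x) ^ (2 * DIM('a)))"
    using lborel_integrable_affine[OF integrable_decay, of l 0] assms by simp
  show "(\<integral>(x::'a). 1 / (1 + l * norm x) ^ (2 * DIM('a)) \<partial>lborel) =
      decay_integral TYPE('a) / l ^ DIM('a)"
    unfolding decay_integral_def
    by (subst (2) lborel_integral_affine[of _ l 0]) (use assms in auto)
qed

lemma integrable_from_decay:
  fixes f :: "'a::euclidean_space \<Rightarrow> 'b::{banach, second_countable_topology}"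
  assumes "f \<in> borel_measurable borel" "\<And>x. norm (f x) \<le> C / (1 + norm x) ^ (2 * DIM('a))"
  shows "integrable lborel f"
proof (rule Bochner_Integration.integrable_bound[OF integrable_mult_right[OF integrable_decay, of C]])
  show "AE x in lborel. norm (f x) \<le> norm (C * (1 / (1 + norm x) ^ (2 * DIM('a))))"
    by (rule AE_I2, rule order_trans[OF assms(2)]) (simp add: divide_right_mono)
qed (use assms in simp)

lemma schwartz_integrable:
  assumes "f \<in> schwartz_functions"
  shows "integrable lborel f"
  using schwartz_decay[OF assms] integrable_from_decay smooth_measurable schwartz_smooth assms
  by metis

section \<open>Oscillatory integrals\<close>

text \<open>The Fourier transform and its inverse are, up to normalisation, the cases \<open>\<sigma> = -1\<close> and
  \<open>\<sigma> = 1\<close> of one integral.\<close>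

definition osc :: "real \<Rightarrow> ('a::euclidean_space \<Rightarrow> complex) \<Rightarrow> 'a \<Rightarrow> complex" where
  "osc \<sigma> f x = (\<integral>y. cis (\<sigma> * (x \<bullet> y)) * f y \<partial>lborel)"

definition fourier_const :: "'a::euclidean_space itself \<Rightarrow> real" where
  "fourier_const _ = (2 * pi) powr (- real DIM('a) / 2)"

lemma fourier_const_pos: "fourier_const TYPE('a::euclidean_space) > 0"
  by (simp add: fourier_const_def)

lemma fourier_osc: "fourier f x = fourier_const TYPE('a) * osc (-1) f (x :: 'a::euclidean_space)"
  by (simp add: fourier_def osc_def cis_conv_exp fourier_const_def)

lemma inv_fourier_osc: "inv_fourier f x = fourier_const TYPE('a) * osc 1 f (x :: 'a::euclidean_space)"
  by (simp add: inv_fourier_def osc_def cis_conv_exp fourier_const_def)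

lemma cis_measurable [measurable]: "cis \<in> borel_measurable borel"
  unfolding cis_conv_exp by measurable

lemma integrable_osc:
  assumes "integrable lborel f"
  shows "integrable lborel (\<lambda>y. cis (\<sigma> * (x \<bullet> y)) * f y)"
  by (rule Bochner_Integration.integrable_bound[OF assms]) (use assms in \<open>auto simp: norm_mult\<close>)

lemma norm_osc_le:
  assumes "integrable lborel f"
  shows "norm (osc \<sigma> f x) \<le> (\<integral>y. norm (f y) \<partial>lborel)"
  unfolding osc_def using integral_norm_bound[of lborel "\<lambda>y. cis (\<sigma> * (x \<bullet> y)) * f y"]
  by (simp add: norm_mult)

lemma osc_measurable [measurable]:
  assumes [measurable]: "f \<in> borel_measurable borel"
  shows "osc \<sigma> f \<in> borel_measurable borel"
  unfolding osc_def[abs_def] by (rule lborel.borel_measurable_lebesgue_integral) simp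

lemma integrable_osc_mult:
  assumes f: "integrable lborel f" and g: "integrable lborel g"
  shows "integrable lborel (\<lambda>x. osc \<sigma> f x * g x)"
proof -
  have [measurable]: "f \<in> borel_measurable borel" "g \<in> borel_measurable borel" using f g by auto
  show ?thesis
    by (rule Bochner_Integration.integrable_bound
        [OF integrable_mult_right[OF integrable_norm[OF g], of "\<integral>y. norm (f y) \<partial>lborel"]])
      (auto simp: norm_mult intro!: mult_right_mono norm_osc_le[OF f]
        intro: order_trans[OF _ abs_ge_self])
qed

lemma osc_mult_integral:
  fixes f g :: "'a::euclidean_space \<Rightarrow> complex"
  assumes f: "integrable lborel f" and g: "integrable lborel g"
  shows "(\<integral>x. osc \<sigma> f x * g x \<partial>lborel) = (\<integral>x. f x * osc \<sigma> g x \<partial>lborel)"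
proof -
  have [measurable]: "f \<in> borel_measurable borel" "g \<in> borel_measurable borel" using f g by auto
  have int: "integrable (lborel \<Otimes>\<^sub>M lborel) (\<lambda>(x, y). cis (\<sigma> * (x \<bullet> y)) * f y * g x)"
  proof (rule Bochner_Integration.integrable_bound)
    show "integrable (lborel \<Otimes>\<^sub>M lborel) (\<lambda>(x, y). norm (g x) * norm (f y))"
      using f g by (subst lborel_pair.integrable_product_swap_iff[symmetric])
       (auto intro!: lborel_pair.integrable_fst' simp: lborel_pair.Fubini_integrable)
  qed (auto simp: norm_mult)
  have "(\<integral>x. osc \<sigma> f x * g x \<partial>lborel) = (\<integral>x. (\<integral>y. cis (\<sigma> * (x \<bullet> y)) * f y * g x \<partial>lborel) \<partial>lborel)"
    unfolding osc_def by (simp add: integrable_osc f)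
  also have "\<dots> = (\<integral>y. (\<integral>x. cis (\<sigma> * (x \<bullet> y)) * f y * g x \<partial>lborel) \<partial>lborel)"
    by (rule lborel_pair.Fubini_integral[symmetric]) (use int in simp)
  also have "\<dots> = (\<integral>y. f y * osc \<sigma> g y \<partial>lborel)"
  proof (intro Bochner_Integration.integral_cong refl)
    fix y
    have "(\<integral>x. cis (\<sigma> * (x \<bullet> y)) * f y * g x \<partial>lborel) = (\<integral>x. f y * (cis (\<sigma> * (y \<bullet> x)) * g x) \<partial>lborel)"
      by (simp add: inner_commute mult_ac)
    also have "\<dots> = f y * osc \<sigma> g y" unfolding osc_def by (simp add: integrable_osc g)
    finally show "(\<integral>x. cis (\<sigma> * (x \<bullet> y)) * f y * g x \<partial>lborel) = f y * osc \<sigma> g y" .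
  qed
  finally show ?thesis .
qed

lemma osc_translate:
  assumes "integrable lborel f"
  shows "(\<integral>y. cis (\<sigma> * (x \<bullet> y)) * f (y + v) \<partial>lborel) = cis (- \<sigma> * (x \<bullet> v)) * osc \<sigma> f x"
proof -
  have [measurable]: "f \<in> borel_measurable borel" using assms by auto
  have "osc \<sigma> f x = (\<integral>y. cis (\<sigma> * (x \<bullet> (v + 1 *\<^sub>R y))) * f (v + 1 *\<^sub>R y) \<partial>lborel)"
    unfolding osc_def by (subst lborel_integral_affine[of _ 1 v]) auto
  also have "\<dots> = (\<integral>y. cis (\<sigma> * (x \<bullet> v)) * (cis (\<sigma> * (x \<bullet> y)) * f (y + v)) \<partial>lborel)"
    by (intro Bochner_Integration.integral_cong refl)
      (simp add: inner_add_right distrib_left cis_mult[symmetric] add.commute mult_ac)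
  also have "\<dots> = cis (\<sigma> * (x \<bullet> v)) * (\<integral>y. cis (\<sigma> * (x \<bullet> y)) * f (y + v) \<partial>lborel)"
    by (rule integral_mult_right_zero)
  finally show ?thesis by (simp add: cis_mult)
qed

lemma has_vector_derivative_quotient_tendsto:
  assumes "(f has_vector_derivative D) (at (0::real))"
  shows "((\<lambda>s. (f s - f 0) /\<^sub>R s) \<longlongrightarrow> D) (at 0)"
proof -
  have lim: "((\<lambda>s. norm (f s - f 0 - s *\<^sub>R D) / norm s) \<longlongrightarrow> 0) (at 0)"
    using assms by (simp add: has_vector_derivative_def has_derivative_at)
  have "norm (f s - f 0 - s *\<^sub>R D) / norm s = norm ((f s - f 0) /\<^sub>R s - D)" if "s \<noteq> 0" for s
  proof -
    have "(f s - f 0) /\<^sub>R s - D = (f s - f 0 - s *\<^sub>R D) /\<^sub>R s"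
      using that by (simp add: scaleR_diff_right)
    then show ?thesis by (simp add: divide_inverse mult.commute)
  qed
  then have "((\<lambda>s. norm ((f s - f 0) /\<^sub>R s - D)) \<longlongrightarrow> 0) (at 0)"
    by (intro Lim_transform_eventually[OF lim]) (simp add: eventually_at_filter)
  then show ?thesis by (rule LIM_zero_cancel[OF tendsto_norm_zero_cancel])
qed

text \<open>Derivatives become multiplications: difference quotients of \<open>f\<close> correspond to the factors
  \<open>(cis (- \<sigma> h (x \<bullet> b)) - 1) / h\<close>, and the decay of the derivative permits the passage to the limit
  \<open>h \<rightarrow> 0\<close>.\<close>

lemma osc_partial_deriv:
  fixes f :: "'a::euclidean_space \<Rightarrow> complex"
  assumes f: "f \<in> schwartz_functions" and b: "b \<in> Basis"
  shows "osc \<sigma> (partial_deriv b f) x = - (\<i> * (\<sigma> * (x \<bullet> b))) * osc \<sigma> f x"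
proof -
  let ?g = "partial_deriv b f"
  have g: "?g \<in> schwartz_functions" using schwartz_iter_deriv[OF f, of "[b]"] b by simp
  note sm = schwartz_smooth[OF f] schwartz_smooth[OF g]
  have [measurable]: "f \<in> borel_measurable borel" "?g \<in> borel_measurable borel"
    using sm smooth_measurable by auto
  obtain C where C: "C > 0" "\<And>x. norm (?g x) \<le> C / (1 + norm x) ^ (2 * DIM('a))"
    using schwartz_decay[OF g] by metis
  define h :: "nat \<Rightarrow> real" where "h k = inverse (Suc k)" for k
  have h: "h k > 0" "h k \<le> 1" for k by (auto simp: h_def field_simps)
  have h0: "h \<longlonglongrightarrow> 0" unfolding h_def by (rule LIMSEQ_inverse_real_of_nat)
  have h_at: "filterlim h (at 0) sequentially"
    using h0 h(1) by (auto simp: filterlim_at less_imp_neq[symmetric])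
  have D: "((\<lambda>s. f (y + s *\<^sub>R b)) has_vector_derivative ?g (y + s *\<^sub>R b)) (at s)" for y s
  proof -
    have F: "(f has_derivative frechet_derivative f (at (y + s *\<^sub>R b))) (at (y + s *\<^sub>R b))"
      by (intro has_derivative_partial_deriv smooth_differentiable sm)
    have "((\<lambda>s. f (y + s *\<^sub>R b)) has_derivative
        (\<lambda>d. frechet_derivative f (at (y + s *\<^sub>R b)) (d *\<^sub>R b))) (at s)"
      by (rule has_derivative_compose[where f="\<lambda>s. y + s *\<^sub>R b" and x=s and s=UNIV, OF _ F]) (auto intro!: derivative_eq_intros)
    then show ?thesis
      unfolding has_vector_derivative_def partial_deriv_def
      by (simp add: linear_scale[OF has_derivative_linear[OF F]])
  qed
  let ?q = "\<lambda>k y. (f (y + h k *\<^sub>R b) - f y) /\<^sub>R h k"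
  let ?w = "\<lambda>y::'a. C * 2 ^ (2 * DIM('a)) / (1 + norm y) ^ (2 * DIM('a))"
  \<comment> \<open>Mean value inequality on a segment of length at most \<open>1\<close>, along which \<open>1 + norm y\<close> changes at
    most by a factor \<open>2\<close>.\<close>
  have q_bound: "norm (?q k y) \<le> ?w y" for k y
  proof -
    have g_bound: "norm (?g (y + s *\<^sub>R b)) \<le> ?w y" if "s \<in> {0..h k}" for s
    proof -
      have "norm y \<le> norm (y + s *\<^sub>R b) + norm (s *\<^sub>R b)"
        using norm_triangle_sub[of y "y + s *\<^sub>R b"] by simp
      also have "norm (s *\<^sub>R b) \<le> 1" using that h(2)[of k] b by simp
      finally have "norm y \<le> norm (y + s *\<^sub>R b) + 1" by simp
      then have "(1 + norm y) ^ (2 * DIM('a)) \<le> (2 * (1 + norm (y + s *\<^sub>R b))) ^ (2 * DIM('a))"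
        using norm_ge_zero[of "y + s *\<^sub>R b"] by (intro power_mono) (smt (verit), simp)
      then have "1 / (1 + norm (y + s *\<^sub>R b)) ^ (2 * DIM('a)) \<le>
          2 ^ (2 * DIM('a)) / (1 + norm y) ^ (2 * DIM('a))"
        unfolding power_mult_distrib
        by (subst frac_le_eq) (auto simp: field_simps add_pos_nonneg add_nonneg_eq_0_iff)
      then have "C / (1 + norm (y + s *\<^sub>R b)) ^ (2 * DIM('a)) \<le> ?w y"
        using mult_left_mono[OF _ less_imp_le[OF C(1)]] by fastforce
      then show ?thesis using C(2)[of "y + s *\<^sub>R b"] by linarith
    qed
    have "onorm (\<lambda>d. d *\<^sub>R ?g (y + s *\<^sub>R b)) \<le> ?w y" if "s \<in> {0..h k}" for s
    proof (intro onorm_le)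
      fix d
      show "norm (d *\<^sub>R ?g (y + s *\<^sub>R b)) \<le> ?w y * norm d"
        using mult_right_mono[OF g_bound[OF that] norm_ge_zero[of d]] by (simp only: norm_scaleR mult.commute real_norm_def)
    qed
    then have "norm (f (y + h k *\<^sub>R b) - f (y + 0 *\<^sub>R b)) \<le> ?w y * norm (h k - 0)"
      using h(1)[of k] D[unfolded has_vector_derivative_def, THEN has_derivative_at_withinI]
      by (intro differentiable_bound[where S="{0..h k}" and f="\<lambda>s. f (y + s *\<^sub>R b)"]) auto
    then have "norm (f (y + h k *\<^sub>R b) - f y) / h k \<le> ?w y"
      unfolding pos_divide_le_eq[OF h(1)] using h(1)[of k] by simp
    moreover have "norm (?q k y) = norm (f (y + h k *\<^sub>R b) - f y) / h k"
      using h(1)[of k] by (simp add: divide_inverse mult.commute)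
    ultimately show ?thesis by simp
  qed
  have lim1: "(\<lambda>k. \<integral>y. cis (\<sigma> * (x \<bullet> y)) * ?q k y \<partial>lborel) \<longlonglongrightarrow> osc \<sigma> ?g x"
    unfolding osc_def
  proof (rule integral_dominated_convergence[where w="?w"])
    show "integrable lborel ?w"
      using integrable_mult_right[OF integrable_decay, of "C * 2 ^ (2 * DIM('a))"] by simp
    show "AE y in lborel. norm (cis (\<sigma> * (x \<bullet> y)) * ?q k y) \<le> ?w y" for k
      using q_bound by (simp add: norm_mult)
    have "(\<lambda>k. ?q k y) \<longlonglongrightarrow> ?g y" for y
    proof -
      have "((\<lambda>s. (f (y + s *\<^sub>R b) - f y) /\<^sub>R s) \<longlongrightarrow> ?g y) (at 0)"
        using has_vector_derivative_quotient_tendsto[of "\<lambda>s. f (y + s *\<^sub>R b)"] D[of y 0] by simp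
      then show ?thesis using h_at by (rule filterlim_compose)
    qed
    then show "AE y in lborel. (\<lambda>k. cis (\<sigma> * (x \<bullet> y)) * ?q k y) \<longlonglongrightarrow> cis (\<sigma> * (x \<bullet> y)) * ?g y"
      by (intro AE_I2 tendsto_mult tendsto_const)
  qed auto
  let ?a = "- \<sigma> * (x \<bullet> b)"
  have fi: "integrable lborel f" by (rule schwartz_integrable[OF f])
  have eq: "(\<integral>y. cis (\<sigma> * (x \<bullet> y)) * ?q k y \<partial>lborel) = (cis (h k * ?a) - cis (0 * ?a)) /\<^sub>R h k * osc \<sigma> f x" for k
  proof -
    have i: "integrable lborel (\<lambda>y. cis (\<sigma> * (x \<bullet> y)) * f (y + h k *\<^sub>R b))"
      using integrable_osc[OF lborel_integrable_affine[OF fi, of 1 "h k *\<^sub>R b"]] by (simp add: add.commute)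
    have "(\<integral>y. cis (\<sigma> * (x \<bullet> y)) * ?q k y \<partial>lborel) =
        (\<integral>y. (cis (\<sigma> * (x \<bullet> y)) * f (y + h k *\<^sub>R b) - cis (\<sigma> * (x \<bullet> y)) * f y) /\<^sub>R h k \<partial>lborel)"
      by (simp add: algebra_simps)
    also have "\<dots> = (cis (- \<sigma> * (x \<bullet> (h k *\<^sub>R b))) * osc \<sigma> f x - osc \<sigma> f x) /\<^sub>R h k"
      using i integrable_osc[OF fi, of \<sigma> x] osc_translate[OF fi, of \<sigma> x "h k *\<^sub>R b"]
      by (simp add: osc_def)
    also have "\<dots> = (cis (h k * ?a) - cis (0 * ?a)) /\<^sub>R h k * osc \<sigma> f x"
      by (simp add: algebra_simps)
    finally show ?thesis .
  qed
  have "((\<lambda>s. cis (s * ?a)) has_vector_derivative (\<i> * ?a * cis (0 * ?a))) (at 0)"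
    unfolding has_vector_derivative_def
    by (rule has_derivative_eq_rhs, rule has_derivative_cis[OF has_derivative_mult_left[OF has_derivative_ident]])
      (simp add: scaleR_conv_of_real mult_ac)
  then have "((\<lambda>s. (cis (s * ?a) - cis (0 * ?a)) /\<^sub>R s) \<longlongrightarrow> \<i> * ?a) (at 0)"
    using has_vector_derivative_quotient_tendsto[of "\<lambda>s. cis (s * ?a)"] by simp
  then have "(\<lambda>k. (cis (h k * ?a) - cis (0 * ?a)) /\<^sub>R h k) \<longlonglongrightarrow> \<i> * ?a"
    using h_at by (rule filterlim_compose)
  then have "(\<lambda>k. \<integral>y. cis (\<sigma> * (x \<bullet> y)) * ?q k y \<partial>lborel) \<longlonglongrightarrow> \<i> * ?a * osc \<sigma> f x"
    unfolding eq by (rule tendsto_mult_right)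
  then show ?thesis using LIMSEQ_unique[OF lim1] by simp
qed

lemma osc_iter_deriv:
  assumes "f \<in> schwartz_functions" "b \<in> Basis"
  shows "osc \<sigma> (iter_deriv (replicate m b) f) x = (- (\<i> * (\<sigma> * (x \<bullet> b)))) ^ m * osc \<sigma> f x"
proof (induction m)
  case (Suc m)
  have "iter_deriv (replicate m b) f \<in> schwartz_functions"
    using assms by (intro schwartz_iter_deriv) auto
  then show ?case using osc_partial_deriv[OF _ assms(2), of "iter_deriv (replicate m b) f"] Suc by simp
qed simp

text \<open>Since some coordinate of \<open>x\<close> is at least \<open>norm x / DIM('a)\<close>, it suffices to integrate
  \<open>f\<close> and its pure derivatives of order \<open>m\<close>.\<close>

lemma osc_decay:
  fixes f :: "'a::euclidean_space \<Rightarrow> complex"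
  assumes f: "f \<in> schwartz_functions" and "l > 0" and \<sigma>: "\<bar>\<sigma>\<bar> = 1"
    and M0: "(\<integral>y. norm (f y) \<partial>lborel) \<le> M"
    and Mm: "\<And>b. b \<in> Basis \<Longrightarrow> (\<integral>y. norm (iter_deriv (replicate m b) f y) \<partial>lborel) \<le> M / l ^ m"
  shows "norm (osc \<sigma> f x) \<le> M * (2 * real DIM('a)) ^ m / (1 + l * norm x) ^ m"
proof -
  define N where "N = real DIM('a)"
  have N: "N \<ge> 1" by (simp add: N_def Suc_leI)
  have le0: "norm (osc \<sigma> f x) \<le> M"
    using norm_osc_le[OF schwartz_integrable[OF f]] M0 order_trans by blast
  have "norm (osc \<sigma> f x) * (1 + l * norm x) ^ m \<le> M * (2 * N) ^ m"
  proof (cases "l * norm x \<le> 1")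
    case True
    then have "(1 + l * norm x) ^ m \<le> (2 * N) ^ m"
      using N assms(2) by (intro power_mono) auto
    then show ?thesis using le0 assms(2) by (intro mult_mono) (auto intro: order_trans[OF norm_ge_zero le0])
  next
    case False
    obtain b where b: "b \<in> Basis" "norm x \<le> N * \<bar>x \<bullet> b\<bar>"
    proof (rule ccontr)
      assume "\<not> thesis"
      then have "\<And>b. b \<in> Basis \<Longrightarrow> \<bar>x \<bullet> b\<bar> < norm x / N"
        using that N by (force simp: field_simps not_le)
      then have "(\<Sum>b\<in>Basis. \<bar>x \<bullet> b\<bar>) < (\<Sum>b\<in>(Basis::'a set). norm x / N)"
        by (intro sum_strict_mono) auto
      then show False using norm_le_l1[of x] N by (simp add: N_def)
    qed
    have i: "integrable lborel (iter_deriv (replicate m b) f)"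
      using b by (intro schwartz_integrable schwartz_iter_deriv f) auto
    have "(1 + l * norm x) ^ m \<le> (2 * N * (l * \<bar>x \<bullet> b\<bar>)) ^ m"
    proof (rule power_mono)
      have "l * norm x \<le> l * (N * \<bar>x \<bullet> b\<bar>)" using b assms(2) by (intro mult_left_mono) auto
      then show "1 + l * norm x \<le> 2 * N * (l * \<bar>x \<bullet> b\<bar>)" using False by (simp add: mult_ac)
    qed (use assms in auto)
    then have "norm (osc \<sigma> f x) * (1 + l * norm x) ^ m \<le> norm (osc \<sigma> f x) * (2 * N * (l * \<bar>x \<bullet> b\<bar>)) ^ m"
      by (intro mult_left_mono) auto
    also have "\<dots> = (2 * N) ^ m * l ^ m * norm (osc \<sigma> (iter_deriv (replicate m b) f) x)"
      using \<sigma> by (simp add: osc_iter_deriv[OF f b(1)] norm_mult norm_power power_mult_distrib abs_mult mult_ac)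
    also have "\<dots> \<le> (2 * N) ^ m * l ^ m * (M / l ^ m)"
      using N assms(2) by (intro mult_left_mono order_trans[OF norm_osc_le[OF i] Mm[OF b(1)]]) auto
    also have "\<dots> = M * (2 * N) ^ m" using assms(2) by simp
    finally show ?thesis .
  qed
  moreover have "(1 + l * norm x) ^ m > 0" using assms(2) by (simp add: add_pos_nonneg)
  ultimately show ?thesis unfolding N_def by (simp add: pos_le_divide_eq)
qed

lemma schwartz_osc_decay:
  fixes f :: "'a::euclidean_space \<Rightarrow> complex"
  assumes "f \<in> schwartz_functions" "\<bar>\<sigma>\<bar> = 1"
  obtains C where "C \<ge> 0" "\<And>x. norm (osc \<sigma> f x) \<le> C / (1 + norm x) ^ m"
proof -
  let ?I = "\<lambda>b. \<integral>y. norm (iter_deriv (replicate m b) f y) \<partial>lborel"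
  define M where "M = (\<integral>y. norm (f y) \<partial>lborel) + (\<Sum>b\<in>Basis. ?I b)"
  have nn: "0 \<le> ?I b" "0 \<le> (\<integral>y. norm (f y) \<partial>lborel)" for b by (auto intro!: integral_nonneg_AE)
  have "(\<integral>y. norm (f y) \<partial>lborel) \<le> M" using nn by (auto simp: M_def intro!: sum_nonneg)
  moreover have "?I b \<le> M / 1 ^ m" if "b \<in> Basis" for b
    using member_le_sum[of b Basis ?I, OF that nn(1) finite_Basis] nn(2) unfolding M_def power_one div_by_1
    by linarith
  ultimately have "norm (osc \<sigma> f x) \<le> M * (2 * real DIM('a)) ^ m / (1 + norm x) ^ m" for x
    using osc_decay[OF assms(1) zero_less_one assms(2), of M m x] by simp
  moreover have "M \<ge> 0" using nn by (auto simp: M_def intro!: sum_nonneg add_nonneg_nonneg)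
  ultimately show thesis by (intro that[of "M * (2 * real DIM('a)) ^ m"]) auto
qed

text \<open>The quantitative form for bumps at scale \<open>l\<close>: their transform lives at frequencies of
  size at most about \<open>1 / l\<close>.\<close>

lemma osc_bump_decay:
  fixes f :: "'a::euclidean_space \<Rightarrow> complex"
  assumes f: "f \<in> test_functions" and B: "deriv_bounded m l B f" and l: "l > 0" and \<sigma>: "\<bar>\<sigma>\<bar> = 1"
    and supp: "\<And>y. y \<notin> ball z (2 * l) \<Longrightarrow> f y = 0"
  shows "norm (osc \<sigma> f x) \<le>
    (unit_ball_vol DIM('a) * 2 ^ DIM('a) * (2 * real DIM('a)) ^ m) * B * l ^ DIM('a) / (1 + l * norm x) ^ m"
proof -
  let ?V = "unit_ball_vol DIM('a) * (2 * l) ^ DIM('a)"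
  have fs: "f \<in> schwartz_functions" by (rule test_functions_schwartz[OF f])
  have sm: "smooth f" using B by (simp add: deriv_bounded_def)
  have I: "(\<integral>y. norm (iter_deriv bs f y) \<partial>lborel) \<le> B * ?V / l ^ length bs"
    if bs: "bs \<in> lists Basis" "length bs \<le> m" for bs
  proof -
    have i: "integrable lborel (iter_deriv bs f)" using bs by (intro schwartz_integrable schwartz_iter_deriv fs)
    have c: "emeasure lborel (cball z (2 * l)) = ennreal ?V"
      using l by (simp add: emeasure_cball)
    have B0: "B / l ^ length bs \<ge> 0" using deriv_boundedD[OF B bs] norm_ge_zero order_trans by blast
    have "(\<integral>y. norm (iter_deriv bs f y) \<partial>lborel) \<le>
        (\<integral>y. B / l ^ length bs * indicator (cball z (2 * l)) y \<partial>lborel)"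
    proof (rule integral_mono)
      show "integrable lborel (\<lambda>y. B / l ^ length bs * indicator (cball z (2 * l)) y)"
        using c by (intro integrable_mult_right integrable_real_indicator) auto
      show "norm (iter_deriv bs f y) \<le> B / l ^ length bs * indicator (cball z (2 * l)) y" for y
      proof (cases "y \<in> cball z (2 * l)")
        case True
        then show ?thesis using deriv_boundedD[OF B bs] by simp
      next
        case False
        have "iter_deriv bs f y = 0"
          by (rule iter_deriv_eq_0_outside[OF sm _ _ bs(1), of "- cball z (2 * l)"]) (use False supp in auto)
        then show ?thesis using False by simp
      qed
    qed (use i in auto)
    also have "\<dots> = B * ?V / l ^ length bs" using c l by (simp add: measure_def)
    finally show ?thesis .
  qed
  have "norm (osc \<sigma> f x) \<le> (B * ?V) * (2 * real DIM('a)) ^ m / (1 + l * norm x) ^ m"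
  proof (rule osc_decay[OF fs l \<sigma>])
    show "(\<integral>y. norm (f y) \<partial>lborel) \<le> B * ?V" using I[of "[]"] by simp
    show "(\<integral>y. norm (iter_deriv (replicate m b) f y) \<partial>lborel) \<le> B * ?V / l ^ m" if "b \<in> Basis" for b
      using I[of "replicate m b"] that by (simp add: in_lists_conv_set)
  qed
  then show ?thesis by (simp add: power_mult_distrib mult_ac)
qed



section \<open>Test functions determine locally integrable functions\<close>

lemma unif_cutoff_test: "unif_cutoff \<eta> \<Longrightarrow> (\<lambda>x. complex_of_real (\<eta> x)) \<in> test_functions"
  by (simp add: unif_cutoff_def)

lemma unif_cutoff_bounds: "unif_cutoff \<eta> \<Longrightarrow> 0 \<le> \<eta> x \<and> \<eta> x \<le> 1"
  by (simp add: unif_cutoff_def)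

lemma unif_cutoff_eq_1: "unif_cutoff \<eta> \<Longrightarrow> norm x < 1 \<Longrightarrow> \<eta> x = 1"
  by (simp add: unif_cutoff_def)

lemma unif_cutoff_eq_0: "unif_cutoff \<eta> \<Longrightarrow> 2 \<le> norm x \<Longrightarrow> \<eta> x = 0"
  by (simp add: unif_cutoff_def)

lemma unif_cutoff_measurable:
  assumes "unif_cutoff \<eta>"
  shows "\<eta> \<in> borel_measurable borel"
proof -
  have "(\<lambda>x. Re (complex_of_real (\<eta> x))) \<in> borel_measurable borel"
    using unif_cutoff_test[OF assms]
    by (intro borel_measurable_continuous_onI continuous_on_Re smooth_continuous) (simp add: test_functions_def)
  then show ?thesis by simp
qed

text \<open>Cover \<open>K\<close> by finitely many balls of centres \<open>x\<close> and radii \<open>r x\<close> whose doubled balls lie in \<open>V\<close>.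
  The product of the functions \<open>1 - \<eta> ((y - x) / r x)\<close> vanishes on \<open>K\<close> and equals \<open>1\<close> off \<open>V\<close>, so no
  convolution is needed to construct the cutoff.\<close>

lemma compact_cutoff:
  fixes \<eta> :: "'a::euclidean_space \<Rightarrow> real" and K :: "'a set"
  assumes \<eta>: "unif_cutoff \<eta>" and K: "compact K" and V: "open V" "K \<subseteq> V"
  obtains h where "(\<lambda>x. complex_of_real (h x)) \<in> test_functions"
    "\<And>x. 0 \<le> h x \<and> h x \<le> 1" "\<And>x. x \<in> K \<Longrightarrow> h x = 1" "\<And>x. x \<notin> V \<Longrightarrow> h x = 0"
proof -
  have "\<exists>r>0. ball x (2 * r) \<subseteq> V" if "x \<in> K" for x
  proof -
    obtain e where "e > 0" "ball x e \<subseteq> V" using V \<open>x \<in> K\<close> by (meson openE subsetD)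
    then show ?thesis by (intro exI[of _ "e / 2"]) auto
  qed
  then obtain r where r: "\<And>x. x \<in> K \<Longrightarrow> r x > 0 \<and> ball x (2 * r x) \<subseteq> V" by metis
  have "K \<subseteq> (\<Union>x\<in>K. ball x (r x))" using r by force
  then obtain F where F: "F \<subseteq> K" "finite F" "K \<subseteq> (\<Union>x\<in>F. ball x (r x))"
    using compactE_image[OF K, of K "\<lambda>x. ball x (r x)"] by auto
  define h :: "'a \<Rightarrow> real" where "h y = 1 - (\<Prod>x\<in>F. 1 - \<eta> ((y - x) /\<^sub>R r x))" for y
  have zero: "\<exists>x\<in>F. y \<in> ball x (2 * r x)" if "h y \<noteq> 0" for y
  proof (rule ccontr)
    assume *: "\<not> ?thesis"
    have "\<eta> ((y - x) /\<^sub>R r x) = 0" if "x \<in> F" for x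
    proof -
      have "r x > 0" "2 * r x \<le> norm (y - x)"
        using * that r F(1) by (auto simp: dist_norm norm_minus_commute not_less)
      then show ?thesis
        by (intro unif_cutoff_eq_0[OF \<eta>]) (simp add: divide_inverse_commute[symmetric] pos_le_divide_eq)
    qed
    then show False using that by (simp add: h_def)
  qed
  show thesis
  proof (rule that[of h])
    have "smooth (\<lambda>y. 1 + (-1) * (\<Prod>x\<in>F. 1 + (-1) * complex_of_real (\<eta> ((y - x) /\<^sub>R r x))))"
      by (intro smooth_add smooth_mult smooth_const smooth_prod smooth_affine[where f="\<lambda>x. complex_of_real (\<eta> x)"])
        (use unif_cutoff_test[OF \<eta>] in \<open>simp add: test_functions_def\<close>)
    then have "smooth (\<lambda>y. complex_of_real (h y))" by (simp add: h_def)
    then show "(\<lambda>y. complex_of_real (h y)) \<in> test_functions"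
    proof (rule test_functionsI)
      fix y assume "complex_of_real (h y) \<noteq> 0"
      then obtain x where x: "x \<in> F" "y \<in> ball x (2 * r x)" using zero by auto
      have "norm y \<le> norm x + 2 * r x"
        using x(2) norm_triangle_sub[of y x] by (simp add: dist_norm norm_minus_commute)
      also have "\<dots> \<le> (\<Sum>x\<in>F. norm x + 2 * r x)"
        using x(1) F r by (intro member_le_sum) (auto intro!: add_nonneg_nonneg simp: less_imp_le subset_iff)
      finally show "norm y \<le> (\<Sum>x\<in>F. norm x + 2 * r x)" .
    qed
    show "0 \<le> h x \<and> h x \<le> 1" for x
    proof -
      have "0 \<le> (\<Prod>z\<in>F. 1 - \<eta> ((x - z) /\<^sub>R r z))" "(\<Prod>z\<in>F. 1 - \<eta> ((x - z) /\<^sub>R r z)) \<le> 1"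
        using unif_cutoff_bounds[OF \<eta>] by (auto intro!: prod_nonneg prod_le_1)
      then show ?thesis by (simp add: h_def)
    qed
    show "h x = 1" if xK: "x \<in> K" for x
    proof -
      obtain z where z: "z \<in> F" "x \<in> ball z (r z)" using F(3) xK by auto
      then have "norm (x - z) < r z" by (simp add: dist_norm norm_minus_commute)
      moreover have "r z > 0" using r F z by auto
      ultimately have "\<eta> ((x - z) /\<^sub>R r z) = 1" by (intro unif_cutoff_eq_1[OF \<eta>]) (simp add: divide_inverse_commute[symmetric] pos_divide_less_eq)
      then have "(\<Prod>z\<in>F. 1 - \<eta> ((x - z) /\<^sub>R r z)) = 0" using F(2) z(1) by (intro prod_zero) auto
      then show ?thesis by (simp add: h_def)
    qed
    show "h x = 0" if "x \<notin> V" for x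
    proof (rule ccontr)
      assume "h x \<noteq> 0"
      then obtain z where "z \<in> F" "x \<in> ball z (2 * r z)" using zero by blast
      then show False using r[of z] F(1) that by blast
    qed
  qed
qed

text \<open>Cutoffs for \<open>K\<close> in shrinking neighbourhoods of \<open>K\<close> converge to its indicator function.\<close>

lemma integral_compact_eq_0:
  fixes d :: "'a::euclidean_space \<Rightarrow> complex" and \<eta> :: "'a \<Rightarrow> real"
  assumes \<eta>: "unif_cutoff \<eta>" and d[measurable]: "d \<in> borel_measurable borel"
    and loc: "\<And>R. set_integrable lborel (cball 0 R) d"
    and zero: "\<And>\<phi>. \<phi> \<in> test_functions \<Longrightarrow> (\<integral>x. d x * \<phi> x \<partial>lborel) = 0"
    and K: "compact K"
  shows "set_lebesgue_integral lborel K d = 0"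
proof -
  define V where "V k = (\<Union>x\<in>K. ball x (1 / real (Suc k)))" for k
  have V: "open (V k)" "K \<subseteq> V k" for k by (auto simp: V_def)
  have "\<exists>h. (\<lambda>x. complex_of_real (h x)) \<in> test_functions \<and> (\<forall>x. 0 \<le> h x \<and> h x \<le> 1) \<and>
      (\<forall>x\<in>K. h x = 1) \<and> (\<forall>x. x \<notin> V k \<longrightarrow> h x = 0)" for k
    by (rule compact_cutoff[OF \<eta> K V(1,2)[of k]]) blast
  then obtain h where h: "\<And>k. (\<lambda>x. complex_of_real (h k x)) \<in> test_functions"
    "\<And>k x. 0 \<le> h k x \<and> h k x \<le> 1" "\<And>k x. x \<in> K \<Longrightarrow> h k x = 1" "\<And>k x. x \<notin> V k \<Longrightarrow> h k x = 0"
    by metis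
  obtain R where R: "\<And>x. x \<in> K \<Longrightarrow> norm x \<le> R"
    using compact_imp_bounded[OF K] by (auto simp: bounded_iff)
  have VR: "V k \<subseteq> cball 0 (R + 1)" for k
  proof
    fix y assume "y \<in> V k"
    then obtain x where x: "x \<in> K" "dist x y < 1 / real (Suc k)" by (auto simp: V_def)
    have "1 / real (Suc k) \<le> 1" by simp
    then have "dist x y < 1" using x(2) by linarith
    then show "y \<in> cball 0 (R + 1)"
      using R[OF x(1)] norm_triangle_sub[of y x] by (simp add: dist_norm norm_minus_commute)
  qed
  have [measurable]: "(\<lambda>x. complex_of_real (h k x)) \<in> borel_measurable borel" for k
    using h(1) by (intro smooth_measurable) (simp add: test_functions_def)
  have lim: "(\<lambda>k. complex_of_real (h k x)) \<longlonglongrightarrow> indicator K x" for x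
  proof (cases "x \<in> K")
    case True
    then show ?thesis using h(3) by simp
  next
    case False
    have "eventually (\<lambda>k. x \<notin> V k) sequentially"
    proof -
      obtain e where e: "e > 0" "ball x e \<subseteq> - K"
        using False K by (meson ComplI compact_imp_closed open_Compl openE)
      obtain k0 where k0: "1 / real (Suc k0) < e" using e(1) by (metis nat_approx_posE)
      have "x \<notin> V k" if "k \<ge> k0" for k
      proof
        assume "x \<in> V k"
        then obtain y where y: "y \<in> K" "dist y x < 1 / real (Suc k)" by (auto simp: V_def)
        have "1 / real (Suc k) \<le> 1 / real (Suc k0)" using that by (simp add: frac_le)
        then have "y \<in> ball x e" using y k0 by (simp add: dist_commute)
        then show False using e y by blast
      qed
      then show ?thesis by (auto simp: eventually_sequentially)
    qed
    then have "eventually (\<lambda>k. complex_of_real (h k x) = 0) sequentially"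
      by eventually_elim (simp add: h(4))
    then show ?thesis using False by (simp add: tendsto_eventually)
  qed
  have "(\<lambda>k. \<integral>x. d x * complex_of_real (h k x) \<partial>lborel) \<longlonglongrightarrow> (\<integral>x. d x * indicator K x \<partial>lborel)"
  proof (rule integral_dominated_convergence[where w="\<lambda>x. norm (indicator (cball 0 (R + 1)) x *\<^sub>R d x)"])
    show "integrable lborel (\<lambda>x. norm (indicator (cball 0 (R + 1)) x *\<^sub>R d x))"
      using loc[of "R + 1"] by (intro integrable_norm) (simp add: set_integrable_def)
    show "AE x in lborel. norm (d x * complex_of_real (h k x)) \<le> norm (indicator (cball 0 (R + 1)) x *\<^sub>R d x)" for k
    proof (rule AE_I2)
      fix x
      show "norm (d x * complex_of_real (h k x)) \<le> norm (indicator (cball 0 (R + 1)) x *\<^sub>R d x)"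
        using h(2)[of k x] h(4)[where x=x and k=k] VR[of k]
        by (cases "x \<in> V k") (auto simp: norm_mult mult_left_le subset_iff)
    qed
    show "AE x in lborel. (\<lambda>k. d x * complex_of_real (h k x)) \<longlonglongrightarrow> d x * indicator K x"
      by (intro AE_I2 tendsto_mult tendsto_const lim)
    have [measurable]: "K \<in> sets borel" using K by (simp add: compact_imp_closed)
    show "(\<lambda>x. d x * indicator K x) \<in> borel_measurable lborel" by simp
  qed simp
  then have "(\<integral>x. d x * indicator K x \<partial>lborel) = 0"
    using zero[OF h(1)] by (simp add: LIMSEQ_const_iff)
  moreover have "(\<lambda>x. d x * indicator K x) = (\<lambda>x. indicator K x *\<^sub>R d x)"
    by (auto simp: fun_eq_iff split: split_indicator)
  ultimately show ?thesis by (simp add: set_lebesgue_integral_def)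
qed

text \<open>The sets over which \<open>d\<close> has integral zero contain the compact sets, and inside a fixed ball they form
  a Dynkin system; hence they contain all Borel subsets of that ball.\<close>

lemma AE_eq_0_from_test_functions:
  fixes d :: "'a::euclidean_space \<Rightarrow> complex" and \<eta> :: "'a \<Rightarrow> real"
  assumes \<eta>: "unif_cutoff \<eta>" and d[measurable]: "d \<in> borel_measurable borel"
    and loc: "\<And>R. set_integrable lborel (cball 0 R) d"
    and zero: "\<And>\<phi>. \<phi> \<in> test_functions \<Longrightarrow> (\<integral>x. d x * \<phi> x \<partial>lborel) = 0"
  shows "AE x in lborel. d x = 0"
proof -
  have "AE x in lborel. indicator (cball 0 R) x *\<^sub>R d x = 0" for R
  proof (rule sigma_finite_measure.density_zero[OF lborel.sigma_finite_measure_axioms])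
    let ?g = "\<lambda>x. indicator (cball 0 R) x *\<^sub>R d x"
    show g: "integrable lborel ?g" using loc[of R] by (simp add: set_integrable_def)
    have gi: "set_integrable lborel A ?g" if "A \<in> sets borel" for A
      unfolding set_integrable_def by (rule integrable_mult_indicator) (use g that in auto)
    have comp: "set_lebesgue_integral lborel C ?g = 0" if "closed C" for C
    proof -
      have "set_lebesgue_integral lborel (C \<inter> cball 0 R) d = 0"
        using that by (intro integral_compact_eq_0[OF \<eta> d loc zero] closed_Int_compact) auto
      then show ?thesis by (simp add: set_lebesgue_integral_def indicator_inter_arith mult.commute)
    qed
    fix A :: "'a set" assume "A \<in> sets lborel"
    then have A: "A \<in> sigma_sets UNIV {C. closed C}"
      by (simp add: borel_eq_closed)
    have "Int_stable {C::'a set. closed C}" "{C::'a set. closed C} \<subseteq> Pow UNIV"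
      by (auto simp: Int_stable_def)
    from this A show "set_lebesgue_integral lborel A ?g = 0"
    proof (induction rule: sigma_sets_induct_disjoint)
      case (basic A) then show ?case using comp by simp
    next
      case empty show ?case by (simp add: set_lebesgue_integral_def)
    next
      case (compl A)
      then have A: "A \<in> sets borel" by (simp add: borel_eq_closed)
      have "set_lebesgue_integral lborel (A \<union> (UNIV - A)) ?g =
          set_lebesgue_integral lborel A ?g + set_lebesgue_integral lborel (UNIV - A) ?g"
        using A by (intro set_integral_Un gi) auto
      moreover have "A \<union> (UNIV - A) = UNIV" by auto
      ultimately show ?case using compl.IH comp[of UNIV] by simp
    next
      case (union A)
      then have A: "A i \<in> sets borel" for i by (auto simp: borel_eq_closed)
      have "set_lebesgue_integral lborel (\<Union>i. A i) ?g = (\<Sum>i. set_lebesgue_integral lborel (A i) ?g)"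
        using A union(1) by (intro lebesgue_integral_countable_add gi) (auto simp: disjoint_family_on_def)
      then show ?case using union by simp
    qed
  qed
  then have "AE x in lborel. \<forall>k::nat. indicator (cball 0 (real k)) x *\<^sub>R d x = 0"
    unfolding AE_all_countable by blast
  then show ?thesis
  proof eventually_elim
    case (elim x)
    obtain k :: nat where "norm x \<le> real k" using real_arch_simple by blast
    then show ?case using elim[rule_format, of k] by simp
  qed
qed

section \<open>An L2 bound for the Fourier transform\<close>

text \<open>Schur's test: bound \<open>a x * a y\<close> by \<open>((a x)\<^sup>2 + (a y)\<^sup>2) / 2\<close> and integrate the kernel over the
  other variable.\<close>

lemma schur_quadratic:
  fixes a k :: "'a::euclidean_space \<Rightarrow> real"
  assumes [measurable]: "a \<in> borel_measurable borel" "k \<in> borel_measurable borel"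
    and nn: "\<And>x. a x \<ge> 0" "\<And>x. k x \<ge> 0"
  shows "(\<integral>\<^sup>+x. (\<integral>\<^sup>+y. ennreal (a x * (a y * k (x - y))) \<partial>lborel) \<partial>lborel) \<le>
    (\<integral>\<^sup>+x. ennreal (k x) \<partial>lborel) * (\<integral>\<^sup>+x. ennreal ((a x)\<^sup>2) \<partial>lborel)"
proof -
  let ?k = "\<integral>\<^sup>+x. ennreal (k x) \<partial>lborel"
  let ?a = "\<integral>\<^sup>+x. ennreal ((a x)\<^sup>2) \<partial>lborel"
  have k1: "(\<integral>\<^sup>+y. ennreal (k (x - y)) \<partial>lborel) = ?k" for x
    using nn_integral_lborel_affine[of "\<lambda>y. ennreal (k y)" "-1" x] by simp
  have k2: "(\<integral>\<^sup>+x. ennreal (k (x - y)) \<partial>lborel) = ?k" for y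
    using nn_integral_lborel_affine[of "\<lambda>y. ennreal (k y)" "1" "- y"] by simp
  have "(\<integral>\<^sup>+x. (\<integral>\<^sup>+y. ennreal (a x * (a y * k (x - y))) \<partial>lborel) \<partial>lborel) \<le>
    (\<integral>\<^sup>+x. (\<integral>\<^sup>+y. ennreal ((a x)\<^sup>2 / 2) * ennreal (k (x - y)) + ennreal ((a y)\<^sup>2 / 2) * ennreal (k (x - y)) \<partial>lborel) \<partial>lborel)"
  proof (intro nn_integral_mono)
    fix x y
    have "2 * (a x * a y) \<le> (a x)\<^sup>2 + (a y)\<^sup>2" using sum_squares_bound[of "a x" "a y"] by simp
    then have "(a x * a y) * k (x - y) \<le> ((a x)\<^sup>2 / 2 + (a y)\<^sup>2 / 2) * k (x - y)"
      using nn by (intro mult_right_mono) auto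
    then have "ennreal (a x * (a y * k (x - y))) \<le> ennreal (((a x)\<^sup>2 / 2) * k (x - y) + ((a y)\<^sup>2 / 2) * k (x - y))"
      by (intro ennreal_leI) (simp add: algebra_simps)
    also have "\<dots> = ennreal ((a x)\<^sup>2 / 2) * ennreal (k (x - y)) + ennreal ((a y)\<^sup>2 / 2) * ennreal (k (x - y))"
      using nn by (subst ennreal_plus) (auto simp: ennreal_mult[symmetric])
    finally show "ennreal (a x * (a y * k (x - y))) \<le> \<dots>" .
  qed
  also have "\<dots> = (\<integral>\<^sup>+x. (\<integral>\<^sup>+y. ennreal ((a x)\<^sup>2 / 2) * ennreal (k (x - y)) \<partial>lborel) \<partial>lborel) +
      (\<integral>\<^sup>+x. (\<integral>\<^sup>+y. ennreal ((a y)\<^sup>2 / 2) * ennreal (k (x - y)) \<partial>lborel) \<partial>lborel)"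
    by (simp add: nn_integral_add)
  also have "(\<integral>\<^sup>+x. (\<integral>\<^sup>+y. ennreal ((a y)\<^sup>2 / 2) * ennreal (k (x - y)) \<partial>lborel) \<partial>lborel) =
      (\<integral>\<^sup>+y. (\<integral>\<^sup>+x. ennreal ((a y)\<^sup>2 / 2) * ennreal (k (x - y)) \<partial>lborel) \<partial>lborel)"
    by (rule lborel_pair.Fubini') simp
  also have "\<dots> = (\<integral>\<^sup>+y. ennreal ((a y)\<^sup>2 / 2) * ?k \<partial>lborel)"
    by (simp add: nn_integral_cmult k2)
  also have "(\<integral>\<^sup>+x. (\<integral>\<^sup>+y. ennreal ((a x)\<^sup>2 / 2) * ennreal (k (x - y)) \<partial>lborel) \<partial>lborel) =
      (\<integral>\<^sup>+y. ennreal ((a y)\<^sup>2 / 2) * ?k \<partial>lborel)"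
    by (simp add: nn_integral_cmult k1)
  also have "(\<integral>\<^sup>+y. ennreal ((a y)\<^sup>2 / 2) * ?k \<partial>lborel) + (\<integral>\<^sup>+y. ennreal ((a y)\<^sup>2 / 2) * ?k \<partial>lborel) =
      (\<integral>\<^sup>+y. (ennreal ((a y)\<^sup>2 / 2) + ennreal ((a y)\<^sup>2 / 2)) * ?k \<partial>lborel)"
    by (simp add: nn_integral_add[symmetric] distrib_right)
  also have "\<dots> = (\<integral>\<^sup>+y. ennreal ((a y)\<^sup>2) * ?k \<partial>lborel)"
    by (simp add: ennreal_plus[symmetric] del: ennreal_plus)
  also have "\<dots> = ?a * ?k" by (rule nn_integral_multc) simp
  also have "\<dots> = ?k * ?a" by (rule mult.commute)
  finally show ?thesis .
qed

text \<open>Plancherel's inequality up to a constant. Inserting the factor \<open>\<eta> (x / R)\<close> turns the squared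
  \<open>L2\<close> norm of the transform into a quadratic form in \<open>m\<close> whose convolution kernel is the transform of
  that factor. The \<open>L1\<close> norm of the kernel is bounded uniformly in \<open>R\<close>, since \<open>R\<close> merely rescales it;
  so Schur's test applies, and \<open>R\<close> tends to infinity.\<close>

lemma osc_L2_bound:
  fixes \<eta> :: "'a::euclidean_space \<Rightarrow> real"
  assumes \<eta>: "unif_cutoff \<eta>"
  obtains C where "C \<ge> 0"
    "\<And>m :: 'a \<Rightarrow> complex. integrable lborel m \<Longrightarrow>
      (\<integral>\<^sup>+x. ennreal ((norm (osc 1 m x))\<^sup>2) \<partial>lborel) \<le> ennreal C * (\<integral>\<^sup>+x. ennreal ((norm (m x))\<^sup>2) \<partial>lborel)"
proof -
  let ?n = "DIM('a)"
  let ?e = "\<lambda>x. complex_of_real (\<eta> x)"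
  obtain B where B: "B > 0" "deriv_bounded (2 * ?n) 1 B ?e"
    using test_functions_deriv_bounded[OF unif_cutoff_test[OF \<eta>]] by blast
  define K where "K = unit_ball_vol ?n * 2 ^ ?n * (2 * real ?n) ^ (2 * ?n) * B"
  have K: "K \<ge> 0" using B by (simp add: K_def)
  define C where "C = K * decay_integral TYPE('a)"
  define e where "e R x = ?e ((x - 0) /\<^sub>R R)" for R x
  have e_test: "e R \<in> test_functions" if "R > 0" for R
    unfolding e_def using that by (intro test_functions_affine unif_cutoff_test[OF \<eta>]) auto
  have e_int: "integrable lborel (e R)" if "R > 0" for R
    by (intro schwartz_integrable test_functions_schwartz e_test that)
  have e_dec: "norm (osc 1 (e R) x) \<le> K * R ^ ?n / (1 + R * norm x) ^ (2 * ?n)" if "R > 0" for R x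
    unfolding K_def
  proof (rule osc_bump_decay[where z=0])
    show "deriv_bounded (2 * ?n) R B (e R)" unfolding e_def by (rule deriv_bounded_affine[OF B(2) that])
    show "e R y = 0" if "y \<notin> ball 0 (2 * R)" for y
      unfolding e_def using that \<open>R > 0\<close> by (simp add: unif_cutoff_eq_0[OF \<eta>] field_simps)
  qed (use that e_test in auto)
  have kernel: "(\<integral>\<^sup>+x. ennreal (norm (osc 1 (e R) x)) \<partial>lborel) \<le> ennreal C" if "R > 0" for R
  proof -
    have "(\<integral>\<^sup>+x. ennreal (norm (osc 1 (e R) x)) \<partial>lborel) \<le>
       (\<integral>\<^sup>+x. ennreal (K * R ^ ?n * (1 / (1 + R * norm x) ^ (2 * ?n))) \<partial>(lborel::'a measure))"
      using e_dec[OF that] by (intro nn_integral_mono ennreal_leI) simp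
    also have "\<dots> = ennreal (\<integral>x. K * R ^ ?n * (1 / (1 + R * norm x) ^ (2 * ?n)) \<partial>(lborel::'a measure))"
      using that K by (intro nn_integral_eq_integral integrable_mult_right integral_decay_scale) auto
    also have "(\<integral>x. K * R ^ ?n * (1 / (1 + R * norm x) ^ (2 * ?n)) \<partial>(lborel::'a measure)) = C"
      using that integral_decay_scale[OF that, where 'a='a]
      by (subst integral_mult_right_zero) (auto simp: C_def)
    finally show ?thesis .
  qed
  have main: "(\<integral>\<^sup>+x. ennreal (\<eta> (x /\<^sub>R R) * (norm (osc 1 m x))\<^sup>2) \<partial>lborel) \<le>
      ennreal C * (\<integral>\<^sup>+x. ennreal ((norm (m x))\<^sup>2) \<partial>lborel)"
    if R: "R > 0" and m: "integrable lborel m" for R and m :: "'a \<Rightarrow> complex"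
  proof -
    have [measurable]: "m \<in> borel_measurable borel" "e R \<in> borel_measurable borel"
      using m e_int[OF R] by auto
    have cm: "integrable lborel (\<lambda>x. cnj (m x))" using m by simp
    have [measurable]: "(\<lambda>x. cnj (m x)) \<in> borel_measurable borel"
      using borel_measurable_integrable[OF cm] by simp
    have cnj_osc: "cnj (osc 1 m x) = osc (-1) (\<lambda>x. cnj (m x)) x" for x
    proof -
      have "osc (-1) (\<lambda>x. cnj (m x)) x = (\<integral>y. cnj (cis (1 * (x \<bullet> y)) * m y) \<partial>lborel)"
        unfolding osc_def by (simp add: cis_cnj del: Bochner_Integration.integral_cnj)
      then show ?thesis by (simp only: osc_def[of 1] Bochner_Integration.integral_cnj)
    qed
    define \<theta> where "\<theta> x = osc (-1) (\<lambda>x. cnj (m x)) x * e R x" for x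
    have \<theta>: "integrable lborel \<theta>" unfolding \<theta>_def by (rule integrable_osc_mult[OF cm e_int[OF R]])
    have osc_\<theta>: "osc 1 \<theta> \<xi> = (\<integral>\<zeta>. cnj (m \<zeta>) * osc 1 (e R) (\<xi> - \<zeta>) \<partial>lborel)" for \<xi>
    proof -
      have "osc 1 \<theta> \<xi> = (\<integral>x. osc (-1) (\<lambda>x. cnj (m x)) x * (cis (1 * (\<xi> \<bullet> x)) * e R x) \<partial>lborel)"
        unfolding osc_def[of 1 \<theta>] \<theta>_def by (simp add: mult_ac)
      also have "\<dots> = (\<integral>\<zeta>. cnj (m \<zeta>) * osc (-1) (\<lambda>x. cis (1 * (\<xi> \<bullet> x)) * e R x) \<zeta> \<partial>lborel)"
        by (rule osc_mult_integral[OF cm integrable_osc[OF e_int[OF R]]])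
      moreover have "osc (-1) (\<lambda>x. cis (1 * (\<xi> \<bullet> x)) * e R x) \<zeta> = osc 1 (e R) (\<xi> - \<zeta>)" for \<zeta>
        unfolding osc_def by (simp add: mult.assoc[symmetric] cis_mult inner_diff_left inner_diff_right inner_commute)
      ultimately show ?thesis by (simp only:)
    qed
    have bound: "ennreal (norm (osc 1 \<theta> \<xi>)) \<le> (\<integral>\<^sup>+\<zeta>. ennreal (norm (m \<zeta>) * norm (osc 1 (e R) (\<xi> - \<zeta>))) \<partial>lborel)" for \<xi>
    proof -
      have "integrable lborel (\<lambda>\<zeta>. cnj (m \<zeta>) * osc 1 (e R) (\<xi> - \<zeta>))"
        by (rule Bochner_Integration.integrable_bound[OF integrable_mult_left[OF integrable_norm[OF m],
              of "\<integral>y. norm (e R y) \<partial>lborel"]])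
          (auto simp: norm_mult intro!: mult_left_mono norm_osc_le[OF e_int[OF R]] intro: order_trans[OF _ abs_ge_self])
      from integral_norm_bound_ennreal[OF this] show ?thesis
        unfolding osc_\<theta> by (simp add: norm_mult)
    qed
    have eqR: "osc 1 m x * \<theta> x = complex_of_real (\<eta> (x /\<^sub>R R) * (norm (osc 1 m x))\<^sup>2)" for x
      unfolding \<theta>_def e_def cnj_osc[symmetric]
      by (simp add: complex_norm_square[symmetric] mult_ac flip: of_real_power)
    have int: "integrable lborel (\<lambda>x. osc 1 m x * \<theta> x)" by (rule integrable_osc_mult[OF m \<theta>])
    have "(\<integral>\<^sup>+x. ennreal (\<eta> (x /\<^sub>R R) * (norm (osc 1 m x))\<^sup>2) \<partial>lborel) =
        ennreal (\<integral>x. \<eta> (x /\<^sub>R R) * (norm (osc 1 m x))\<^sup>2 \<partial>lborel)"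
      using unif_cutoff_bounds[OF \<eta>] int[unfolded eqR complex_of_real_integrable_eq]
      by (intro nn_integral_eq_integral) auto
    also have "\<dots> \<le> ennreal (norm (\<integral>x. osc 1 m x * \<theta> x \<partial>lborel))"
      unfolding eqR integral_complex_of_real by (intro ennreal_leI) simp
    also have "(\<integral>x. osc 1 m x * \<theta> x \<partial>lborel) = (\<integral>x. m x * osc 1 \<theta> x \<partial>lborel)"
      by (rule osc_mult_integral[OF m \<theta>])
    also have "ennreal (norm \<dots>) \<le> (\<integral>\<^sup>+x. norm (m x * osc 1 \<theta> x) \<partial>lborel)"
      by (rule integral_norm_bound_ennreal) (use integrable_osc_mult[OF \<theta> m, of 1] in \<open>simp add: mult.commute\<close>)
    also have "\<dots> \<le> (\<integral>\<^sup>+x. (\<integral>\<^sup>+y. ennreal (norm (m x) * (norm (m y) * norm (osc 1 (e R) (x - y)))) \<partial>lborel) \<partial>lborel)"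
    proof (intro nn_integral_mono)
      fix x
      have "ennreal (norm (m x * osc 1 \<theta> x)) = ennreal (norm (m x)) * ennreal (norm (osc 1 \<theta> x))"
        by (simp add: norm_mult ennreal_mult)
      also have "\<dots> \<le> ennreal (norm (m x)) * (\<integral>\<^sup>+y. ennreal (norm (m y) * norm (osc 1 (e R) (x - y))) \<partial>lborel)"
        by (intro mult_left_mono bound) simp
      also have "\<dots> = (\<integral>\<^sup>+y. ennreal (norm (m x)) * ennreal (norm (m y) * norm (osc 1 (e R) (x - y))) \<partial>lborel)"
        by (intro nn_integral_cmult[symmetric]) simp
      finally show "ennreal (norm (m x * osc 1 \<theta> x)) \<le> (\<integral>\<^sup>+y. ennreal (norm (m x) * (norm (m y) * norm (osc 1 (e R) (x - y)))) \<partial>lborel)"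
        by (simp add: ennreal_mult)
    qed
    also have "\<dots> \<le> (\<integral>\<^sup>+x. ennreal (norm (osc 1 (e R) x)) \<partial>lborel) * (\<integral>\<^sup>+x. ennreal ((norm (m x))\<^sup>2) \<partial>lborel)"
      by (rule schur_quadratic) auto
    also have "\<dots> \<le> ennreal C * (\<integral>\<^sup>+x. ennreal ((norm (m x))\<^sup>2) \<partial>lborel)"
      by (intro mult_right_mono kernel R) simp
    finally show ?thesis .
  qed
  show thesis
  proof (rule that[of C])
    show "C \<ge> 0" using K by (simp add: C_def decay_integral_nonneg)
    fix m :: "'a \<Rightarrow> complex" assume m: "integrable lborel m"
    have [measurable]: "m \<in> borel_measurable borel" using m by auto
    have [measurable]: "\<eta> \<in> borel_measurable borel" by (rule unif_cutoff_measurable[OF \<eta>])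
    let ?F = "\<lambda>k x. ennreal (\<eta> (x /\<^sub>R real (Suc k)) * (norm (osc 1 m x))\<^sup>2)"
    have "liminf (\<lambda>k. ?F k x) = ennreal ((norm (osc 1 m x))\<^sup>2)" for x
    proof -
      obtain k0 :: nat where k0: "norm x < real k0" using reals_Archimedean2 by blast
      have "eventually (\<lambda>k. ?F k x = ennreal ((norm (osc 1 m x))\<^sup>2)) sequentially"
      proof (rule eventually_sequentiallyI[of k0])
        fix k assume "k0 \<le> k"
        then have "norm x < real (Suc k)" using k0 by simp
        then have "\<eta> (x /\<^sub>R real (Suc k)) = 1" by (intro unif_cutoff_eq_1[OF \<eta>]) (simp add: field_simps)
        then show "?F k x = ennreal ((norm (osc 1 m x))\<^sup>2)" by simp
      qed
      then have "(\<lambda>k. ?F k x) \<longlonglongrightarrow> ennreal ((norm (osc 1 m x))\<^sup>2)" by (rule tendsto_eventually)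
      then show ?thesis by (simp add: lim_imp_Liminf)
    qed
    then have "(\<integral>\<^sup>+x. ennreal ((norm (osc 1 m x))\<^sup>2) \<partial>lborel) = (\<integral>\<^sup>+x. liminf (\<lambda>k. ?F k x) \<partial>lborel)" by simp
    also have "\<dots> \<le> liminf (\<lambda>k. \<integral>\<^sup>+x. ?F k x \<partial>lborel)"
      by (rule nn_integral_liminf) simp
    also have "\<dots> \<le> liminf (\<lambda>k::nat. ennreal C * (\<integral>\<^sup>+x. ennreal ((norm (m x))\<^sup>2) \<partial>lborel))"
      by (intro Liminf_mono always_eventually allI main m) simp
    finally show "(\<integral>\<^sup>+x. ennreal ((norm (osc 1 m x))\<^sup>2) \<partial>lborel) \<le> ennreal C * (\<integral>\<^sup>+x. ennreal ((norm (m x))\<^sup>2) \<partial>lborel)"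
      by (simp add: Liminf_const)
  qed
qed



section \<open>Bessel potential norms of bumps\<close>

lemma bessel_weight_measurable [measurable]: "bessel_weight r \<in> borel_measurable borel"
  unfolding bessel_weight_def by measurable

lemma norm_bessel_weight: "norm (bessel_weight r x) = (1 + (norm x)\<^sup>2) powr (r / 2)"
  by (simp add: bessel_weight_def)

lemma fourier_measurable:
  assumes "f \<in> borel_measurable borel"
  shows "fourier f \<in> borel_measurable borel" "inv_fourier f \<in> borel_measurable borel"
  using assms unfolding fourier_osc[abs_def] inv_fourier_osc[abs_def] by (simp_all add: osc_measurable)

lemma norm_bessel_weight_le:
  fixes x :: "'a::euclidean_space"
  assumes "0 < l" "l \<le> 1" "0 \<le> r" "r \<le> real N"
  shows "norm (bessel_weight r x) \<le> l powr (- r) * (1 + l * norm x) ^ N"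
proof -
  have pos: "1 + l * norm x > 0" "1 + norm x > 0" using assms by (auto simp: add_pos_nonneg)
  have "norm (bessel_weight r x) \<le> ((1 + norm x)\<^sup>2) powr (r / 2)"
    unfolding norm_bessel_weight using assms by (intro powr_mono2) (auto simp: power2_sum)
  also have "\<dots> = (1 + norm x) powr r" using pos by (simp add: powr_powr flip: powr_numeral)
  also have "\<dots> \<le> (inverse l * (1 + l * norm x)) powr r"
  proof (intro powr_mono2)
    have "1 \<le> inverse l" using assms by (simp add: one_le_inverse)
    moreover have "inverse l * (1 + l * norm x) = inverse l + norm x" using assms by (simp add: field_simps)
    ultimately show "1 + norm x \<le> inverse l * (1 + l * norm x)" by simp
  qed (use assms pos in auto)
  also have "\<dots> = l powr (- r) * (1 + l * norm x) powr r"
    using assms pos by (simp add: powr_mult powr_minus inverse_powr)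
  also have "(1 + l * norm x) powr r \<le> (1 + l * norm x) powr real N"
    using assms by (intro powr_mono) auto
  also have "(1 + l * norm x) powr real N = (1 + l * norm x) ^ N" using pos by (simp add: powr_realpow)
  finally show ?thesis by (simp add: mult_left_mono)
qed

text \<open>Up to constants the transform is bounded by \<open>\<integral>\<bar>m\<bar>\<close>, which is at most of order \<open>A / l ^ n\<close> with
  \<open>n\<close> the dimension, and its squared \<open>L2\<close> norm is at most of order \<open>A\<^sup>2 / l ^ n\<close>. Interpolation between the two gives \<open>Lp\<close> for
  all \<open>p \<ge> 2\<close>.\<close>

lemma inv_fourier_Lp_bound:
  fixes \<eta> :: "'a::euclidean_space \<Rightarrow> real"
  assumes \<eta>: "unif_cutoff \<eta>" and p: "2 \<le> p"
  obtains E where "E > 0"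
    "\<And>l A (m :: 'a \<Rightarrow> complex). 0 < l \<Longrightarrow> 0 < A \<Longrightarrow> m \<in> borel_measurable borel \<Longrightarrow>
      (\<And>\<xi>. norm (m \<xi>) \<le> A / (1 + l * norm \<xi>) ^ (2 * DIM('a))) \<Longrightarrow>
      integrable lborel m \<and> inv_fourier m \<in> Lp_functions p \<and>
      Lp_norm p (inv_fourier m) \<le> E * A * l powr (DIM('a) / p - DIM('a))"
proof -
  let ?n = "DIM('a)"
  obtain C where C: "C \<ge> 0"
    "\<And>m :: 'a \<Rightarrow> complex. integrable lborel m \<Longrightarrow>
      (\<integral>\<^sup>+x. ennreal ((norm (osc 1 m x))\<^sup>2) \<partial>lborel) \<le> ennreal C * (\<integral>\<^sup>+x. ennreal ((norm (m x))\<^sup>2) \<partial>lborel)"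
    using osc_L2_bound[OF \<eta>] by blast
  define c where "c = fourier_const TYPE('a)"
  define Q where "Q = decay_integral TYPE('a)"
  have c: "c > 0" by (simp add: c_def fourier_const_pos)
  have Q: "Q \<ge> 0" by (simp add: Q_def decay_integral_nonneg)
  \<comment> \<open>Large enough for the supremum bound, with constant \<open>c * Q\<close>, and for the squared \<open>L2\<close> bound, with
    constant \<open>c\<^sup>2 * Q * C\<close>.\<close>
  define E where "E = c * (1 + Q) * (1 + C)"
  have E: "E > 0" unfolding E_def using c Q C by (intro mult_pos_pos add_pos_nonneg) auto
  show thesis
  proof (rule that[OF E])
    fix l A :: real and m :: "'a \<Rightarrow> complex"
    assume l: "0 < l" and A: "0 < A" and [measurable]: "m \<in> borel_measurable borel"
      and bound: "\<And>\<xi>. norm (m \<xi>) \<le> A / (1 + l * norm \<xi>) ^ (2 * ?n)"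
    let ?d = "\<lambda>x::'a. 1 / (1 + l * norm x) ^ (2 * ?n)"
    note d = integral_decay_scale[OF l, where 'a='a, folded Q_def]
    have d_bounds: "0 \<le> ?d x" "?d x \<le> 1" for x
    proof -
      have "1 \<le> (1 + l * norm x) ^ (2 * ?n)" using l by (intro one_le_power) simp
      then show "0 \<le> ?d x" "?d x \<le> 1" by (auto simp: divide_le_eq_1)
    qed
    have mi: "integrable lborel m"
      by (rule Bochner_Integration.integrable_bound[OF integrable_mult_right[OF d(1), of A]])
        (use bound A l in auto)
    define h where "h = inv_fourier m"
    have h_eq: "norm (h x) = c * norm (osc 1 m x)" for x
      using c by (simp add: h_def inv_fourier_osc norm_mult c_def)
    have [measurable]: "h \<in> borel_measurable borel" unfolding h_def by (rule fourier_measurable) simp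
    define X where "X = E * A"
    have X: "X > 0" using E A by (simp add: X_def)
    define S where "S = X / l ^ ?n"
    have S: "S > 0" using X l by (simp add: S_def)
    have sup: "norm (h x) \<le> S" for x
    proof -
      have "norm (osc 1 m x) \<le> (\<integral>y. norm (m y) \<partial>lborel)" by (rule norm_osc_le[OF mi])
      also have "\<dots> \<le> (\<integral>y. A * ?d y \<partial>lborel)"
        using bound by (intro integral_mono integrable_norm mi integrable_mult_right d(1)) simp
      also have "\<dots> = A * (Q / l ^ ?n)" by (simp only: integral_mult_right_zero d(2))
      finally have "norm (h x) \<le> c * (A * (Q / l ^ ?n))"
        unfolding h_eq using c by (intro mult_left_mono) auto
      also have "\<dots> = (c * Q) * A / l ^ ?n" by simp
      also have "\<dots> \<le> S"
      proof -
        have "Q * 1 \<le> (1 + Q) * (1 + C)" using Q C by (intro mult_mono) auto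
        then have "c * Q \<le> E" using c by (simp add: E_def mult.assoc)
        then show ?thesis unfolding S_def X_def using A l by (intro divide_right_mono mult_right_mono) auto
      qed
      finally show ?thesis .
    qed
    have L2: "(\<integral>\<^sup>+x. ennreal ((norm (h x))\<^sup>2) \<partial>lborel) \<le> ennreal (X\<^sup>2 / l ^ ?n)"
    proof -
      have "(\<integral>\<^sup>+x. ennreal ((norm (h x))\<^sup>2) \<partial>lborel) = ennreal (c\<^sup>2) * (\<integral>\<^sup>+x. ennreal ((norm (osc 1 m x))\<^sup>2) \<partial>lborel)"
        unfolding h_eq power_mult_distrib by (subst nn_integral_cmult[symmetric]) (auto simp: ennreal_mult)
      also have "\<dots> \<le> ennreal (c\<^sup>2) * (ennreal C * (\<integral>\<^sup>+x. ennreal ((norm (m x))\<^sup>2) \<partial>lborel))"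
        by (intro mult_left_mono C(2) mi) simp
      also have "(\<integral>\<^sup>+x. ennreal ((norm (m x))\<^sup>2) \<partial>lborel) \<le> (\<integral>\<^sup>+x. ennreal (A\<^sup>2 * ?d x) \<partial>lborel)"
      proof (intro nn_integral_mono ennreal_leI)
        fix x
        have "(norm (m x))\<^sup>2 \<le> (A * ?d x)\<^sup>2" using bound[of x] by (intro power_mono) auto
        also have "\<dots> = A\<^sup>2 * (?d x * ?d x)" by (simp add: power2_eq_square)
        also have "\<dots> \<le> A\<^sup>2 * ?d x" using d_bounds[of x] by (intro mult_left_mono mult_left_le) auto
        finally show "(norm (m x))\<^sup>2 \<le> A\<^sup>2 * ?d x" .
      qed
      also have "(\<integral>\<^sup>+x. ennreal (A\<^sup>2 * ?d x) \<partial>lborel) = ennreal (\<integral>x. A\<^sup>2 * ?d x \<partial>lborel)"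
        using d_bounds by (intro nn_integral_eq_integral integrable_mult_right d(1)) auto
      also have "(\<integral>x. A\<^sup>2 * ?d x \<partial>lborel) = A\<^sup>2 * (Q / l ^ ?n)" by (simp only: integral_mult_right_zero d(2))
      also have "ennreal (c\<^sup>2) * (ennreal C * ennreal (A\<^sup>2 * (Q / l ^ ?n))) = ennreal ((c\<^sup>2 * (Q * C)) * A\<^sup>2 / l ^ ?n)"
        using C Q c l by (simp add: ennreal_mult[symmetric] mult_ac)
      also have "\<dots> \<le> ennreal (X\<^sup>2 / l ^ ?n)"
      proof (intro ennreal_leI)
        have "Q * C \<le> (1 + Q)\<^sup>2 * (1 + C)\<^sup>2" using Q C
          by (intro mult_mono) (auto simp: power2_eq_square algebra_simps)
        then have "c\<^sup>2 * (Q * C) \<le> E\<^sup>2" unfolding E_def power_mult_distrib mult.assoc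
          by (intro mult_left_mono) auto
        then show "c\<^sup>2 * (Q * C) * A\<^sup>2 / l ^ ?n \<le> X\<^sup>2 / l ^ ?n"
          unfolding X_def power_mult_distrib using l by (intro divide_right_mono mult_right_mono) auto
      qed
      finally show ?thesis by (simp add: mult_left_mono)
    qed
    define T where "T = S powr (p - 2) * (X\<^sup>2 / l ^ ?n)"
    have T: "(\<integral>\<^sup>+x. ennreal (norm (h x) powr p) \<partial>lborel) \<le> ennreal T"
    proof -
      have "norm (h x) powr p \<le> S powr (p - 2) * (norm (h x))\<^sup>2" for x
      proof (cases "h x = 0")
        case False
        then have "norm (h x) powr p = norm (h x) powr (p - 2) * (norm (h x))\<^sup>2"
          by (simp add: powr_add[symmetric] flip: powr_numeral)
        also have "\<dots> \<le> S powr (p - 2) * (norm (h x))\<^sup>2"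
          using p sup by (intro mult_right_mono powr_mono2) auto
        finally show ?thesis .
      qed simp
      then have "(\<integral>\<^sup>+x. ennreal (norm (h x) powr p) \<partial>lborel) \<le> (\<integral>\<^sup>+x. ennreal (S powr (p - 2)) * ennreal ((norm (h x))\<^sup>2) \<partial>lborel)"
        by (intro nn_integral_mono) (simp add: ennreal_mult[symmetric] ennreal_leI)
      also have "\<dots> = ennreal (S powr (p - 2)) * (\<integral>\<^sup>+x. ennreal ((norm (h x))\<^sup>2) \<partial>lborel)"
        by (rule nn_integral_cmult) simp
      also have "\<dots> \<le> ennreal (S powr (p - 2)) * ennreal (X\<^sup>2 / l ^ ?n)"
        by (intro mult_left_mono L2) simp
      also have "\<dots> = ennreal T" unfolding T_def using l by (intro ennreal_mult[symmetric]) auto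
      finally show ?thesis .
    qed
    have hi: "integrable lborel (\<lambda>x. norm (h x) powr p)"
      using order_le_less_trans[OF T ennreal_less_top] by (intro integrableI_nonneg) auto
    have "ennreal (\<integral>x. norm (h x) powr p \<partial>lborel) \<le> ennreal T"
      using T hi by (subst nn_integral_eq_integral[symmetric]) auto
    moreover have "T \<ge> 0" unfolding T_def using l by simp
    ultimately have "(\<integral>x. norm (h x) powr p \<partial>lborel) \<le> T" by simp
    then have "Lp_norm p h \<le> T powr (1 / p)"
      unfolding Lp_norm_def using p by (intro powr_mono2) (auto intro: integral_nonneg_AE)
    also have "T = X powr p * l powr (- real ?n * (p - 1))"
    proof -
      have ln: "l ^ ?n = l powr real ?n" using l by (simp add: powr_realpow)
      have "S = X * l powr (- real ?n)" unfolding S_def ln by (simp add: powr_minus divide_inverse)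
      then have "S powr (p - 2) = X powr (p - 2) * l powr (- real ?n * (p - 2))"
        using X l by (simp add: powr_mult powr_powr)
      then have "T = (X powr (p - 2) * X powr 2) * (l powr (- real ?n * (p - 2)) * l powr (- real ?n))"
        unfolding T_def ln using X by (simp add: powr_minus divide_inverse)
      also have "\<dots> = X powr p * l powr (- real ?n * (p - 1))"
        unfolding powr_add[symmetric] by (simp add: algebra_simps)
      finally show ?thesis .
    qed
    also have "(X powr p * l powr (- real ?n * (p - 1))) powr (1 / p) = X * l powr (real ?n / p - real ?n)"
    proof -
      have "- real ?n * (p - 1) * (1 / p) = real ?n / p - real ?n" using p by (simp add: field_simps)
      then show ?thesis using X l p by (simp add: powr_mult powr_powr)
    qed
    finally show "integrable lborel m \<and> inv_fourier m \<in> Lp_functions p \<and>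
      Lp_norm p (inv_fourier m) \<le> E * A * l powr (real ?n / p - real ?n)"
      using mi hi by (simp add: Lp_functions_def h_def[symmetric] X_def)
  qed
qed

text \<open>The Fourier transform of the Bessel potential of \<open>g\<close>.\<close>

definition bessel_symbol :: "real \<Rightarrow> ('a::euclidean_space \<Rightarrow> complex) \<Rightarrow> 'a \<Rightarrow> complex" where
  "bessel_symbol r g = (\<lambda>\<xi>. bessel_weight r \<xi> * fourier g \<xi>)"

lemma bessel_symbol_measurable:
  "g \<in> borel_measurable borel \<Longrightarrow> bessel_symbol r g \<in> borel_measurable borel"
  unfolding bessel_symbol_def by (intro borel_measurable_times bessel_weight_measurable fourier_measurable)

text \<open>Both transforms and the weight are moved from the Schwartz function to \<open>g\<close> by the multiplication
  formula \<open>osc_mult_integral\<close>. This is legitimate since the transform of a Schwartz function decays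
  fast enough to be integrable against the weight.\<close>

lemma bessel_J_generated:
  fixes g :: "'a::euclidean_space \<Rightarrow> complex"
  assumes r: "0 \<le> r" "r \<le> real DIM('a)" and g: "integrable lborel g"
    and m: "integrable lborel (bessel_symbol r g)"
  shows "generates (inv_fourier (bessel_symbol r g)) (bessel_J r (regular_dist g))"
  unfolding generates_def
proof
  fix \<phi> :: "'a \<Rightarrow> complex" assume \<phi>: "\<phi> \<in> schwartz_functions"
  let ?n = "DIM('a)"
  define c where "c = fourier_const TYPE('a)"
  have \<phi>i: "integrable lborel \<phi>" by (rule schwartz_integrable[OF \<phi>])
  define k where "k x = bessel_weight r x * inv_fourier \<phi> x" for x
  obtain C where C: "C \<ge> 0" "\<And>x. norm (osc 1 \<phi> x) \<le> C / (1 + norm x) ^ (3 * ?n)"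
    using schwartz_osc_decay[OF \<phi>, of 1 "3 * ?n"] by auto
  have "integrable lborel k"
  proof (rule integrable_from_decay)
    have [measurable]: "inv_fourier \<phi> \<in> borel_measurable borel"
      using \<phi>i by (intro fourier_measurable) auto
    show "k \<in> borel_measurable borel" unfolding k_def by measurable
    fix x :: 'a
    have pos: "1 + norm x > 0" by (simp add: add_pos_nonneg)
    have "norm (k x) \<le> (1 + norm x) ^ ?n * (c * (C / (1 + norm x) ^ (3 * ?n)))"
      unfolding k_def norm_mult inv_fourier_osc c_def[symmetric]
      using norm_bessel_weight_le[of 1 r ?n x] r C c_def fourier_const_pos[where 'a='a]
      by (intro mult_mono) auto
    also have "(1 + norm x) ^ (3 * ?n) = (1 + norm x) ^ ?n * (1 + norm x) ^ (2 * ?n)"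
      by (simp flip: power_add)
    finally show "norm (k x) \<le> c * C / (1 + norm x) ^ (2 * ?n)" using pos by simp
  qed
  note ki = this
  have "bessel_J r (regular_dist g) \<phi> = (\<integral>x. g x * fourier k x \<partial>lborel)"
    by (simp add: bessel_J_def inv_fourier_dist_def mult_dist_def fourier_dist_def regular_dist_def k_def[abs_def])
  also have "\<dots> = (\<integral>x. c * (g x * osc (-1) k x) \<partial>lborel)"
    by (simp add: fourier_osc c_def mult_ac)
  also have "\<dots> = c * (\<integral>x. osc (-1) g x * k x \<partial>lborel)"
    by (simp add: osc_mult_integral[OF g ki])
  also have "\<dots> = (\<integral>x. c * (osc (-1) g x * k x) \<partial>lborel)" by simp
  also have "\<dots> = (\<integral>x. c * (bessel_symbol r g x * osc 1 \<phi> x) \<partial>lborel)"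
    by (simp add: k_def bessel_symbol_def fourier_osc inv_fourier_osc c_def mult_ac)
  also have "\<dots> = c * (\<integral>x. osc 1 (bessel_symbol r g) x * \<phi> x \<partial>lborel)"
    by (simp add: osc_mult_integral[OF m \<phi>i])
  also have "\<dots> = (\<integral>x. c * (osc 1 (bessel_symbol r g) x * \<phi> x) \<partial>lborel)" by simp
  also have "\<dots> = regular_dist (inv_fourier (bessel_symbol r g)) \<phi>"
    by (simp add: regular_dist_def inv_fourier_osc c_def mult_ac)
  finally show "bessel_J r (regular_dist g) \<phi> = regular_dist (inv_fourier (bessel_symbol r g)) \<phi>" .
qed

lemma Lp_locally_integrable:
  fixes f :: "'a::euclidean_space \<Rightarrow> complex"
  assumes f: "f \<in> Lp_functions p" and p: "1 \<le> p"
  shows "set_integrable lborel (cball 0 R) f"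
  unfolding set_integrable_def
proof (rule Bochner_Integration.integrable_bound)
  show "integrable lborel (\<lambda>x. indicator (cball 0 R) x + norm (f x) powr p)"
    using f emeasure_bounded_finite[of "cball (0::'a) R"]
    by (intro Bochner_Integration.integrable_add integrable_real_indicator) (auto simp: Lp_functions_def)
  have [measurable]: "f \<in> borel_measurable borel" using f by (simp add: Lp_functions_def)
  show "(\<lambda>x. indicator (cball 0 R) x *\<^sub>R f x) \<in> borel_measurable lborel"
    by (intro borel_measurable_scaleR borel_measurable_indicator) auto
  have "norm (f x) \<le> 1 + norm (f x) powr p" for x
  proof (cases "norm (f x) \<le> 1")
    case False
    then show ?thesis using powr_mono[OF p, of "norm (f x)"] by simp
  qed (simp add: add_increasing2)
  then show "AE x in lborel. norm (indicator (cball 0 R) x *\<^sub>R f x) \<le> norm (indicator (cball 0 R) x + norm (f x) powr p)"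
    by (auto split: split_indicator)
qed

lemma locally_integrable_mult_test:
  fixes f :: "'a::euclidean_space \<Rightarrow> complex"
  assumes [measurable]: "f \<in> borel_measurable borel" and f: "\<And>R. set_integrable lborel (cball 0 R) f"
    and \<phi>: "\<phi> \<in> test_functions"
  shows "integrable lborel (\<lambda>x. f x * \<phi> x)"
proof -
  obtain R where R: "smooth \<phi>" "R > 0" "\<And>x. \<phi> x \<noteq> 0 \<Longrightarrow> norm x \<le> R"
    using test_functionsE[OF \<phi>] by blast
  have [measurable]: "\<phi> \<in> borel_measurable borel" by (rule smooth_measurable[OF R(1)])
  obtain C where C: "C > 0" "\<And>x. norm (\<phi> x) \<le> C"
    using schwartz_decay[OF test_functions_schwartz[OF \<phi>], of 0] by auto
  show ?thesis
  proof (rule Bochner_Integration.integrable_bound)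
    show "integrable lborel (\<lambda>x. C *\<^sub>R (indicator (cball 0 R) x *\<^sub>R f x))"
      using f[of R] by (intro integrable_scaleR_right) (simp add: set_integrable_def)
    show "AE x in lborel. norm (f x * \<phi> x) \<le> norm (C *\<^sub>R (indicator (cball 0 R) x *\<^sub>R f x))"
    proof (rule AE_I2)
      fix x
      show "norm (f x * \<phi> x) \<le> norm (C *\<^sub>R (indicator (cball 0 R) x *\<^sub>R f x))"
      proof (cases "\<phi> x = 0")
        case False
        then have "x \<in> cball 0 R" using R by auto
        then show ?thesis using C mult_right_mono[OF C(2)[of x], of "norm (f x)"]
          by (simp add: norm_mult mult.commute)
      qed simp
    qed
  qed simp
qed

lemma generates_unique:
  fixes f h :: "'a::euclidean_space \<Rightarrow> complex" and \<eta> :: "'a \<Rightarrow> real"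
  assumes \<eta>: "unif_cutoff \<eta>" and p: "1 \<le> p"
    and f: "f \<in> Lp_functions p" "generates f v" and h: "h \<in> Lp_functions p" "generates h v"
  shows "AE x in lborel. f x = h x"
proof -
  have [measurable]: "f \<in> borel_measurable borel" "h \<in> borel_measurable borel"
    using f h by (auto simp: Lp_functions_def)
  note li = Lp_locally_integrable[OF f(1) p] Lp_locally_integrable[OF h(1) p]
  have "AE x in lborel. f x - h x = 0"
  proof (rule AE_eq_0_from_test_functions[OF \<eta>])
    show "set_integrable lborel (cball 0 R) (\<lambda>x. f x - h x)" for R by (intro set_integral_diff li)
    fix \<phi> :: "'a \<Rightarrow> complex" assume \<phi>: "\<phi> \<in> test_functions"
    have "regular_dist f \<phi> = regular_dist h \<phi>"
      using f(2) h(2) test_functions_schwartz[OF \<phi>] by (simp add: generates_def)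
    then show "(\<integral>x. (f x - h x) * \<phi> x \<partial>lborel) = 0"
      using li \<phi> by (simp add: left_diff_distrib regular_dist_def locally_integrable_mult_test)
  qed simp
  then show ?thesis by simp
qed

lemma H0_norm_eq:
  fixes h :: "'a::euclidean_space \<Rightarrow> complex" and \<eta> :: "'a \<Rightarrow> real"
  assumes \<eta>: "unif_cutoff \<eta>" and p: "1 \<le> p"
    and h: "h \<in> Lp_functions p" "generates h v"
  shows "H0_norm p v = Lp_norm p h"
proof -
  define f where "f = (SOME f. f \<in> Lp_functions p \<and> generates f v)"
  have f: "f \<in> Lp_functions p \<and> generates f v" unfolding f_def by (rule someI[of _ h]) (use h in blast)
  have [measurable]: "f \<in> borel_measurable borel" "h \<in> borel_measurable borel"
    using f h by (auto simp: Lp_functions_def)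
  have AE: "AE x in lborel. f x = h x" by (rule generates_unique[OF \<eta> p _ _ h]) (use f in auto)
  have "(\<integral>x. norm (f x) powr p \<partial>lborel) = (\<integral>x. norm (h x) powr p \<partial>lborel)"
    by (rule integral_cong_AE) (use AE in auto)
  then show ?thesis unfolding H0_norm_def f_def[symmetric] Lp_norm_def by simp
qed

lemma regular_dist_linear:
  fixes g :: "'a::euclidean_space \<Rightarrow> complex"
  assumes g: "integrable lborel g"
    and bd: "\<And>\<phi>. \<phi> \<in> X \<Longrightarrow> \<phi> \<in> schwartz_functions"
  shows "linear_functional_on X (regular_dist g)"
  unfolding linear_functional_on_def
proof (intro ballI allI)
  fix \<phi> \<psi> :: "'a \<Rightarrow> complex" and a b assume X: "\<phi> \<in> X" "\<psi> \<in> X"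
  have i: "integrable lborel (\<lambda>x. g x * \<phi> x)" if \<phi>X: "\<phi> \<in> X" for \<phi>
  proof -
    obtain C where C: "C > 0" "\<And>x. norm (\<phi> x) \<le> C"
      using schwartz_decay[OF bd[OF \<phi>X], of 0] by auto
    have [measurable]: "\<phi> \<in> borel_measurable borel" "g \<in> borel_measurable borel"
      using smooth_measurable[OF schwartz_smooth[OF bd[OF \<phi>X]]] g by auto
    show ?thesis
      by (rule Bochner_Integration.integrable_bound[OF integrable_mult_left[OF integrable_norm[OF g], of C]])
        (use C in \<open>auto simp: norm_mult mult_left_mono\<close>)
  qed
  have "regular_dist g (\<lambda>x. a * \<phi> x + b * \<psi> x) = (\<integral>x. a * (g x * \<phi> x) + b * (g x * \<psi> x) \<partial>lborel)"
    by (simp add: regular_dist_def algebra_simps)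
  also have "\<dots> = (\<integral>x. a * (g x * \<phi> x) \<partial>lborel) + (\<integral>x. b * (g x * \<psi> x) \<partial>lborel)"
    by (intro Bochner_Integration.integral_add integrable_mult_right i X)
  also have "\<dots> = a * regular_dist g \<phi> + b * regular_dist g \<psi>" by (simp add: regular_dist_def)
  finally show "regular_dist g (\<lambda>x. a * \<phi> x + b * \<psi> x) = a * regular_dist g \<phi> + b * regular_dist g \<psi>" .
qed

lemma regular_dist_tendsto:
  fixes g :: "'a::euclidean_space \<Rightarrow> complex"
  assumes g: "integrable lborel g"
    and meas: "\<And>j. F j \<in> borel_measurable borel" "f \<in> borel_measurable borel"
    and f: "\<And>x. norm (f x) \<le> C"
    and lim: "uniform_limit UNIV F f sequentially"
  shows "(\<lambda>j. regular_dist g (F j)) \<longlonglongrightarrow> regular_dist g f"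
proof -
  have "eventually (\<lambda>j. \<forall>x. dist (F j x) (f x) < 1) sequentially"
    using lim unfolding uniform_limit_iff by auto
  then obtain j0 where j0: "\<And>j x. j \<ge> j0 \<Longrightarrow> dist (F j x) (f x) < 1"
    unfolding eventually_sequentially by blast
  have [measurable]: "g \<in> borel_measurable borel" using g by auto
  note meas[measurable]
  have "(\<lambda>j. \<integral>x. g x * F (j + j0) x \<partial>lborel) \<longlonglongrightarrow> (\<integral>x. g x * f x \<partial>lborel)"
  proof (rule integral_dominated_convergence[where w="\<lambda>x. norm (g x) * (C + 1)"])
    show "integrable lborel (\<lambda>x. norm (g x) * (C + 1))" using g by simp
    have "norm (F (j + j0) x) \<le> C + 1" for j x
      using j0[of "j + j0" x] f[of x] norm_triangle_sub[of "F (j + j0) x" "f x"] by (simp add: dist_norm)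
    then show "AE x in lborel. norm (g x * F (j + j0) x) \<le> norm (g x) * (C + 1)" for j
      by (intro AE_I2) (simp add: norm_mult mult_left_mono)
    have "(\<lambda>j. F j x) \<longlonglongrightarrow> f x" for x using tendsto_uniform_limitI[OF lim] by simp
    then show "AE x in lborel. (\<lambda>j. g x * F (j + j0) x) \<longlonglongrightarrow> g x * f x"
      by (intro AE_I2 tendsto_mult tendsto_const LIMSEQ_ignore_initial_segment)
  qed simp_all
  then show ?thesis unfolding regular_dist_def by (rule LIMSEQ_offset)
qed

lemma regular_dist_tempered:
  fixes g :: "'a::euclidean_space \<Rightarrow> complex"
  assumes g: "integrable lborel g"
  shows "regular_dist g \<in> tempered_distributions"
  unfolding tempered_distributions_def
proof (intro CollectI conjI allI impI)
  show "linear_functional_on schwartz_functions (regular_dist g)" by (rule regular_dist_linear[OF g])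
  fix F :: "nat \<Rightarrow> 'a \<Rightarrow> complex" and f assume *: "range F \<subseteq> schwartz_functions \<and> f \<in> schwartz_functions \<and> schwartz_converges F f"
  then have f: "f \<in> schwartz_functions" and F: "F j \<in> schwartz_functions" for j by auto
  obtain C where "\<And>x. norm (f x) \<le> C" using schwartz_decay[OF f, of 0] by auto
  moreover have "uniform_limit UNIV F f sequentially"
  proof -
    have "[] \<in> lists (Basis :: 'a set)" by simp
    then have "uniform_limit UNIV (\<lambda>j x. (1 + norm x) ^ 0 *\<^sub>R iter_deriv [] (F j) x)
          (\<lambda>x. (1 + norm x) ^ 0 *\<^sub>R iter_deriv [] f x) sequentially"
      using * unfolding schwartz_converges_def by blast
    then show ?thesis by simp
  qed
  ultimately show "(\<lambda>j. regular_dist g (F j)) \<longlonglongrightarrow> regular_dist g f"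
    by (intro regular_dist_tendsto[OF g] smooth_measurable schwartz_smooth f F)
qed

text \<open>With \<open>n\<close> the dimension, the transform of a bump has size at most of order \<open>l ^ n\<close> and lives on
  frequencies up to about \<open>1 / l\<close>, where the weight is of order \<open>l powr (- r)\<close>. Derivatives up to order
  \<open>3 n\<close> are controlled: the decay that they give compensates the growth of the weight, of order at
  most \<open>n\<close>, and leaves \<open>2 n\<close> orders for integrability.\<close>

lemma H_norm_bump_le:
  fixes \<eta> :: "'a::euclidean_space \<Rightarrow> real"
  assumes \<eta>: "unif_cutoff \<eta>" and p: "2 \<le> p" and r: "0 \<le> r" "r \<le> real DIM('a)"
  obtains E where "E > 0"
    "\<And>l B z (g :: 'a \<Rightarrow> complex). 0 < l \<Longrightarrow> l \<le> 1 \<Longrightarrow> 0 < B \<Longrightarrow> g \<in> test_functions \<Longrightarrow>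
      deriv_bounded (3 * DIM('a)) l B g \<Longrightarrow> (\<And>y. y \<notin> ball z (2 * l) \<Longrightarrow> g y = 0) \<Longrightarrow>
      H_norm r p (regular_dist g) \<le> E * B * l powr (DIM('a) / p - r)"
proof -
  let ?n = "DIM('a)"
  define c where "c = fourier_const TYPE('a)"
  have c: "c > 0" by (simp add: c_def fourier_const_pos)
  define D where "D = c * (unit_ball_vol ?n * 2 ^ ?n * (2 * real ?n) ^ (3 * ?n))"
  have D: "D > 0" unfolding D_def using c unit_ball_vol_pos[of "real ?n"] by auto
  obtain E where E: "E > 0"
    "\<And>l A (m :: 'a \<Rightarrow> complex). 0 < l \<Longrightarrow> 0 < A \<Longrightarrow> m \<in> borel_measurable borel \<Longrightarrow>
      (\<And>\<xi>. norm (m \<xi>) \<le> A / (1 + l * norm \<xi>) ^ (2 * ?n)) \<Longrightarrow>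
      integrable lborel m \<and> inv_fourier m \<in> Lp_functions p \<and>
      Lp_norm p (inv_fourier m) \<le> E * A * l powr (?n / p - ?n)"
    using inv_fourier_Lp_bound[OF \<eta> p] by blast
  show thesis
  proof (rule that[of "E * D"])
    show "E * D > 0" using E D by simp
    fix l B z and g :: "'a \<Rightarrow> complex"
    assume l: "0 < l" "l \<le> 1" and B: "0 < B" and g: "g \<in> test_functions"
      and db: "deriv_bounded (3 * ?n) l B g" and supp: "\<And>y. y \<notin> ball z (2 * l) \<Longrightarrow> g y = 0"
    have gi: "integrable lborel g" by (intro schwartz_integrable test_functions_schwartz g)
    have gm: "g \<in> borel_measurable borel" using gi by auto
    define A where "A = D * B * l powr (?n - r)"
    have A: "A > 0" using D B l by (simp add: A_def)
    have bound: "norm (bessel_symbol r g \<xi>) \<le> A / (1 + l * norm \<xi>) ^ (2 * ?n)" for \<xi>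
    proof -
      have pos: "1 + l * norm \<xi> > 0" using l by (simp add: add_pos_nonneg)
      have "norm (fourier g \<xi>) = c * norm (osc (-1) g \<xi>)"
        using c by (simp add: fourier_osc norm_mult c_def)
      also have "\<dots> \<le> c * ((unit_ball_vol ?n * 2 ^ ?n * (2 * real ?n) ^ (3 * ?n)) * B * l ^ ?n / (1 + l * norm \<xi>) ^ (3 * ?n))"
        using c by (intro mult_left_mono osc_bump_decay[OF g db l(1) _ supp]) auto
      also have "\<dots> = D * B * l ^ ?n / (1 + l * norm \<xi>) ^ (3 * ?n)"
        by (simp add: D_def mult.assoc)
      finally have "norm (bessel_symbol r g \<xi>) \<le>
          (l powr (- r) * (1 + l * norm \<xi>) ^ ?n) * (D * B * l ^ ?n / (1 + l * norm \<xi>) ^ (3 * ?n))"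
        unfolding bessel_symbol_def norm_mult using norm_bessel_weight_le[OF l r] pos
        by (intro mult_mono) auto
      also have "(1 + l * norm \<xi>) ^ (3 * ?n) = (1 + l * norm \<xi>) ^ ?n * (1 + l * norm \<xi>) ^ (2 * ?n)"
        by (simp flip: power_add)
      also have "(l powr (- r) * (1 + l * norm \<xi>) ^ ?n) * (D * B * l ^ ?n / ((1 + l * norm \<xi>) ^ ?n * (1 + l * norm \<xi>) ^ (2 * ?n))) =
          (D * B * (l powr (- r) * l ^ ?n)) / (1 + l * norm \<xi>) ^ (2 * ?n)"
        using pos by simp
      also have "l powr (- r) * l ^ ?n = l powr (?n - r)"
        using l by (simp add: powr_add[symmetric] flip: powr_realpow)
      finally show ?thesis by (simp add: A_def)
    qed
    note Lp = E(2)[OF l(1) A bessel_symbol_measurable[OF gm] bound]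
    have "H_norm r p (regular_dist g) = Lp_norm p (inv_fourier (bessel_symbol r g))"
      unfolding H_norm_def using p Lp by (intro H0_norm_eq[OF \<eta>] bessel_J_generated[OF r gi]) auto
    also have "\<dots> \<le> E * A * l powr (?n / p - ?n)" using Lp by blast
    also have "\<dots> = E * D * B * (l powr (?n - r) * l powr (?n / p - ?n))" by (simp add: A_def)
    also have "l powr (?n - r) * l powr (?n / p - ?n) = l powr (?n / p - r)"
      unfolding powr_add[symmetric] by simp
    finally show "H_norm r p (regular_dist g) \<le> E * D * B * l powr (?n / p - r)" .
  qed
qed

lemma test_bessel_symbol:
  fixes \<eta> :: "'a::euclidean_space \<Rightarrow> real" and g :: "'a \<Rightarrow> complex"
  assumes \<eta>: "unif_cutoff \<eta>" and p: "2 \<le> p" and r: "0 \<le> r" "r \<le> real DIM('a)"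
    and g: "g \<in> test_functions"
  shows "integrable lborel (bessel_symbol r g)" "inv_fourier (bessel_symbol r g) \<in> Lp_functions p"
proof -
  let ?n = "DIM('a)"
  have gi: "integrable lborel g" by (intro schwartz_integrable test_functions_schwartz g)
  have gm: "g \<in> borel_measurable borel" using gi by auto
  define c where "c = fourier_const TYPE('a)"
  have c: "c > 0" by (simp add: c_def fourier_const_pos)
  obtain C where C: "C \<ge> 0" "\<And>x. norm (osc (-1) g x) \<le> C / (1 + norm x) ^ (3 * ?n)"
    using schwartz_osc_decay[OF test_functions_schwartz[OF g], of "-1" "3 * ?n"] by auto
  have "norm (bessel_symbol r g x) \<le> (c * C + 1) / (1 + 1 * norm x) ^ (2 * ?n)" for x
  proof -
    have pos: "1 + norm x > 0" by (simp add: add_pos_nonneg)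
    have "norm (bessel_symbol r g x) \<le> (1 + norm x) ^ ?n * (c * (C / (1 + norm x) ^ (3 * ?n)))"
      unfolding bessel_symbol_def norm_mult fourier_osc c_def[symmetric]
      using norm_bessel_weight_le[of 1 r ?n x] r C c
      by (intro mult_mono) auto
    also have "(1 + norm x) ^ (3 * ?n) = (1 + norm x) ^ ?n * (1 + norm x) ^ (2 * ?n)"
      by (simp flip: power_add)
    finally have "norm (bessel_symbol r g x) \<le> c * C / (1 + norm x) ^ (2 * ?n)" using pos by simp
    also have "\<dots> \<le> (c * C + 1) / (1 + 1 * norm x) ^ (2 * ?n)" using pos by (simp add: divide_right_mono)
    finally show ?thesis .
  qed
  moreover have "c * C + 1 > 0" using c C by (simp add: add_nonneg_pos)
  ultimately have "integrable lborel (bessel_symbol r g) \<and> inv_fourier (bessel_symbol r g) \<in> Lp_functions p"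
    using bessel_symbol_measurable[OF gm] zero_less_one inv_fourier_Lp_bound[OF \<eta> p] by metis
  then show "integrable lborel (bessel_symbol r g)" "inv_fourier (bessel_symbol r g) \<in> Lp_functions p" by auto
qed

lemma test_H_space:
  fixes \<eta> :: "'a::euclidean_space \<Rightarrow> real" and g :: "'a \<Rightarrow> complex"
  assumes \<eta>: "unif_cutoff \<eta>" and p: "2 \<le> p" and r: "0 \<le> r" "r \<le> real DIM('a)"
    and g: "g \<in> test_functions"
  shows "regular_dist g \<in> H_space r p"
proof -
  have gi: "integrable lborel g" by (intro schwartz_integrable test_functions_schwartz g)
  show ?thesis
    unfolding H_space_def H0_space_def
    using test_bessel_symbol[OF assms] bessel_J_generated[OF r gi] regular_dist_tempered[OF gi] by blast
qed

text \<open>For frequencies up to \<open>1 / (2 l)\<close> the phase varies by at most \<open>1\<close> from its value at \<open>z\<close> on the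
  support of \<open>\<gamma>\<close>. As \<open>1 \<le> pi / 3\<close>, its cosine is at least \<open>1 / 2\<close> after multiplication by a
  constant phase factor, and there is no cancellation in the integral.\<close>

lemma osc_bump_lower:
  fixes \<gamma> :: "'a::euclidean_space \<Rightarrow> real"
  assumes int: "integrable lborel (\<lambda>x. complex_of_real (\<gamma> x))" and l: "0 < l" and c: "0 \<le> c"
    and \<gamma>: "\<And>x. 0 \<le> \<gamma> x" "\<And>x. x \<in> ball z l \<Longrightarrow> \<gamma> x = c" "\<And>x. x \<notin> ball z (2 * l) \<Longrightarrow> \<gamma> x = 0"
    and \<xi>: "norm \<xi> \<le> 1 / (2 * l)" and \<sigma>: "\<bar>\<sigma>\<bar> = 1"
  shows "c * unit_ball_vol DIM('a) * l ^ DIM('a) / 2 \<le> norm (osc \<sigma> (\<lambda>x. complex_of_real (\<gamma> x)) \<xi>)"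
proof -
  have ri: "integrable lborel \<gamma>" using int by (simp only: complex_of_real_integrable_eq)
  let ?g = "\<lambda>x. complex_of_real (\<gamma> x)"
  have phase: "cis (\<sigma> * (\<xi> \<bullet> (y - z))) * w = cis (- \<sigma> * (\<xi> \<bullet> z)) * (cis (\<sigma> * (\<xi> \<bullet> y)) * w)" for y w
    by (simp add: cis_mult inner_diff_right right_diff_distrib flip: mult.assoc)
  have "c * unit_ball_vol DIM('a) * l ^ DIM('a) / 2 = (\<integral>y. c / 2 * indicator (ball z l) y \<partial>lborel)"
    using l content_ball[of l z] by simp
  also have "\<dots> \<le> (\<integral>y. Re (cis (\<sigma> * (\<xi> \<bullet> (y - z))) * ?g y) \<partial>lborel)"
  proof (rule integral_mono)
    show "integrable lborel (\<lambda>y. c / 2 * indicator (ball z l) y)"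
      using emeasure_bounded_finite[of "ball z l"] by (intro integrable_mult_right integrable_real_indicator) auto
    have "integrable lborel (\<lambda>y. cis (- \<sigma> * (\<xi> \<bullet> z)) * (cis (\<sigma> * (\<xi> \<bullet> y)) * ?g y))"
      by (intro integrable_mult_right integrable_osc int)
    then have "integrable lborel (\<lambda>y. cis (\<sigma> * (\<xi> \<bullet> (y - z))) * ?g y)"
      by (simp only: phase)
    then show "integrable lborel (\<lambda>y. Re (cis (\<sigma> * (\<xi> \<bullet> (y - z))) * ?g y))" by (rule integrable_Re)
    fix y
    show "c / 2 * indicator (ball z l) y \<le> Re (cis (\<sigma> * (\<xi> \<bullet> (y - z))) * ?g y)"
    proof (cases "y \<in> ball z (2 * l)")
      case True
      have "\<bar>\<sigma> * (\<xi> \<bullet> (y - z))\<bar> \<le> norm \<xi> * norm (y - z)"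
        using \<sigma> Cauchy_Schwarz_ineq2[of \<xi> "y - z"] by (simp add: abs_mult)
      also have "\<dots> \<le> (1 / (2 * l)) * (2 * l)"
        using \<xi> True l by (intro mult_mono) (auto simp: dist_norm norm_minus_commute)
      also have "\<dots> = 1" using l by simp
      finally have "\<bar>\<sigma> * (\<xi> \<bullet> (y - z))\<bar> \<le> pi / 3" using pi_gt3 by simp
      then have "cos (pi / 3) \<le> cos \<bar>\<sigma> * (\<xi> \<bullet> (y - z))\<bar>" by (intro cos_monotone_0_pi_le) auto
      then have cos: "1 / 2 \<le> cos (\<sigma> * (\<xi> \<bullet> (y - z)))" by (simp add: cos_60)
      have "c / 2 * indicator (ball z l) y \<le> 1 / 2 * \<gamma> y"
        using \<gamma>(1)[of y] \<gamma>(2)[of y] by (auto split: split_indicator)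
      also have "\<dots> \<le> cos (\<sigma> * (\<xi> \<bullet> (y - z))) * \<gamma> y" using cos \<gamma>(1) by (intro mult_right_mono)
      finally show ?thesis by simp
    next
      case False
      then have "y \<notin> ball z l" using l by auto
      then show ?thesis using \<gamma>(3)[OF False] by simp
    qed
  qed
  also have "\<dots> = Re (\<integral>y. cis (\<sigma> * (\<xi> \<bullet> (y - z))) * ?g y \<partial>lborel)"
  proof (rule integral_Re)
    have "integrable lborel (\<lambda>y. cis (- \<sigma> * (\<xi> \<bullet> z)) * (cis (\<sigma> * (\<xi> \<bullet> y)) * ?g y))"
      by (intro integrable_mult_right integrable_osc int)
    then show "integrable lborel (\<lambda>y. cis (\<sigma> * (\<xi> \<bullet> (y - z))) * ?g y)"
      by (simp only: phase)
  qed
  also have "(\<integral>y. cis (\<sigma> * (\<xi> \<bullet> (y - z))) * ?g y \<partial>lborel) = (\<integral>y. cis (- \<sigma> * (\<xi> \<bullet> z)) * (cis (\<sigma> * (\<xi> \<bullet> y)) * ?g y) \<partial>lborel)"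
    by (simp only: phase)
  also have "\<dots> = cis (- \<sigma> * (\<xi> \<bullet> z)) * osc \<sigma> ?g \<xi>" unfolding osc_def by (rule integral_mult_right_zero)
  also have "Re \<dots> \<le> norm (osc \<sigma> ?g \<xi>)"
    using complex_Re_le_cmod[of "cis (- \<sigma> * (\<xi> \<bullet> z)) * osc \<sigma> ?g \<xi>"] by (simp add: norm_mult)
  finally show ?thesis .
qed



text \<open>Let \<open>h\<close> be the Bessel potential of the bump \<open>g\<close>. The pairing of \<open>h\<close> with \<open>g\<close> equals the integral
  of the squared modulus of the transform of \<open>g\<close> against the weight, and by the Cauchy--Schwarz
  inequality it is at most the \<open>L2\<close> norm of \<open>h\<close> times that of \<open>g\<close>. The integral is bounded below by its
  part over a ball of frequencies of modulus between \<open>1 / (4 l)\<close> and \<open>1 / (2 l)\<close>: there the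
  transform is large, and so is the weight.\<close>

lemma H_norm_bump_ge:
  fixes \<eta> :: "'a::euclidean_space \<Rightarrow> real"
  assumes \<eta>: "unif_cutoff \<eta>" and r: "0 \<le> r" "r \<le> real DIM('a)"
  obtains G where "G > 0"
    "\<And>l c z (\<gamma> :: 'a \<Rightarrow> real). 0 < l \<Longrightarrow> 0 < c \<Longrightarrow> (\<lambda>x. complex_of_real (\<gamma> x)) \<in> test_functions \<Longrightarrow>
      (\<And>x. 0 \<le> \<gamma> x \<and> \<gamma> x \<le> c) \<Longrightarrow> (\<And>x. x \<in> ball z l \<Longrightarrow> \<gamma> x = c) \<Longrightarrow>
      (\<And>x. x \<notin> ball z (2 * l) \<Longrightarrow> \<gamma> x = 0) \<Longrightarrow>
      G * c * l powr (real DIM('a) / 2 - r) \<le> H_norm r 2 (regular_dist (\<lambda>x. complex_of_real (\<gamma> x)))"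
proof -
  let ?n = "DIM('a)"
  define V where "V = unit_ball_vol ?n"
  define c0 where "c0 = fourier_const TYPE('a)"
  have V: "V > 0" by (simp add: V_def)
  have c0: "c0 > 0" by (simp add: c0_def fourier_const_pos)
  \<comment> \<open>Two factors \<open>V\<close> come from the squared transform of the bump, and the factor \<open>V / 8 ^ n\<close> from a ball
    of frequencies of radius \<open>1 / (8 l)\<close>.\<close>
  define G0 where "G0 = c0 * (c0 * (4 powr (- r) * (V ^ 3 / (4 * 8 ^ ?n))))"
  have G0: "G0 > 0" using V c0 by (simp add: G0_def)
  define G where "G = G0 / sqrt (V * 2 ^ ?n)"
  show thesis
  proof (rule that[of G])
    show "G > 0" using G0 V by (simp add: G_def)
    fix l c z and \<gamma> :: "'a \<Rightarrow> real"
    assume l: "0 < l" and c: "0 < c" and g: "(\<lambda>x. complex_of_real (\<gamma> x)) \<in> test_functions"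
      and \<gamma>: "\<And>x. 0 \<le> \<gamma> x \<and> \<gamma> x \<le> c" "\<And>x. x \<in> ball z l \<Longrightarrow> \<gamma> x = c"
        "\<And>x. x \<notin> ball z (2 * l) \<Longrightarrow> \<gamma> x = 0"
    define g where "g x = complex_of_real (\<gamma> x)" for x
    have gt: "g \<in> test_functions" using g by (simp add: g_def[abs_def])
    have gi: "integrable lborel g" by (intro schwartz_integrable test_functions_schwartz gt)
    have [measurable]: "g \<in> borel_measurable borel" using gi by auto
    define m where "m = bessel_symbol r g"
    define h where "h = inv_fourier m"
    have mi: "integrable lborel m" and hL: "h \<in> Lp_functions 2"
      using test_bessel_symbol[OF \<eta> _ r gt, of 2] by (auto simp: m_def h_def)
    have [measurable]: "h \<in> borel_measurable borel" using hL by (simp add: Lp_functions_def)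
    define N where "N = H_norm r 2 (regular_dist g)"
    have "H_norm r 2 (regular_dist g) = Lp_norm 2 h"
      unfolding H_norm_def using bessel_J_generated[OF r gi] mi hL
      by (intro H0_norm_eq[OF \<eta>]) (auto simp: m_def h_def)
    then have N: "N = sqrt (\<integral>x. (norm (h x))\<^sup>2 \<partial>lborel)"
      unfolding N_def Lp_norm_def by (simp add: powr_half_sqrt)
    have hi: "integrable lborel (\<lambda>x. (norm (h x))\<^sup>2)" using hL by (simp add: Lp_functions_def)

    \<comment> \<open>The integrand of the pairing on the Fourier side; \<open>g\<close> is real, so the two transforms of \<open>g\<close>
      occurring in it are complex conjugates.\<close>
    define W where "W \<xi> = (1 + (norm \<xi>)\<^sup>2) powr (r / 2) * (c0 * (norm (osc (-1) g \<xi>))\<^sup>2)" for \<xi>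
    have cnj_osc: "osc 1 g \<xi> = cnj (osc (-1) g \<xi>)" for \<xi>
    proof -
      have "osc 1 g \<xi> = (\<integral>y. cnj (cis (-1 * (\<xi> \<bullet> y)) * g y) \<partial>lborel)"
        unfolding osc_def by (simp add: cis_cnj g_def del: Bochner_Integration.integral_cnj)
      then show ?thesis by (simp only: osc_def[of "-1"] Bochner_Integration.integral_cnj)
    qed
    have mW: "m \<xi> * osc 1 g \<xi> = complex_of_real (W \<xi>)" for \<xi>
      unfolding m_def bessel_symbol_def bessel_weight_def fourier_osc cnj_osc W_def c0_def[symmetric]
      using complex_norm_square[of "osc (-1) g \<xi>"] by (simp add: mult_ac)
    have "integrable lborel (\<lambda>\<xi>. osc 1 g \<xi> * m \<xi>)" by (rule integrable_osc_mult[OF gi mi])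
    then have Wi: "integrable lborel W"
      using mW by (simp add: mult.commute complex_of_real_integrable_eq)
    define J where "J = (\<integral>\<xi>. W \<xi> \<partial>lborel)"
    have pair: "(\<integral>x. h x * g x \<partial>lborel) = complex_of_real (c0 * J)"
    proof -
      have "(\<integral>x. h x * g x \<partial>lborel) = (\<integral>x. c0 * (osc 1 m x * g x) \<partial>lborel)"
        by (simp add: h_def inv_fourier_osc c0_def mult_ac)
      also have "\<dots> = c0 * (\<integral>x. m x * osc 1 g x \<partial>lborel)"
        by (simp add: osc_mult_integral[OF mi gi])
      finally show ?thesis unfolding mW J_def by simp
    qed

    have J: "G0 / c0 * c\<^sup>2 * l powr (real ?n - r) \<le> J"
    proof -
      obtain b :: 'a where b: "b \<in> Basis" using nonempty_Basis by blast
      define S where "S = ball ((3 / (8 * l)) *\<^sub>R b) (1 / (8 * l))"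
      have S: "1 / (4 * l) \<le> norm \<xi>" "norm \<xi> \<le> 1 / (2 * l)" if "\<xi> \<in> S" for \<xi>
      proof -
        have d: "norm ((3 / (8 * l)) *\<^sub>R b - \<xi>) < 1 / (8 * l)" using that by (simp add: S_def dist_norm)
        have nb: "norm ((3 / (8 * l)) *\<^sub>R b) = 3 * (1 / (8 * l))" using b l by simp
        have e: "1 / (4 * l) = 2 * (1 / (8 * l))" "1 / (2 * l) = 4 * (1 / (8 * l))" by auto
        show "1 / (4 * l) \<le> norm \<xi>"
          using d nb norm_triangle_sub[of "(3 / (8 * l)) *\<^sub>R b" \<xi>] unfolding e by linarith
        show "norm \<xi> \<le> 1 / (2 * l)"
          using d nb norm_triangle_sub[of \<xi> "(3 / (8 * l)) *\<^sub>R b"] unfolding e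
          by (simp only: norm_minus_commute[of \<xi>])
      qed
      define w where "w = (1 / (4 * l)) powr r * (c0 * (c * V * l ^ ?n / 2)\<^sup>2)"
      have "w * indicator S \<xi> \<le> W \<xi>" for \<xi>
      proof (cases "\<xi> \<in> S")
        case True
        have "(1 / (4 * l)) powr r \<le> norm \<xi> powr r"
          using S[OF True] l r by (intro powr_mono2) auto
        also have "\<dots> = ((norm \<xi>)\<^sup>2) powr (r / 2)"
          by (cases "\<xi> = 0") (simp_all add: powr_powr flip: powr_numeral)
        also have "\<dots> \<le> (1 + (norm \<xi>)\<^sup>2) powr (r / 2)" using r by (intro powr_mono2) auto
        finally have 1: "(1 / (4 * l)) powr r \<le> (1 + (norm \<xi>)\<^sup>2) powr (r / 2)" .
        have "c * V * l ^ ?n / 2 \<le> norm (osc (-1) g \<xi>)"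
          unfolding V_def g_def[abs_def]
          by (rule osc_bump_lower[where z=z]) (use gi l c \<gamma> S[OF True] in \<open>auto simp: g_def[abs_def]\<close>)
        then have "(c * V * l ^ ?n / 2)\<^sup>2 \<le> (norm (osc (-1) g \<xi>))\<^sup>2"
          using c V l by (intro power_mono) auto
        then show ?thesis
          unfolding W_def w_def using 1 True c0 by (simp add: mult_mono)
      next
        case False
        then show ?thesis unfolding W_def using c0 by simp
      qed
      moreover have "integrable lborel (\<lambda>\<xi>. w * indicator S \<xi>)"
        unfolding S_def using emeasure_bounded_finite[of "ball ((3 / (8 * l)) *\<^sub>R b) (1 / (8 * l))"]
        by (intro integrable_mult_right integrable_real_indicator) auto
      ultimately have "(\<integral>\<xi>. w * indicator S \<xi> \<partial>lborel) \<le> J"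
        unfolding J_def by (intro integral_mono Wi)
      moreover have "(\<integral>\<xi>. w * indicator S \<xi> \<partial>lborel) = w * (V * (1 / (8 * l)) ^ ?n)"
        using l content_ball[of "1 / (8 * l)" "(3 / (8 * l)) *\<^sub>R b"] by (simp add: S_def V_def)
      moreover have "w * (V * (1 / (8 * l)) ^ ?n) = G0 / c0 * c\<^sup>2 * l powr (real ?n - r)"
      proof -
        have 1: "(1 / (4 * l)) powr r = 4 powr (- r) * l powr (- r)"
        proof -
          have "(1 / (4 * l)) powr r = (4 * l) powr (- r)"
            using l by (simp add: powr_minus_divide powr_divide)
          also have "\<dots> = 4 powr (- r) * l powr (- r)" by (rule powr_mult)
          finally show ?thesis .
        qed
        have 2: "l powr (real ?n - r) = l powr (- r) * l ^ ?n"
          using l by (simp add: powr_add[symmetric] flip: powr_realpow)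
        have 3: "(1 / (8 * l)) ^ ?n = 1 / (8 ^ ?n * l ^ ?n)"
          by (simp add: power_divide power_mult_distrib)
        have 4: "a * b * (c0 * (c * V * y / 2)\<^sup>2) * (V * (1 / (e * y))) =
            c0 * (c0 * (a * (V ^ 3 / (4 * e)))) / c0 * c\<^sup>2 * (b * y)" if "y > 0" "e > 0" for a b y e :: real
          using that c0 by (simp add: power2_eq_square power3_eq_cube)
        show ?thesis unfolding w_def G0_def 1 2 3 by (rule 4) (use l in auto)
      qed
      ultimately show ?thesis by simp
    qed

    \<comment> \<open>An upper bound for the \<open>L2\<close> norm of \<open>g\<close>.\<close>
    define q where "q = c * sqrt (V * 2 ^ ?n) * l powr (real ?n / 2)"
    have q: "q > 0" using c V l by (simp add: q_def)
    have q2: "q\<^sup>2 = c\<^sup>2 * (V * (2 * l) ^ ?n)"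
    proof -
      have "(l powr (real ?n / 2))\<^sup>2 = l ^ ?n" using l by (simp add: powr_powr flip: powr_numeral powr_realpow)
      then show ?thesis using V by (simp add: q_def power_mult_distrib mult_ac)
    qed
    have CS: "c0 * J \<le> N * q"
    proof -
      have "ennreal (c0 * J) \<le> ennreal (norm (\<integral>x. h x * g x \<partial>lborel))"
        unfolding pair norm_of_real by (intro ennreal_leI abs_ge_self)
      also have "\<dots> \<le> (\<integral>\<^sup>+x. norm (h x * g x) \<partial>lborel)"
      proof (cases "integrable lborel (\<lambda>x. h x * g x)")
        case True
        then show ?thesis by (rule integral_norm_bound_ennreal)
      next
        case False
        then show ?thesis by (simp add: not_integrable_integral_eq)
      qed
      also have "\<dots> = (\<integral>\<^sup>+x. ennreal (norm (h x)) * ennreal (norm (g x)) \<partial>lborel)"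
        by (simp add: norm_mult ennreal_mult)
      finally have "(ennreal (c0 * J))\<^sup>2 \<le> (\<integral>\<^sup>+x. ennreal (norm (h x)) * ennreal (norm (g x)) \<partial>lborel)\<^sup>2"
        by (rule power_mono) simp
      also have "\<dots> \<le> (\<integral>\<^sup>+x. ennreal (norm (h x)) ^ 2 \<partial>lborel) * (\<integral>\<^sup>+x. ennreal (norm (g x)) ^ 2 \<partial>lborel)"
        by (rule Cauchy_Schwarz_nn_integral) auto
      also have "(\<integral>\<^sup>+x. ennreal (norm (h x)) ^ 2 \<partial>lborel) = ennreal (N\<^sup>2)"
        unfolding N using hi by (simp add: ennreal_power nn_integral_eq_integral)
      also have "(\<integral>\<^sup>+x. ennreal (norm (g x)) ^ 2 \<partial>lborel) \<le> (\<integral>\<^sup>+x. ennreal (c\<^sup>2) * indicator (cball z (2 * l)) x \<partial>lborel)"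
      proof (intro nn_integral_mono)
        fix x
        show "ennreal (norm (g x)) ^ 2 \<le> ennreal (c\<^sup>2) * indicator (cball z (2 * l)) x"
        proof (cases "x \<in> cball z (2 * l)")
          case True
          then show ?thesis using \<gamma>(1)[of x] by (simp add: g_def ennreal_power power_mono ennreal_leI)
        next
          case False
          then have "\<gamma> x = 0" by (intro \<gamma>(3)) auto
          then show ?thesis by (simp add: g_def)
        qed
      qed
      also have "\<dots> = ennreal (c\<^sup>2) * ennreal (V * (2 * l) ^ ?n)"
        using l by (subst nn_integral_cmult_indicator) (auto simp: emeasure_cball V_def)
      also have "\<dots> = ennreal (q\<^sup>2)" unfolding q2 using V l by (intro ennreal_mult[symmetric]) auto
      finally have "(ennreal (c0 * J))\<^sup>2 \<le> ennreal ((N * q)\<^sup>2)"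
        by (simp add: mult_left_mono ennreal_mult power_mult_distrib)
      moreover have J0: "J \<ge> 0"
        unfolding J_def W_def using c0 by (intro integral_nonneg_AE) auto
      moreover have "N \<ge> 0" unfolding N by (simp add: integral_nonneg_AE)
      ultimately have "(c0 * J)\<^sup>2 \<le> (N * q)\<^sup>2" using c0 q by (simp add: ennreal_power)
      then show ?thesis by (rule power2_le_imp_le) (use \<open>N \<ge> 0\<close> q in simp)
    qed
    have "(G * c * l powr (real ?n / 2 - r)) * q = c0 * (G0 / c0 * c\<^sup>2 * l powr (real ?n - r))"
    proof -
      have "l powr (real ?n / 2 - r) * l powr (real ?n / 2) = l powr (real ?n - r)"
        unfolding powr_add[symmetric] by simp
      moreover have "G * sqrt (V * 2 ^ ?n) = G0" unfolding G_def using V by simp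
      ultimately show ?thesis unfolding q_def using c0 by (simp add: power2_eq_square mult_ac) 
    qed
    also have "\<dots> \<le> c0 * J" using J c0 by (intro mult_left_mono) auto
    also have "\<dots> \<le> N * q" by (rule CS)
    finally show "G * c * l powr (real ?n / 2 - r) \<le> H_norm r 2 (regular_dist (\<lambda>x. complex_of_real (\<gamma> x)))"
      using q unfolding N_def g_def[abs_def] by simp
  qed
qed



section \<open>Regular distributions with locally smooth density\<close>

lemma mult_dist_regular: "mult_dist f (regular_dist U) = regular_dist (\<lambda>x. f x * U x)"
  by (simp add: mult_dist_def regular_dist_def fun_eq_iff mult_ac)

text \<open>On test functions supported in a fixed compact set, \<open>U\<close> may be replaced by its product with a
  cutoff, which is integrable.\<close>

lemma regular_dist_distribution:
  fixes \<eta> :: "'a::euclidean_space \<Rightarrow> real" and U :: "'a \<Rightarrow> complex"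
  assumes \<eta>: "unif_cutoff \<eta>" and U: "\<And>f. f \<in> test_functions \<Longrightarrow> (\<lambda>x. f x * U x) \<in> test_functions"
  shows "regular_dist U \<in> distributions"
proof -
  have loc: "\<exists>h. integrable lborel h \<and> (\<forall>\<phi>. (\<forall>x. \<phi> x \<noteq> 0 \<longrightarrow> x \<in> K) \<longrightarrow> regular_dist U \<phi> = regular_dist h \<phi>)"
    if K: "compact K" for K
  proof -
    obtain \<kappa> where \<kappa>: "(\<lambda>x. complex_of_real (\<kappa> x)) \<in> test_functions" "\<And>x. x \<in> K \<Longrightarrow> \<kappa> x = 1"
      using compact_cutoff[OF \<eta> K open_UNIV] by (metis subset_UNIV)
    have "regular_dist U \<phi> = regular_dist (\<lambda>x. complex_of_real (\<kappa> x) * U x) \<phi>" if "\<forall>x. \<phi> x \<noteq> 0 \<longrightarrow> x \<in> K" for \<phi>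
      unfolding regular_dist_def
    proof (intro Bochner_Integration.integral_cong refl)
      show "U x * \<phi> x = complex_of_real (\<kappa> x) * U x * \<phi> x" for x
        using that \<kappa>(2)[of x] by (cases "\<phi> x = 0") auto
    qed
    then show ?thesis
      using schwartz_integrable[OF test_functions_schwartz[OF U[OF \<kappa>(1)]]] by blast
  qed
  show ?thesis
    unfolding distributions_def
  proof (intro CollectI conjI allI impI)
    show "linear_functional_on test_functions (regular_dist U)"
      unfolding linear_functional_on_def
    proof (intro ballI allI)
      fix f g :: "'a \<Rightarrow> complex" and a b assume fg: "f \<in> test_functions" "g \<in> test_functions"
      obtain R where R: "\<And>x. f x \<noteq> 0 \<Longrightarrow> norm x \<le> R" using test_functionsE[OF fg(1)] by metis
      obtain S where S: "\<And>x. g x \<noteq> 0 \<Longrightarrow> norm x \<le> S" using test_functionsE[OF fg(2)] by metis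
      define K where "K = cball (0::'a) (max R S)"
      obtain h where h: "integrable lborel h"
        "\<And>\<phi>. (\<forall>x. \<phi> x \<noteq> 0 \<longrightarrow> x \<in> K) \<Longrightarrow> regular_dist U \<phi> = regular_dist h \<phi>"
        using loc[of K] unfolding K_def by auto
      have "linear_functional_on test_functions (regular_dist h)"
        by (rule regular_dist_linear[OF h(1) test_functions_schwartz])
      then have "regular_dist h (\<lambda>x. a * f x + b * g x) = a * regular_dist h f + b * regular_dist h g"
        using fg by (simp add: linear_functional_on_def)
      moreover have "f x \<noteq> 0 \<Longrightarrow> x \<in> K" "g x \<noteq> 0 \<Longrightarrow> x \<in> K" for x
        using R[of x] S[of x] by (auto simp: K_def)
      then have "regular_dist U f = regular_dist h f" "regular_dist U g = regular_dist h g"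
        "regular_dist U (\<lambda>x. a * f x + b * g x) = regular_dist h (\<lambda>x. a * f x + b * g x)"
        by (intro h(2); force)+
      ultimately show "regular_dist U (\<lambda>x. a * f x + b * g x) = a * regular_dist U f + b * regular_dist U g"
        by simp
    qed
    fix F :: "nat \<Rightarrow> 'a \<Rightarrow> complex" and f
    assume *: "range F \<subseteq> test_functions \<and> f \<in> test_functions \<and> test_converges F f"
    then have f: "f \<in> test_functions" and F: "F j \<in> test_functions" for j by auto
    obtain K where K: "compact K" "\<And>j. fun_support (F j) \<subseteq> K" using * by (auto simp: test_converges_def)
    have "[] \<in> lists (Basis :: 'a set)" by simp
    then have "uniform_limit UNIV (\<lambda>j. iter_deriv [] (F j)) (iter_deriv [] f) sequentially"
      using * unfolding test_converges_def by blast
    then have lim: "uniform_limit UNIV F f sequentially" by simp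
    have FK: "F j x = 0" if "x \<notin> K" for j x
      using that K(2)[of j] closure_subset[of "{x. F j x \<noteq> 0}"] unfolding fun_support_def by blast
    have fK: "f x = 0" if "x \<notin> K" for x
    proof -
      have "(\<lambda>j. F j x) \<longlonglongrightarrow> f x" using tendsto_uniform_limitI[OF lim] by simp
      then show ?thesis using FK[OF that] by (simp add: LIMSEQ_const_iff)
    qed
    obtain h where h: "integrable lborel h"
      "\<And>\<phi>. (\<forall>x. \<phi> x \<noteq> 0 \<longrightarrow> x \<in> K) \<Longrightarrow> regular_dist U \<phi> = regular_dist h \<phi>"
      using loc[OF K(1)] by auto
    obtain C where "\<And>x. norm (f x) \<le> C"
      using schwartz_decay[OF test_functions_schwartz[OF f], of 0] by auto
    then have "(\<lambda>j. regular_dist h (F j)) \<longlonglongrightarrow> regular_dist h f"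
      by (intro regular_dist_tendsto[OF h(1)] smooth_measurable schwartz_smooth test_functions_schwartz f F lim)
    moreover have "regular_dist U f = regular_dist h f" "regular_dist U (F j) = regular_dist h (F j)" for j
      using FK fK by (intro h(2); blast)+
    ultimately show "(\<lambda>j. regular_dist U (F j)) \<longlonglongrightarrow> regular_dist U f" by simp
  qed
qed

section \<open>The counterexample\<close>

text \<open>The bumps have supports of radius at most \<open>2\<close>, as have the cutoffs \<open>\<eta> (x - z)\<close> of the uniformly
  localised norm; centres at mutual distance \<open>10\<close> therefore ensure that such a cutoff meets at most
  one bump.\<close>

definition bump_width :: "nat \<Rightarrow> real" where
  "bump_width k = 1 / real (Suc k)"

definition bump_centre :: "'a::euclidean_space itself \<Rightarrow> nat \<Rightarrow> 'a" where
  "bump_centre _ k = (10 * real (Suc k)) *\<^sub>R (SOME b. b \<in> Basis)"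

definition bump :: "('a::euclidean_space \<Rightarrow> real) \<Rightarrow> nat \<Rightarrow> 'a \<Rightarrow> real" where
  "bump \<eta> k x = \<eta> ((x - bump_centre TYPE('a) k) /\<^sub>R bump_width k)"

definition bump_series :: "('a::euclidean_space \<Rightarrow> real) \<Rightarrow> (nat \<Rightarrow> real) \<Rightarrow> 'a \<Rightarrow> complex" where
  "bump_series \<eta> a x = complex_of_real (\<Sum>k. a k * bump \<eta> k x)"

lemma bump_width_bounds: "0 < bump_width k" "bump_width k \<le> 1"
  by (auto simp: bump_width_def)

lemma norm_SOME_Basis: "norm (SOME b::'a::euclidean_space. b \<in> Basis) = 1"
  using someI_ex[of "\<lambda>b::'a. b \<in> Basis"] nonempty_Basis by (metis ex_in_conv norm_Basis)

lemma dist_bump_centre: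
  assumes "j \<noteq> k"
  shows "10 \<le> dist (bump_centre TYPE('a::euclidean_space) j) (bump_centre TYPE('a) k)"
proof -
  have "dist (bump_centre TYPE('a) j) (bump_centre TYPE('a) k) = \<bar>10 * real (Suc j) - 10 * real (Suc k)\<bar>"
    unfolding bump_centre_def dist_norm scaleR_diff_left[symmetric] norm_scaleR norm_SOME_Basis by simp
  then show ?thesis using assms by (cases j k rule: linorder_cases) auto
qed

lemma norm_bump_centre: "norm (bump_centre TYPE('a::euclidean_space) k) = 10 * real (Suc k)"
  by (simp add: bump_centre_def norm_SOME_Basis)

lemma
  fixes \<eta> :: "'a::euclidean_space \<Rightarrow> real"
  assumes \<eta>: "unif_cutoff \<eta>"
  shows bump_test: "(\<lambda>x. complex_of_real (bump \<eta> k x)) \<in> test_functions"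
    and bump_bounds: "0 \<le> bump \<eta> k x" "bump \<eta> k x \<le> 1"
    and bump_eq_1: "x \<in> ball (bump_centre TYPE('a) k) (bump_width k) \<Longrightarrow> bump \<eta> k x = 1"
    and bump_eq_0: "x \<notin> ball (bump_centre TYPE('a) k) (2 * bump_width k) \<Longrightarrow> bump \<eta> k x = 0"
proof -
  let ?z = "bump_centre TYPE('a) k"
  note l = bump_width_bounds(1)[of k]
  show "(\<lambda>x. complex_of_real (bump \<eta> k x)) \<in> test_functions"
    unfolding bump_def
    by (rule test_functions_affine[where f="\<lambda>x. complex_of_real (\<eta> x)", OF unif_cutoff_test[OF \<eta>]]) (use l in simp)
  show "0 \<le> bump \<eta> k x" "bump \<eta> k x \<le> 1" using unif_cutoff_bounds[OF \<eta>] by (auto simp: bump_def)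
  have n: "norm ((x - ?z) /\<^sub>R bump_width k) = dist ?z x / bump_width k"
    using l by (simp add: dist_norm norm_minus_commute divide_inverse_commute)
  show "bump \<eta> k x = 1" if "x \<in> ball ?z (bump_width k)"
    unfolding bump_def using that l by (intro unif_cutoff_eq_1[OF \<eta>]) (simp only: n pos_divide_less_eq, simp)
  show "bump \<eta> k x = 0" if "x \<notin> ball ?z (2 * bump_width k)"
    unfolding bump_def using that l by (intro unif_cutoff_eq_0[OF \<eta>]) (simp only: n pos_le_divide_eq, simp)
qed

lemma bump_dist:
  fixes \<eta> :: "'a::euclidean_space \<Rightarrow> real"
  assumes \<eta>: "unif_cutoff \<eta>" and "bump \<eta> k x \<noteq> 0"
  shows "dist (bump_centre TYPE('a) k) x < 2"
proof -
  have "x \<in> ball (bump_centre TYPE('a) k) (2 * bump_width k)" using bump_eq_0[OF \<eta>] assms(2) by blast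
  then show ?thesis using bump_width_bounds(2)[of k] by simp
qed

lemma bump_disjoint:
  fixes \<eta> :: "'a::euclidean_space \<Rightarrow> real"
  assumes \<eta>: "unif_cutoff \<eta>" and "bump \<eta> j x \<noteq> 0" "bump \<eta> k y \<noteq> 0" "dist x y < 4"
  shows "j = k"
proof (rule ccontr)
  assume "j \<noteq> k"
  from dist_bump_centre[OF this, where 'a='a] show False
    using bump_dist[OF \<eta> assms(2)] bump_dist[OF \<eta> assms(3)] assms(4)
      dist_triangle[of "bump_centre TYPE('a) j" "bump_centre TYPE('a) k" x]
      dist_triangle[of x "bump_centre TYPE('a) k" y] dist_commute[of y "bump_centre TYPE('a) k"]
    by linarith
qed

lemma bump_series_single:
  fixes \<eta> :: "'a::euclidean_space \<Rightarrow> real"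
  assumes "\<And>j. j \<noteq> k \<Longrightarrow> bump \<eta> j x = 0"
  shows "bump_series \<eta> a x = complex_of_real (a k * bump \<eta> k x)"
proof -
  have "(\<Sum>j. a j * bump \<eta> j x) = (\<Sum>j\<in>{k}. a j * bump \<eta> j x)"
    by (rule suminf_finite) (use assms in auto)
  then show ?thesis by (simp add: bump_series_def)
qed

text \<open>Only finitely many bumps meet the support of \<open>f\<close>.\<close>

lemma bump_series_mult_test:
  fixes \<eta> :: "'a::euclidean_space \<Rightarrow> real"
  assumes \<eta>: "unif_cutoff \<eta>" and f: "f \<in> test_functions"
  shows "(\<lambda>x. f x * bump_series \<eta> a x) \<in> test_functions"
proof -
  obtain R where R: "\<And>x. f x \<noteq> 0 \<Longrightarrow> norm x \<le> R" using test_functionsE[OF f] by metis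
  obtain N :: nat where N: "R < real N" using reals_Archimedean2 by blast
  have "f x * bump_series \<eta> a x = f x * (\<Sum>k<N. complex_of_real (a k) * complex_of_real (bump \<eta> k x))" for x
  proof (cases "f x = 0")
    case False
    have "bump \<eta> k x = 0" if "k \<ge> N" for k
    proof (rule ccontr)
      assume "bump \<eta> k x \<noteq> 0"
      then have "10 * real (Suc k) < norm x + 2"
        using bump_dist[OF \<eta>, of k x] norm_triangle_sub[of "bump_centre TYPE('a) k" x]
        by (simp add: dist_norm norm_bump_centre)
      then show False using R[OF False] N that by simp
    qed
    then have "(\<Sum>k. a k * bump \<eta> k x) = (\<Sum>k<N. a k * bump \<eta> k x)"
      by (intro suminf_finite) auto
    then show ?thesis by (simp add: bump_series_def)
  qed simp
  then have eq: "(\<lambda>x. f x * bump_series \<eta> a x) = (\<lambda>x. f x * (\<Sum>k<N. complex_of_real (a k) * complex_of_real (bump \<eta> k x)))"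
    by (rule ext)
  show ?thesis
    unfolding eq using bump_test[OF \<eta>]
    by (intro test_functions_mult[OF f] smooth_sum smooth_mult smooth_const) (simp add: test_functions_def)
qed

lemma bump_deriv_bounded:
  fixes \<eta> :: "'a::euclidean_space \<Rightarrow> real"
  assumes "deriv_bounded N 1 A (\<lambda>x. complex_of_real (\<eta> x))"
  shows "deriv_bounded N (bump_width k) A (\<lambda>x. complex_of_real (bump \<eta> k x))"
  unfolding bump_def by (rule deriv_bounded_affine[OF assms bump_width_bounds(1)])

lemma bump_series_cutoff:
  fixes \<eta> :: "'a::euclidean_space \<Rightarrow> real"
  assumes \<eta>: "unif_cutoff \<eta>"
  obtains k where "\<And>x. complex_of_real (\<eta> (x - z)) * bump_series \<eta> a x =
    complex_of_real (a k) * (complex_of_real (\<eta> (x - z)) * complex_of_real (bump \<eta> k x))"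
proof -
  have small: "dist x y < 4" if "\<eta> (x - z) \<noteq> 0" "\<eta> (y - z) \<noteq> 0" for x y
  proof -
    have "norm (x - z) < 2" "norm (y - z) < 2" using that unif_cutoff_eq_0[OF \<eta>] not_le by blast+
    then show ?thesis using norm_triangle_ineq4[of "x - z" "y - z"] by (simp add: dist_norm)
  qed
  \<comment> \<open>If the cutoff meets no bump at all, then \<open>k\<close> is arbitrary and both sides below vanish.\<close>
  define k where "k = (SOME k. \<exists>y. \<eta> (y - z) \<noteq> 0 \<and> bump \<eta> k y \<noteq> 0)"
  have uniq: "j = k" if "\<eta> (x - z) \<noteq> 0" "bump \<eta> j x \<noteq> 0" for j x
  proof -
    have "\<exists>y. \<eta> (y - z) \<noteq> 0 \<and> bump \<eta> k y \<noteq> 0" unfolding k_def by (rule someI[of _ j]) (use that in blast)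
    then show ?thesis using bump_disjoint[OF \<eta> that(2)] small[OF that(1)] by blast
  qed
  have "complex_of_real (\<eta> (x - z)) * bump_series \<eta> a x =
    complex_of_real (a k) * (complex_of_real (\<eta> (x - z)) * complex_of_real (bump \<eta> k x))" for x
  proof (cases "\<eta> (x - z) = 0")
    case False
    have "bump_series \<eta> a x = complex_of_real (a k * bump \<eta> k x)"
      by (rule bump_series_single) (use uniq[OF False] in blast)
    then show ?thesis by (simp only: of_real_mult mult_ac)
  qed simp
  then show thesis by (rule that)
qed

lemma bump_mult_series:
  fixes \<eta> :: "'a::euclidean_space \<Rightarrow> real"
  assumes \<eta>: "unif_cutoff \<eta>"
  shows "complex_of_real (bump \<eta> k x) * bump_series \<eta> a x = complex_of_real (a k * (bump \<eta> k x)\<^sup>2)"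
proof (cases "bump \<eta> k x = 0")
  case False
  have "bump \<eta> j x = 0" if "j \<noteq> k" for j
    using bump_disjoint[OF \<eta> _ False, of j x] that by fastforce
  then show ?thesis using bump_series_single[of k \<eta> x a] by (simp add: power2_eq_square mult_ac)
qed simp

text \<open>The heights \<open>bump_width k powr (t - n / p)\<close> normalise the bumps in the Bessel potential space of
  order \<open>t\<close> and exponent \<open>p\<close>. Testing the multiplier inequality on the \<open>k\<close>-th bump would bound
  \<open>(k + 1) powr (n / p - s)\<close>, whose exponent is positive.\<close>

theorem unif_bessel_not_multiplier:
  fixes \<eta> :: "'a::euclidean_space \<Rightarrow> real" and s t p :: real
  assumes \<eta>: "unif_cutoff \<eta>" and s: "0 < s" "s \<le> real DIM('a)" and t: "0 < t" "t \<le> real DIM('a)"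
    and p: "2 \<le> p" "p < real DIM('a) / s"
  shows "\<exists>u. u \<in> H_unif \<eta> t p - multipliers s 2 t 2"
proof -
  let ?n = "real DIM('a)"
  let ?e = "\<lambda>k x. complex_of_real (bump \<eta> k x)"
  define a where "a k = bump_width k powr (t - ?n / p)" for k
  have a: "a k > 0" for k using bump_width_bounds(1)[of k] by (simp add: a_def)
  define U where "U = bump_series \<eta> a"
  define u where "u = regular_dist U"
  note l = bump_width_bounds
  note U_test = bump_series_mult_test[OF \<eta>, of _ a, folded U_def]
  obtain A where A: "A > 0" "deriv_bounded (3 * DIM('a)) 1 A (\<lambda>x. complex_of_real (\<eta> x))"
    using test_functions_deriv_bounded[OF unif_cutoff_test[OF \<eta>]] by blast
  have "u \<in> H_loc t p"
    unfolding H_loc_def u_def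
    using t by (auto simp: mult_dist_regular intro!: regular_dist_distribution[OF \<eta>] U_test test_H_space[OF \<eta> p(1)])
  moreover have "H_unif_norm \<eta> t p u < \<infinity>"
  proof -
    obtain E where E: "E > 0"
      "\<And>l B z (g :: 'a \<Rightarrow> complex). 0 < l \<Longrightarrow> l \<le> 1 \<Longrightarrow> 0 < B \<Longrightarrow> g \<in> test_functions \<Longrightarrow>
        deriv_bounded (3 * DIM('a)) l B g \<Longrightarrow> (\<And>y. y \<notin> ball z (2 * l) \<Longrightarrow> g y = 0) \<Longrightarrow>
        H_norm t p (regular_dist g) \<le> E * B * l powr (DIM('a) / p - t)"
      using H_norm_bump_le[OF \<eta> p(1), of t] t by auto
    let ?A = "2 ^ (3 * DIM('a)) * A * A"
    have "H_norm t p (mult_dist (\<lambda>x. complex_of_real (\<eta> (x - z))) u) \<le> E * ?A" for z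
    proof -
      let ?z = "\<lambda>x. complex_of_real (\<eta> (x - z))"
      obtain k where k: "\<And>x. ?z x * U x = complex_of_real (a k) * (?z x * ?e k x)"
        using bump_series_cutoff[OF \<eta>] unfolding U_def by blast
      define g where "g x = complex_of_real (a k) * (?z x * ?e k x)" for x
      have z_eq: "?z = (\<lambda>x. complex_of_real (\<eta> ((x - z) /\<^sub>R 1)))" by simp
      have zb: "deriv_bounded (3 * DIM('a)) 1 A ?z"
        unfolding z_eq by (rule deriv_bounded_affine[OF A(2)]) simp
      have zt: "?z \<in> test_functions"
        unfolding z_eq by (rule test_functions_affine[where f="\<lambda>x. complex_of_real (\<eta> x)", OF unif_cutoff_test[OF \<eta>]]) simp
      have "mult_dist ?z u = regular_dist g"
        unfolding u_def mult_dist_regular by (simp add: k g_def[abs_def])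
      moreover have "H_norm t p (regular_dist g) \<le> E * (norm (complex_of_real (a k)) * ?A) * bump_width k powr (DIM('a) / p - t)"
      proof (rule E(2)[OF l])
        show "g \<in> test_functions"
          unfolding g_def using bump_test[OF \<eta>]
          by (intro test_functions_scale test_functions_mult zt) (simp add: test_functions_def)
        show "deriv_bounded (3 * DIM('a)) (bump_width k) (norm (complex_of_real (a k)) * ?A) g"
          unfolding g_def
          by (intro deriv_bounded_scale deriv_bounded_mult deriv_bounded_finer_scale[OF zb] bump_deriv_bounded A l)
        show "g y = 0" if "y \<notin> ball (bump_centre TYPE('a) k) (2 * bump_width k)" for y
          using bump_eq_0[OF \<eta> that] by (simp add: g_def)
        show "0 < norm (complex_of_real (a k)) * ?A" using a[of k] A by simp
      qed
      moreover have "norm (complex_of_real (a k)) * bump_width k powr (DIM('a) / p - t) = 1"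
      proof -
        have "a k * bump_width k powr (DIM('a) / p - t) = 1"
          unfolding a_def powr_add[symmetric] using l(1)[of k] by simp
        then show ?thesis using a[of k] by simp
      qed
      moreover have "E * (norm (complex_of_real (a k)) * ?A) * bump_width k powr (DIM('a) / p - t) =
          E * ?A * (norm (complex_of_real (a k)) * bump_width k powr (DIM('a) / p - t))"
        by (simp only: mult_ac)
      ultimately show ?thesis by (simp only: mult_1_right)
    qed
    then have "H_unif_norm \<eta> t p u \<le> ennreal (E * ?A)"
      unfolding H_unif_norm_def by (intro SUP_least ennreal_leI)
    then show ?thesis using ennreal_less_top order_le_less_trans by fastforce
  qed
  moreover have "u \<notin> multipliers s 2 t 2"
  proof
    assume "u \<in> multipliers s 2 t 2"
    then obtain C where C: "C \<ge> 0"
      "\<And>f. f \<in> test_functions \<Longrightarrow> H_norm t 2 (mult_dist f u) \<le> C * H_norm s 2 (regular_dist f)"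
      by (auto simp: multipliers_def)
    obtain E where E: "E > 0"
      "\<And>l B z (g :: 'a \<Rightarrow> complex). 0 < l \<Longrightarrow> l \<le> 1 \<Longrightarrow> 0 < B \<Longrightarrow> g \<in> test_functions \<Longrightarrow>
        deriv_bounded (3 * DIM('a)) l B g \<Longrightarrow> (\<And>y. y \<notin> ball z (2 * l) \<Longrightarrow> g y = 0) \<Longrightarrow>
        H_norm s 2 (regular_dist g) \<le> E * B * l powr (DIM('a) / 2 - s)"
      using H_norm_bump_le[OF \<eta>, of 2 s] s by auto
    obtain G where G: "G > 0"
      "\<And>l c z (\<gamma> :: 'a \<Rightarrow> real). 0 < l \<Longrightarrow> 0 < c \<Longrightarrow> (\<lambda>x. complex_of_real (\<gamma> x)) \<in> test_functions \<Longrightarrow>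
        (\<And>x. 0 \<le> \<gamma> x \<and> \<gamma> x \<le> c) \<Longrightarrow> (\<And>x. x \<in> ball z l \<Longrightarrow> \<gamma> x = c) \<Longrightarrow>
        (\<And>x. x \<notin> ball z (2 * l) \<Longrightarrow> \<gamma> x = 0) \<Longrightarrow>
        G * c * l powr (?n / 2 - t) \<le> H_norm t 2 (regular_dist (\<lambda>x. complex_of_real (\<gamma> x)))"
      by (rule H_norm_bump_ge[OF \<eta> less_imp_le[OF t(1)] t(2)]) blast
    define \<delta> where "\<delta> = ?n / p - s"
    have \<delta>: "\<delta> > 0" using p s by (simp add: \<delta>_def field_simps)
    have bound: "real (Suc k) powr \<delta> \<le> C * E * A / G" for k
    proof -
      let ?l = "bump_width k"
      have "mult_dist (?e k) u = regular_dist (\<lambda>x. complex_of_real (a k * (bump \<eta> k x)\<^sup>2))"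
        unfolding u_def mult_dist_regular U_def by (simp only: bump_mult_series[OF \<eta>])
      moreover have "G * a k * ?l powr (?n / 2 - t) \<le> H_norm t 2 (regular_dist (\<lambda>x. complex_of_real (a k * (bump \<eta> k x)\<^sup>2)))"
      proof (rule G(2)[OF l(1) a])
        show "(\<lambda>x. complex_of_real (a k * (bump \<eta> k x)\<^sup>2)) \<in> test_functions"
          using U_test[OF bump_test[OF \<eta>], of k] by (simp only: U_def bump_mult_series[OF \<eta>])
        show "0 \<le> a k * (bump \<eta> k x)\<^sup>2 \<and> a k * (bump \<eta> k x)\<^sup>2 \<le> a k" for x
          using a[of k] bump_bounds[OF \<eta>, of k x] by (simp add: mult_left_le power_le_one)
        show "a k * (bump \<eta> k x)\<^sup>2 = a k" if "x \<in> ball (bump_centre TYPE('a) k) ?l" for x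
          using bump_eq_1[OF \<eta> that] by simp
        show "a k * (bump \<eta> k x)\<^sup>2 = 0" if "x \<notin> ball (bump_centre TYPE('a) k) (2 * ?l)" for x
          using bump_eq_0[OF \<eta> that] by simp
      qed
      moreover have "H_norm s 2 (regular_dist (?e k)) \<le> E * A * ?l powr (?n / 2 - s)"
        by (rule E(2)[OF l A(1) bump_test[OF \<eta>] bump_deriv_bounded[OF A(2)]]) (use bump_eq_0[OF \<eta>] in simp)
      ultimately have "G * a k * ?l powr (?n / 2 - t) \<le> C * (E * A * ?l powr (?n / 2 - s))"
        using C(2)[OF bump_test[OF \<eta>], of k] C(1) mult_left_mono by fastforce
      also have "G * a k * ?l powr (?n / 2 - t) = G * (?l powr (?n / 2 - s) * ?l powr (- \<delta>))"
        unfolding a_def mult.assoc powr_add[symmetric] by (simp add: \<delta>_def)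
      finally have "G * ?l powr (- \<delta>) * ?l powr (?n / 2 - s) \<le> C * E * A * ?l powr (?n / 2 - s)"
        by (simp add: mult_ac)
      then have "G * ?l powr (- \<delta>) \<le> C * E * A" using l(1)[of k] by simp
      moreover have "?l powr (- \<delta>) = real (Suc k) powr \<delta>"
        by (simp add: bump_width_def powr_minus_divide powr_divide)
      ultimately show ?thesis using G(1) by (simp add: pos_le_divide_eq mult.commute)
    qed
    define M where "M = C * E * A / G"
    have M: "M \<ge> 0" using C(1) E(1) A(1) G(1) by (simp add: M_def)
    obtain k :: nat where "M powr (1 / \<delta>) < real k" using reals_Archimedean2 by blast
    then have "(M powr (1 / \<delta>)) powr \<delta> < real (Suc k) powr \<delta>" using \<delta> by (intro powr_less_mono2) auto
    then have "M < real (Suc k) powr \<delta>" using \<delta> M by (simp add: powr_powr)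
    then show False using bound[of k] by (simp add: M_def)
  qed
  ultimately show ?thesis by (auto simp: H_unif_def)
qed

theorem theorem5:
  fixes s t \<epsilon> :: real and \<eta> :: "real ^ 'n \<Rightarrow> real"
  assumes "unif_cutoff \<eta>"
    and "0 < s" and "s < real CARD('n) / 2"
    and "0 < t" and "t < real CARD('n) / 2"
    and "t < s"
    and "0 < \<epsilon>" and "\<epsilon> < real CARD('n) / s - 2"
  shows "\<exists>u. u \<in> H_unif \<eta> t (real CARD('n) / s - \<epsilon>) - multipliers s 2 t 2"
  using assms by (intro unif_bessel_not_multiplier) auto


end
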